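(* Assume: (i) $Y_h\subset Y$ $(h>0)$ are closed subspaces such that $\bigcup_{h>0}Y_h$ is dense in $Y$; (ii) $\phi_h(y)=\phi(y)$ if $y\in Y_h$ and $\phi_h(y)=\infty$ otherwise; (iii) $\psi_h:Y\to(-\infty,\infty]$ are convex, proper, lower semicontinuous and positively $1$-homogeneous, and $\psi_h\to\psi$ in the Mosco sense in $Y$ as $h\to0$; (iv) $\phi(y)\ge\frac{\alpha}{2}|y|^2$ for all $y\in C_h-C_h$, where $C_h=D(\psi_h)$; (v) $\ell_h:[0,T]\to Y^*$ are Lipschitz continuous uniformly in $h$, and $\ell_h(t)\to\ell(t)$ strongly in $Y^*$ for every $t\in[0,T]$; (vi) $y_{0,h}\in Y_h$ and $y_{0,h}\to y_0$ in $Y$. Let $y_h\in W^{1,1}(0,T;Y)$ satisfy $F_h(y_h)=0$ for every $h$. Then, as $h\to0$, $y_h\to y$ weakly star in $W^{1,\infty}(0,T;Y)$, where $F(y)=0$.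
   Context: Let $T>0$ and let $Y$ be a separable reflexive real Banach space with norm $|\cdot|$, dual $Y^*$, and duality pairing $\langle\cdot,\cdot\rangle$ between $Y^*$ and $Y$. Let $\psi:Y\to[0,\infty]$ be proper, convex, lower semicontinuous and positively $1$-homogeneous; $C=D(\psi)=\{y:\psi(y)<\infty\}$; $\psi^*(w)=\sup_{v\in Y}(\langle w,v\rangle-\psi(v))$ is the conjugate, i.e. the indicator function of the closed convex set $C^*=\partial\psi(0)\subset Y^*$. Let $A:Y\to Y^*$ be linear, continuous and symmetric, $\phi(y)=\frac12\langle Ay,y\rangle$, and assume there is $\alpha>0$ with $\phi(y)\ge\frac{\alpha}{2}|y|^2$ for all $y\in C$. Let $\chi(y)=\phi(y)+|y|^2$, and assume $\chi\ge 0$ on $Y$ with $\chi(y)=0$ iff $y=0$. Let $\ell\in W^{1,\infty}(0,T;Y^* )$ and let $y_0\in C$ be stable at time $0$, i.e. $\ell(0)-Ay_0\in C^*$. Define on $W^{1,1}(0,T;Y)$ $$F(y)=\int_0^T\big(\psi(y')+\psi^*(\ell-Ay)-\langle\ell-Ay,y'\rangle\big)\,dt+\chi(y(0)-y_0),$$ $$F_h(y)=\int_0^T\big(\psi_h(y')+\psi_h^*(\ell_h-A_hy)-\langle\ell_h-A_hy,y'\rangle\big)\,dt+\chi_h(y(0)-y_{0,h}),$$ where $\chi_h(\cdot)=\phi_h(\cdot)+|\cdot|^2$, and $A_h$ has domain $Y_h$ with $A_hy=Ay$ for $y\in Y_h$ (so $F_h(y)=\infty$ unless $y(t)\in Y_h$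 for a.e. $t$). Mosco convergence $f_h\to f$ in $Y$ means: for all $y\in Y$, $f(y)\le\liminf_h f_h(y_h)$ whenever $y_h\to y$ weakly in $Y$, and there exist $y_h\to y$ strongly in $Y$ with $f(y)=\limsup_h f_h(y_h)$. *)

theory Defs
  imports "HOL-Analysis.Analysis"
begin

type_synonym 'a dual = "'a \<Rightarrow>\<^sub>L real"

definition reflexive_space :: "'a::real_normed_vector itself \<Rightarrow> bool" where
  "reflexive_space _ \<longleftrightarrow> (\<forall>\<Phi> :: 'a dual dual. \<exists>y::'a. \<forall>w. blinfun_apply \<Phi> w = blinfun_apply w y)"

definition weakly_tendsto :: "('i \<Rightarrow> 'a::real_normed_vector) \<Rightarrow> 'a \<Rightarrow> 'i filter \<Rightarrow> bool" where
  "weakly_tendsto u y F \<longleftrightarrow>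
     (\<forall>w :: 'a dual. ((\<lambda>h. blinfun_apply w (u h)) \<longlongrightarrow> blinfun_apply w y) F)"

definition Mosco_tendsto ::
  "('i \<Rightarrow> 'a::real_normed_vector \<Rightarrow> ereal) \<Rightarrow> ('a \<Rightarrow> ereal) \<Rightarrow> 'i filter \<Rightarrow> bool" where
  "Mosco_tendsto fh f F \<longleftrightarrow>
     (\<forall>y u. weakly_tendsto u y F \<longrightarrow> f y \<le> Liminf F (\<lambda>h. fh h (u h))) \<and>
     (\<forall>y. \<exists>u. (u \<longlongrightarrow> y) F \<and> f y = Limsup F (\<lambda>h. fh h (u h)))"


section \<open>Extended-real-valued convex functions\<close>

definition eff_dom :: "('a \<Rightarrow> ereal) \<Rightarrow> 'a set" where
  "eff_dom f = {y. f y < \<infinity>}"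

definition proper_fun :: "('a \<Rightarrow> ereal) \<Rightarrow> bool" where
  "proper_fun f \<longleftrightarrow> (\<forall>y. f y \<noteq> -\<infinity>) \<and> eff_dom f \<noteq> {}"

definition convex_fun :: "('a::real_vector \<Rightarrow> ereal) \<Rightarrow> bool" where
  "convex_fun f \<longleftrightarrow> (\<forall>x y c. 0 < c \<and> c < 1 \<longrightarrow>
     f ((1 - c) *\<^sub>R x + c *\<^sub>R y) \<le> ereal (1 - c) * f x + ereal c * f y)"

definition lsc_fun :: "('a::topological_space \<Rightarrow> ereal) \<Rightarrow> bool" where
  "lsc_fun f \<longleftrightarrow> (\<forall>x. f x \<le> Liminf (at x) f)"

definition pos_homogeneous :: "('a::real_vector \<Rightarrow> ereal) \<Rightarrow> bool" where
  "pos_homogeneous f \<longleftrightarrow> (\<forall>c y. 0 < c \<longrightarrow> f (c *\<^sub>R y) = ereal c * f y)"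

definition conjugate :: "('a::real_normed_vector \<Rightarrow> ereal) \<Rightarrow> 'a dual \<Rightarrow> ereal" where
  "conjugate f w = (SUP v. ereal (blinfun_apply w v) - f v)"

definition subdifferential :: "('a::real_normed_vector \<Rightarrow> ereal) \<Rightarrow> 'a \<Rightarrow> 'a dual set" where
  "subdifferential f x =
     {w. x \<in> eff_dom f \<and> (\<forall>v. f x + ereal (blinfun_apply w (v - x)) \<le> f v)}"


section \<open>Bochner integral in an arbitrary normed space\<close>

text \<open>The library's Bochner integral is restricted to second countable types, and the type
  of functionals \<open>'a dual\<close> is not an instance of that class (even where, as for a separable
  reflexive space, the dual is separable). The following is the library definition without
  the class constraint.\<close>

definition Bochner_has_integral ::
  "'s measure \<Rightarrow> ('s \<Rightarrow> 'b::real_normed_vector) \<Rightarrow> 'b \<Rightarrow> bool" where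
  "Bochner_has_integral M f x \<longleftrightarrow> f \<in> borel_measurable M \<and>
     (\<exists>s. (\<forall>i. Bochner_Integration.simple_bochner_integrable M (s i)) \<and>
          (\<lambda>i::nat. \<integral>\<^sup>+t. ennreal (norm (f t - s i t)) \<partial>M) \<longlonglongrightarrow> 0 \<and>
          (\<lambda>i. Bochner_Integration.simple_bochner_integral M (s i)) \<longlonglongrightarrow> x)"

definition Bochner_integrable :: "'s measure \<Rightarrow> ('s \<Rightarrow> 'b::real_normed_vector) \<Rightarrow> bool" where
  "Bochner_integrable M f \<longleftrightarrow> (\<exists>x. Bochner_has_integral M f x)"

definition Bochner_integral :: "'s measure \<Rightarrow> ('s \<Rightarrow> 'b::real_normed_vector) \<Rightarrow> 'b" where
  "Bochner_integral M f =
     (if \<exists>x. Bochner_has_integral M f x then THE x. Bochner_has_integral M f x else 0)"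

lemma Bochner_has_integral_eq:
  fixes f :: "'s \<Rightarrow> 'b::{real_normed_vector, second_countable_topology}"
  shows "Bochner_has_integral M f x \<longleftrightarrow> has_bochner_integral M f x"
  by (auto simp: Bochner_has_integral_def has_bochner_integral.simps)

lemma Bochner_integrable_eq:
  fixes f :: "'s \<Rightarrow> 'b::{real_normed_vector, second_countable_topology}"
  shows "Bochner_integrable M f \<longleftrightarrow> integrable M f"
  by (simp add: Bochner_integrable_def Bochner_has_integral_eq integrable.simps)

lemma Bochner_integral_eq:
  fixes f :: "'s \<Rightarrow> 'b::{banach, second_countable_topology}"
  shows "Bochner_integral M f = integral\<^sup>L M f"
proof -
  have "Bochner_has_integral M f = has_bochner_integral M f"
    by (simp add: fun_eq_iff Bochner_has_integral_eq)
  then show ?thesis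
    by (simp add: Bochner_integral_def lebesgue_integral_def)
qed


section \<open>Vector-valued Sobolev spaces on a bounded interval\<close>

abbreviation Leb :: "real \<Rightarrow> real measure" where
  "Leb T \<equiv> lebesgue_on {0<..<T}"

text \<open>Continuously differentiable functions with compact support in \<open>(0,T)\<close>.\<close>

definition test_functions :: "real \<Rightarrow> (real \<Rightarrow> real) set" where
  "test_functions T = {\<eta>. \<eta> C1_differentiable_on UNIV \<and>
     (\<exists>K. compact K \<and> K \<subseteq> {0<..<T} \<and> (\<forall>t. t \<notin> K \<longrightarrow> \<eta> t = 0))}"

definition is_weak_deriv ::
  "real \<Rightarrow> (real \<Rightarrow> 'b::real_normed_vector) \<Rightarrow> (real \<Rightarrow> 'b) \<Rightarrow> bool" where
  "is_weak_deriv T u g \<longleftrightarrow> (\<forall>\<eta> \<in> test_functions T.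
     Bochner_integral (Leb T) (\<lambda>t. deriv \<eta> t *\<^sub>R u t) =
       - Bochner_integral (Leb T) (\<lambda>t. \<eta> t *\<^sub>R g t))"

text \<open>An element of \<open>W\<^sup>1\<^sup>,\<^sup>p(0,T;B)\<close> is represented by its continuous representative on \<open>[0,T]\<close>
  (unique there), so that \<open>u 0\<close> is its trace at 0 and membership of \<open>u\<close> itself in \<open>L\<^sup>p\<close> is
  automatic; values outside \<open>[0,T]\<close> are irrelevant. In \<open>W1inf\<close>, integrability of the
  derivative adds only strong measurability to essential boundedness, since \<open>(0,T)\<close> has
  finite measure.\<close>

definition W11 :: "real \<Rightarrow> (real \<Rightarrow> 'b::real_normed_vector) set" where
  "W11 T = {u. continuous_on {0..T} u \<and>
     (\<exists>g. Bochner_integrable (Leb T) g \<and> is_weak_deriv T u g)}"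

definition W1inf :: "real \<Rightarrow> (real \<Rightarrow> 'b::real_normed_vector) set" where
  "W1inf T = {u. continuous_on {0..T} u \<and>
     (\<exists>g. Bochner_integrable (Leb T) g \<and> (\<exists>K. AE t in Leb T. norm (g t) \<le> K) \<and>
          is_weak_deriv T u g)}"

text \<open>A representative of \<open>u'\<close>; it is determined up to a null set for \<open>u \<in> W11 T\<close>.\<close>

definition weak_deriv :: "real \<Rightarrow> (real \<Rightarrow> 'b::real_normed_vector) \<Rightarrow> real \<Rightarrow> 'b" where
  "weak_deriv T u = (SOME g. Bochner_integrable (Leb T) g \<and> is_weak_deriv T u g)"

text \<open>Weak star convergence in \<open>W\<^sup>1\<^sup>,\<^sup>\<infinity>(0,T;Y)\<close> for reflexive \<open>Y\<close>: weak star convergence of the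
  functions and of their derivatives in \<open>L\<^sup>\<infinity>(0,T;Y)\<close>, the dual of \<open>L\<^sup>1(0,T;Y\<^sup>*)\<close>.\<close>

definition weak_star_tendsto_W1inf ::
  "real \<Rightarrow> ('i \<Rightarrow> real \<Rightarrow> 'a::real_normed_vector) \<Rightarrow> (real \<Rightarrow> 'a) \<Rightarrow> 'i filter \<Rightarrow> bool" where
  "weak_star_tendsto_W1inf T uh u F \<longleftrightarrow>
     (\<forall>g :: real \<Rightarrow> 'a dual. Bochner_integrable (Leb T) g \<longrightarrow>
        ((\<lambda>h. \<integral>t. blinfun_apply (g t) (uh h t) \<partial>Leb T)
           \<longlongrightarrow> (\<integral>t. blinfun_apply (g t) (u t) \<partial>Leb T)) F \<and>
        ((\<lambda>h. \<integral>t. blinfun_apply (g t) (weak_deriv T (uh h) t) \<partial>Leb T)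
           \<longlongrightarrow> (\<integral>t. blinfun_apply (g t) (weak_deriv T u t) \<partial>Leb T)) F)"


section \<open>The functionals\<close>

definition ereal_integral :: "'s measure \<Rightarrow> ('s \<Rightarrow> ereal) \<Rightarrow> ereal" where
  "ereal_integral M f =
     enn2ereal (\<integral>\<^sup>+t. e2ennreal (f t) \<partial>M) - enn2ereal (\<integral>\<^sup>+t. e2ennreal (- f t) \<partial>M)"

definition phi :: "('a::real_normed_vector \<Rightarrow>\<^sub>L 'a dual) \<Rightarrow> 'a \<Rightarrow> real" where
  "phi A y = 1 / 2 * blinfun_apply (blinfun_apply A y) y"

definition chi :: "('a::real_normed_vector \<Rightarrow>\<^sub>L 'a dual) \<Rightarrow> 'a \<Rightarrow> real" where
  "chi A y = phi A y + (norm y)\<^sup>2"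

definition phi_on :: "'a::real_normed_vector set \<Rightarrow> ('a \<Rightarrow>\<^sub>L 'a dual) \<Rightarrow> 'a \<Rightarrow> ereal" where
  "phi_on Yh A y = (if y \<in> Yh then ereal (phi A y) else \<infinity>)"

definition chi_on :: "'a::real_normed_vector set \<Rightarrow> ('a \<Rightarrow>\<^sub>L 'a dual) \<Rightarrow> 'a \<Rightarrow> ereal" where
  "chi_on Yh A y = phi_on Yh A y + ereal ((norm y)\<^sup>2)"

text \<open>By Fenchel's inequality the integrand is nonnegative whenever \<open>\<psi>\<close> is proper.\<close>

definition Fenchel_integral :: "real \<Rightarrow> ('a::real_normed_vector \<Rightarrow> ereal) \<Rightarrow>
    ('a \<Rightarrow>\<^sub>L 'a dual) \<Rightarrow> (real \<Rightarrow> 'a dual) \<Rightarrow> (real \<Rightarrow> 'a) \<Rightarrow> ereal" where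
  "Fenchel_integral T \<psi> A l y = ereal_integral (Leb T) (\<lambda>t.
     \<psi> (weak_deriv T y t) + conjugate \<psi> (l t - blinfun_apply A (y t))
       - ereal (blinfun_apply (l t - blinfun_apply A (y t)) (weak_deriv T y t)))"

definition F_fun :: "real \<Rightarrow> ('a::real_normed_vector \<Rightarrow> ereal) \<Rightarrow>
    ('a \<Rightarrow>\<^sub>L 'a dual) \<Rightarrow> (real \<Rightarrow> 'a dual) \<Rightarrow> 'a \<Rightarrow> (real \<Rightarrow> 'a) \<Rightarrow> ereal" where
  "F_fun T \<psi> A l y0 y = Fenchel_integral T \<psi> A l y + ereal (chi A (y 0 - y0))"

text \<open>The first case distinction encodes that the operator \<open>A\<^sub>h\<close> is \<open>A\<close> with domain \<open>Y\<^sub>h\<close>.\<close>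

definition Fh_fun :: "real \<Rightarrow> 'a::real_normed_vector set \<Rightarrow> ('a \<Rightarrow> ereal) \<Rightarrow>
    ('a \<Rightarrow>\<^sub>L 'a dual) \<Rightarrow> (real \<Rightarrow> 'a dual) \<Rightarrow> 'a \<Rightarrow> (real \<Rightarrow> 'a) \<Rightarrow> ereal" where
  "Fh_fun T Yh \<psi>h A lh y0h y =
     (if AE t in Leb T. y t \<in> Yh
      then Fenchel_integral T \<psi>h A lh y + chi_on Yh A (y 0 - y0h)
      else \<infinity>)"

end

theory Submission
  imports Defs "HOL-Library.Diagonal_Subsequence" "HOL-Real_Asymp.Real_Asymp"
begin

text \<open>
  If \<open>F\<^sub>h(y\<^sub>h) = 0\<close>, then the Fenchel equality holds almost everywhere: the force \<open>w\<^sub>h = l\<^sub>h - A y\<^sub>h\<close> is stable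
  (below \<open>\<psi>\<^sub>h\<close>) at all times and \<open>\<psi>\<^sub>h(y\<^sub>h') = \<langle>w\<^sub>h, y\<^sub>h'\<rangle>\<close>. Testing stability at time \<open>s\<close> with \<open>y\<^sub>h'(r)\<close> gives
  \<open>\<phi>(y\<^sub>h(t) - y\<^sub>h(s)) \<le> \<integral>\<^sub>s\<^sup>t \<langle>l\<^sub>h(r) - l\<^sub>h(s), y\<^sub>h'(r)\<rangle> dr\<close>, and integration by parts with the coercivity of \<open>\<phi>\<close>
  makes the \<open>y\<^sub>h\<close> uniformly Lipschitz. Weak compactness yields sequences converging weakly at every time.
  Stability passes to the limit with the help of recovery sequences, while the dissipated energies
  \<open>\<integral>\<^sub>0\<^sup>t \<psi>\<^sub>h(y\<^sub>h')\<close> converge to \<open>E(t) = \<integral>\<^sub>0\<^sup>t \<langle>l - A y, y'\<rangle>\<close>: the upper bound is the weak lower semicontinuity of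
  \<open>\<phi>\<close> along \<open>C\<^sub>h - C\<^sub>h\<close>, the lower bound follows from the stability of the limit. Hence
  \<open>\<psi>(y(t) - y(s)) \<le> E(t) - E(s)\<close>, and dividing by \<open>t - s\<close> gives the limit inclusion at the points of weak
  differentiability of \<open>y\<close>. The limit problem has at most one solution, so the whole family converges.
\<close>

section \<open>Separation of convex sets and weak compactness\<close>

text \<open>Velocities converge only weakly, so neither the quadratic power
  \<open>\<langle>A y, y'\<rangle>\<close> nor the dissipation passes to the limit directly. The
  power is the time derivative of \<open>phi A (y t)\<close>, which leaves values at fixed times;
  the dissipation over an interval dominates, by Jensen's inequality, its value at the increment of
  the solution. Mosco convergence is therefore applied to increments, never under an integral sign.
  A second obstacle is that \<open>phi\<close> is not assumed convex or coercive on the whole space: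
  every use of coercivity has to be arranged so that it sees a difference of two elements of one
  effective domain. To return from increments to velocities, the derivative of a Lipschitz function
  must be a weak limit of difference quotients; it is built from dyadic quotients tested against
  countably many functionals that determine the norm. The loads take values in the dual and are
  never differentiated: pairings in time are compared with one-point quadratures on short intervals,
  and the errors are summed over a fine partition.\<close>

definition sublinear :: "('a::real_vector \<Rightarrow> real) \<Rightarrow> bool" where
  "sublinear p \<longleftrightarrow> (\<forall>x y. p (x + y) \<le> p x + p y) \<and> (\<forall>c x. 0 < c \<longrightarrow> p (c *\<^sub>R x) \<le> c * p x)"

lemma sublinear_add: "sublinear p \<Longrightarrow> p (x + y) \<le> p x + p y"
  and sublinear_scale_le: "sublinear p \<Longrightarrow> 0 < c \<Longrightarrow> p (c *\<^sub>R x) \<le> c * p x"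
  by (auto simp: sublinear_def)

lemma sublinear_scale:
  assumes "sublinear p" "0 < c"
  shows "p (c *\<^sub>R x) = c * p x"
proof (rule antisym)
  have "p ((1 / c) *\<^sub>R c *\<^sub>R x) \<le> (1 / c) * p (c *\<^sub>R x)"
    using assms by (intro sublinear_scale_le) auto
  then show "c * p x \<le> p (c *\<^sub>R x)"
    using assms by (simp add: field_simps)
qed (use assms sublinear_scale_le in auto)

lemma sublinear_zero: "sublinear p \<Longrightarrow> p 0 = 0"
  using sublinear_scale[of p 2 0] by simp

lemma sublinear_neg: "sublinear p \<Longrightarrow> - p (- x) \<le> p x"
  using sublinear_add[of p x "- x"] sublinear_zero[of p] by simp

text \<open>A minimal element \<open>m\<close> below \<open>p\<close> is linear: the sublinear function
  \<open>x \<mapsto> inf\<^sub>t (m (x + t y) - t m y)\<close> lies below \<open>m\<close>, hence equals it.\<close>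

lemma sublinear_majorizes_linear:
  fixes p :: "'a::real_vector \<Rightarrow> real"
  assumes p: "sublinear p"
  shows "\<exists>f. linear f \<and> (\<forall>x. f x \<le> p x)"
proof -
  define S where "S = {q :: 'a \<Rightarrow> real. sublinear q \<and> q \<le> p}"
  define P where "P = (\<lambda>q r :: 'a \<Rightarrow> real. r \<le> q)"
  have "\<exists>m\<in>S. \<forall>q\<in>S. P m q \<longrightarrow> q = m"
  proof (rule predicate_Zorn)
    show "partial_order_on S (relation_of P S)"
      by (rule partial_order_on_relation_ofI) (auto simp: P_def)
  next
    fix C assume C: "C \<in> Chains (relation_of P S)"
    show "\<exists>u\<in>S. \<forall>a\<in>C. P a u"
    proof (cases "C = {}")
      case True
      then show ?thesis using p by (auto simp: S_def)
    next
      case False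
      have CS: "sublinear q" "q \<le> p" if "q \<in> C" for q
        using C that by (auto simp: Chains_def relation_of_def S_def)
      have tot: "q \<le> r \<or> r \<le> q" if "q \<in> C" "r \<in> C" for q r
        using C that by (auto simp: Chains_def relation_of_def P_def)
      define u where "u = (\<lambda>x. INF q\<in>C. q x)"
      \<comment> \<open>Each \<open>q \<le> p\<close> in the chain satisfies
        \<open>q x \<ge> - q (- x) \<ge> - p (- x)\<close>, so the pointwise infimum is
        finite.\<close>
      have bdd: "bdd_below ((\<lambda>q. q x) ` C)" for x
      proof (rule bdd_belowI2)
        fix q assume q: "q \<in> C"
        show "- p (- x) \<le> q x"
          using sublinear_neg[OF CS(1)[OF q], of x] CS(2)[OF q] by (auto simp: le_fun_def intro: order_trans[rotated])
      qed
      have u_le: "u x \<le> q x" if "q \<in> C" for q x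
        unfolding u_def by (rule cINF_lower[OF bdd that])
      have le_u: "b \<le> u x" if "\<And>q. q \<in> C \<Longrightarrow> b \<le> q x" for b x
        unfolding u_def using that False by (intro cINF_greatest) auto
      have "sublinear u"
        unfolding sublinear_def
      proof (intro conjI allI impI)
        fix x y
        \<comment> \<open>The chain is totally ordered, so the smaller of \<open>q\<close> and
          \<open>r\<close> serves at both points, and its subadditivity is enough.\<close>
        have *: "u (x + y) \<le> q x + r y" if qr: "q \<in> C" "r \<in> C" for q r
        proof (cases "q \<le> r")
          case True
          then have "q y \<le> r y" by (simp add: le_fun_def)
          then show ?thesis
            using u_le[OF qr(1), of "x + y"] sublinear_add[OF CS(1)[OF qr(1)], of x y] by linarith
        next
          case False
          then have "r \<le> q" using tot[OF qr] by blast
          then have "r x \<le> q x" by (rule le_funD)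
          then show ?thesis
            using u_le[OF qr(2), of "x + y"] sublinear_add[OF CS(1)[OF qr(2)], of x y] by linarith
        qed
        have "u (x + y) - r y \<le> u x" if "r \<in> C" for r
          using *[OF _ that] by (intro le_u) (simp add: algebra_simps)
        then have "u (x + y) - u x \<le> u y"
          by (intro le_u) (simp add: algebra_simps)
        then show "u (x + y) \<le> u x + u y" by simp
      next
        fix c :: real and x assume c: "0 < c"
        have "u (c *\<^sub>R x) / c \<le> u x"
        proof (rule le_u)
          fix q assume "q \<in> C"
          then show "u (c *\<^sub>R x) / c \<le> q x"
            using u_le[of q "c *\<^sub>R x"] sublinear_scale[OF CS(1) c, of q x] c by (simp add: field_simps)
        qed
        then show "u (c *\<^sub>R x) \<le> c * u x" using c by (simp add: field_simps)
      qed
      moreover have "u \<le> p"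
        using False u_le CS(2) unfolding le_fun_def by (meson all_not_in_conv order_trans)
      ultimately show ?thesis
        using u_le by (auto simp: S_def P_def le_fun_def)
    qed
  qed
  then obtain m where m: "sublinear m" "m \<le> p"
    and min: "\<And>q. sublinear q \<Longrightarrow> q \<le> m \<Longrightarrow> q = m"
    unfolding S_def P_def by (smt (verit, del_insts) mem_Collect_eq order_trans)
  have add: "m (x + y) = m x + m y" for x y
  proof -
    define q where "q = (\<lambda>x. INF t\<in>{0..}. m (x + t *\<^sub>R y) - t * m y)"
    have low: "- m (- x) \<le> m (x + t *\<^sub>R y) - t * m y" if "0 \<le> t" for x t
    proof (cases "t = 0")
      case True
      then show ?thesis using sublinear_neg[OF m(1)] by simp
    next
      case False
      then show ?thesis
        using sublinear_add[OF m(1), of "x + t *\<^sub>R y" "- x"] sublinear_scale[OF m(1), of t y] that by simp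
    qed
    have bdd: "bdd_below ((\<lambda>t. m (x + t *\<^sub>R y) - t * m y) ` {0..})" for x
      by (rule bdd_belowI2) (use low in auto)
    have q_le: "q x \<le> m (x + t *\<^sub>R y) - t * m y" if "0 \<le> t" for x t
      unfolding q_def by (rule cINF_lower[OF bdd]) (use that in auto)
    have le_q: "b \<le> q x" if "\<And>t. 0 \<le> t \<Longrightarrow> b \<le> m (x + t *\<^sub>R y) - t * m y" for b x
      unfolding q_def using that by (intro cINF_greatest) auto
    have "sublinear q"
      unfolding sublinear_def
    proof (intro conjI allI impI)
      fix x1 x2
      have *: "q (x1 + x2) \<le> (m (x1 + s *\<^sub>R y) - s * m y) + (m (x2 + t *\<^sub>R y) - t * m y)"
        if "0 \<le> s" "0 \<le> t" for s t
      proof -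
        have "q (x1 + x2) \<le> m ((x1 + x2) + (s + t) *\<^sub>R y) - (s + t) * m y"
          using that by (intro q_le) auto
        also have "(x1 + x2) + (s + t) *\<^sub>R y = (x1 + s *\<^sub>R y) + (x2 + t *\<^sub>R y)"
          by (simp add: algebra_simps)
        finally show ?thesis
          using sublinear_add[OF m(1), of "x1 + s *\<^sub>R y" "x2 + t *\<^sub>R y"] by (simp add: algebra_simps)
      qed
      have "q (x1 + x2) - (m (x2 + t *\<^sub>R y) - t * m y) \<le> q x1" if "0 \<le> t" for t
        using *[OF _ that] by (intro le_q) (simp add: algebra_simps)
      then have "q (x1 + x2) - q x1 \<le> q x2"
        by (intro le_q) (simp add: algebra_simps)
      then show "q (x1 + x2) \<le> q x1 + q x2" by simp
    next
      fix c :: real and x assume c: "0 < c"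
      have "q (c *\<^sub>R x) / c \<le> q x"
      proof (rule le_q)
        fix t :: real assume "0 \<le> t"
        then have "q (c *\<^sub>R x) \<le> m (c *\<^sub>R x + (c * t) *\<^sub>R y) - c * t * m y"
          using c by (intro q_le) auto
        also have "c *\<^sub>R x + (c * t) *\<^sub>R y = c *\<^sub>R (x + t *\<^sub>R y)"
          by (simp add: algebra_simps)
        also have "m \<dots> = c * m (x + t *\<^sub>R y)"
          by (rule sublinear_scale[OF m(1) c])
        finally show "q (c *\<^sub>R x) / c \<le> m (x + t *\<^sub>R y) - t * m y"
          using c by (simp add: field_simps)
      qed
      then show "q (c *\<^sub>R x) \<le> c * q x" using c by (simp add: field_simps)
    qed
    moreover have "q \<le> m"
      using q_le[of 0] by (simp add: le_fun_def)
    ultimately have "q = m" by (rule min)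
    then have "m x \<le> m (x + y) - m y"
      using q_le[of 1 x] by simp
    then show ?thesis using sublinear_add[OF m(1), of x y] by simp
  qed
  have neg: "m (- x) = - m x" for x
    using add[of x "- x"] sublinear_zero[OF m(1)] by simp
  have "linear m"
  proof (rule linearI)
    fix c :: real and x
    consider "c = 0" | "c > 0" | "c < 0" by linarith
    then show "m (c *\<^sub>R x) = c *\<^sub>R m x"
    proof cases
      case 1
      then show ?thesis using sublinear_zero[OF m(1)] by simp
    next
      case 2
      then show ?thesis using sublinear_scale[OF m(1)] by simp
    next
      case 3
      then show ?thesis
        using sublinear_scale[OF m(1), of "- c" x] neg[of "c *\<^sub>R x"] by simp
    qed
  qed (rule add)
  then show ?thesis using m(2) by (auto simp: le_fun_def)
qed

text \<open>The functional is a linear minorant of \<open>v \<mapsto> inf (norm (v + t k) - t d)\<close>, the infimum taken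
  over \<open>t \<ge> 0\<close> and \<open>k \<in> K\<close>.\<close>

lemma separation_from_zero:
  fixes K :: "'a::real_normed_vector set"
  assumes K: "convex K" "K \<noteq> {}" and d: "\<And>k. k \<in> K \<Longrightarrow> d \<le> norm k"
  shows "\<exists>w :: 'a dual. norm w \<le> 1 \<and> (\<forall>k\<in>K. d \<le> blinfun_apply w k)"
proof -
  define p where "p = (\<lambda>v. INF z\<in>{0..}\<times>K. norm (v + fst z *\<^sub>R snd z) - fst z * d)"
  \<comment> \<open>Here the distance bound enters: moving along \<open>k\<close> subtracts
    \<open>t * d\<close>, but the norm grows at least as fast up to the constant
    \<open>norm v\<close>, which keeps the infimum finite.\<close>
  have low: "- norm v \<le> norm (v + t *\<^sub>R k) - t * d" if "0 \<le> t" "k \<in> K" for v t k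
  proof -
    have "t * d \<le> t * norm k" using that d by (intro mult_left_mono) auto
    also have "\<dots> = norm (t *\<^sub>R k)" using that by simp
    also have "\<dots> \<le> norm (v + t *\<^sub>R k) + norm v"
      using norm_triangle_ineq4[of "v + t *\<^sub>R k" v] by simp
    finally show ?thesis by simp
  qed
  have bdd: "bdd_below ((\<lambda>z. norm (v + fst z *\<^sub>R snd z) - fst z * d) ` ({0..}\<times>K))" for v
    by (rule bdd_belowI2) (use low in force)
  have p_le: "p v \<le> norm (v + t *\<^sub>R k) - t * d" if "0 \<le> t" "k \<in> K" for v t k
    unfolding p_def using cINF_lower[OF bdd, of "(t, k)"] that by simp
  have le_p: "b \<le> p v" if "\<And>t k. 0 \<le> t \<Longrightarrow> k \<in> K \<Longrightarrow> b \<le> norm (v + t *\<^sub>R k) - t * d" for b v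
    unfolding p_def using that K(2) by (intro cINF_greatest) auto
  have "sublinear p"
    unfolding sublinear_def
  proof (intro conjI allI impI)
    fix x y
    have *: "p (x + y) \<le> (norm (x + s *\<^sub>R k) - s * d) + (norm (y + t *\<^sub>R k') - t * d)"
      if "0 \<le> s" "0 \<le> t" "k \<in> K" "k' \<in> K" for s t k k'
    proof (cases "s + t = 0")
      case True
      then have "s = 0" "t = 0" using that by auto
      then show ?thesis using p_le[of 0 k "x + y"] that norm_triangle_ineq[of x y] by simp
    next
      case False
      then have pos: "s + t > 0" using that by auto
      \<comment> \<open>The two rays are merged at the weighted mean of \<open>k\<close> and
        \<open>k'\<close>, a point of \<open>K\<close> by convexity.\<close>
      define c where "c = (s / (s + t)) *\<^sub>R k + (t / (s + t)) *\<^sub>R k'"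
      have "c \<in> K"
        unfolding c_def using that pos K(1) by (intro convexD) (auto simp flip: add_divide_distrib)
      then have "p (x + y) \<le> norm ((x + y) + (s + t) *\<^sub>R c) - (s + t) * d"
        using that by (intro p_le) auto
      also have "(s + t) *\<^sub>R c = s *\<^sub>R k + t *\<^sub>R k'"
        unfolding c_def scaleR_add_right scaleR_scaleR using pos by simp
      also have "norm ((x + y) + (s *\<^sub>R k + t *\<^sub>R k')) \<le> norm (x + s *\<^sub>R k) + norm (y + t *\<^sub>R k')"
        using norm_triangle_ineq[of "x + s *\<^sub>R k" "y + t *\<^sub>R k'"] by (simp add: algebra_simps)
      finally show ?thesis by (simp add: algebra_simps)
    qed
    have "p (x + y) - (norm (y + t *\<^sub>R k') - t * d) \<le> p x" if "0 \<le> t" "k' \<in> K" for t k'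
      using *[OF _ that(1) _ that(2)] by (intro le_p) (simp add: algebra_simps)
    then have "p (x + y) - p x \<le> p y"
      by (intro le_p) (simp add: algebra_simps)
    then show "p (x + y) \<le> p x + p y" by simp
  next
    fix c :: real and x assume c: "0 < c"
    have "p (c *\<^sub>R x) / c \<le> p x"
    proof (rule le_p)
      fix t :: real and k assume "0 \<le> t" "k \<in> K"
      then have "p (c *\<^sub>R x) \<le> norm (c *\<^sub>R x + (c * t) *\<^sub>R k) - c * t * d"
        using c by (intro p_le) auto
      also have "c *\<^sub>R x + (c * t) *\<^sub>R k = c *\<^sub>R (x + t *\<^sub>R k)"
        by (simp add: algebra_simps)
      also have "norm \<dots> = c * norm (x + t *\<^sub>R k)"
        using c by simp
      finally show "p (c *\<^sub>R x) / c \<le> norm (x + t *\<^sub>R k) - t * d"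
        using c by (simp add: field_simps)
    qed
    then show "p (c *\<^sub>R x) \<le> c * p x" using c by (simp add: field_simps)
  qed
  then obtain f where f: "linear f" "\<And>x. f x \<le> p x"
    using sublinear_majorizes_linear by blast
  obtain k0 where k0: "k0 \<in> K" using K(2) by auto
  have "f x \<le> norm x" for x
    using f(2)[of x] p_le[of 0 k0 x] k0 by simp
  then have f_norm: "\<bar>f x\<bar> \<le> norm x" for x
    using linear_neg[OF f(1), of x] by (metis abs_le_iff norm_minus_cancel)
  have "bounded_linear f"
    using f(1) f_norm by (intro bounded_linear_intro[where K = 1])
      (auto simp: linear_add linear_scale)
  then have w: "blinfun_apply (Blinfun f) = f" by (rule bounded_linear_Blinfun_apply)
  have "norm (Blinfun f) \<le> 1"
    using f_norm by (intro norm_blinfun_bound) (auto simp: w)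
  \<comment> \<open>At \<open>v = - k\<close> the choice \<open>t = 1\<close> in the infimum gives
    \<open>p (- k) \<le> - d\<close>.\<close>
  moreover have "d \<le> f k" if "k \<in> K" for k
    using f(2)[of "- k"] p_le[of 1 k "- k"] that linear_neg[OF f(1), of k] by simp
  ultimately show ?thesis using w by (intro exI[of _ "Blinfun f"]) auto
qed

text \<open>Zero is separated from the convex set \<open>x - S\<close>; a ball around
  \<open>x\<close> that misses \<open>S\<close> supplies the lower bound \<open>d\<close> for all
  norms there.\<close>

lemma separation_closed_convex_point:
  fixes S :: "'a::real_normed_vector set"
  assumes "convex S" "closed S" "S \<noteq> {}" "x \<notin> S"
  shows "\<exists>(w :: 'a dual) d. 0 < d \<and> (\<forall>s\<in>S. blinfun_apply w s + d \<le> blinfun_apply w x)"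
proof -
  have "open (- S)" "x \<in> - S" using assms by auto
  then obtain d where d: "0 < d" "ball x d \<subseteq> - S" by (meson openE)
  have "convex ((\<lambda>s. x - s) ` S)"
    using convex_affinity[OF assms(1), of x "-1"] by simp
  then obtain w :: "'a dual" where w: "\<forall>k\<in>(\<lambda>s. x - s) ` S. d \<le> blinfun_apply w k"
    using separation_from_zero[of "(\<lambda>s. x - s) ` S" d] d assms(3)
    by (force simp: subset_eq dist_norm)
  then show ?thesis using d(1) by (intro exI[of _ w] exI[of _ d]) (force simp: blinfun.diff_right)
qed

section \<open>Norming functionals and weak sequential compactness\<close>

lemma norming_functional:
  fixes x :: "'a::real_normed_vector"
  obtains w :: "'a dual" where "norm w \<le> 1" "blinfun_apply w x = norm x"
proof -
  obtain w :: "'a dual" where w: "norm w \<le> 1" "norm x \<le> blinfun_apply w x"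
    using separation_from_zero[of "{x}" "norm x"] by auto
  have "blinfun_apply w x \<le> norm w * norm x"
    using norm_blinfun[of w x] by simp
  also have "\<dots> \<le> norm x" using w(1) by (simp add: mult_left_le_one_le)
  finally show ?thesis using w that by force
qed

text \<open>The second conjunct makes \<open>norm x\<close> the supremum of the values
  \<open>W i x\<close>. Such a countable family stands in for the dual unit ball in diagonal
  arguments and in measurability proofs.\<close>

definition norming_sequence :: "(nat \<Rightarrow> 'a::real_normed_vector dual) \<Rightarrow> bool" where
  "norming_sequence W \<longleftrightarrow>
     (\<forall>i. norm (W i) \<le> 1) \<and> (\<forall>x r. r < norm x \<longrightarrow> (\<exists>i. r < blinfun_apply (W i) x))"

lemma blinfun_apply_le_norm:
  fixes w :: "'a::real_normed_vector dual"
  assumes "norm w \<le> 1"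
  shows "\<bar>blinfun_apply w x\<bar> \<le> norm x"
  using norm_blinfun[of w x] mult_right_mono[OF assms, of "norm x"] by simp

text \<open>Norming functionals of a countable dense set suffice: replacing \<open>x\<close> by a
  nearby \<open>d\<close> costs the distance twice, once in the norm and once in the functional,
  hence the radius \<open>(norm x - r) / 2\<close>.\<close>

lemma norming_sequence_exists:
  obtains W :: "nat \<Rightarrow> 'a::{real_normed_vector, second_countable_topology} dual"
  where "norming_sequence W"
proof -
  obtain D :: "'a set" where D: "countable D" "\<And>X. open X \<Longrightarrow> X \<noteq> {} \<Longrightarrow> \<exists>d\<in>D. d \<in> X"
    using countable_dense_exists by metis
  have "D \<noteq> {}" using D(2)[of UNIV] by auto
  then have rng: "range (from_nat_into D) = D" using D(1) by (rule range_from_nat_into)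
  have "\<forall>i. \<exists>w :: 'a dual. norm w \<le> 1 \<and> blinfun_apply w (from_nat_into D i) = norm (from_nat_into D i)"
    using norming_functional by metis
  then obtain W :: "nat \<Rightarrow> 'a dual" where W: "\<And>i. norm (W i) \<le> 1"
    "\<And>i. blinfun_apply (W i) (from_nat_into D i) = norm (from_nat_into D i)"
    by metis
  have "\<exists>i. r < blinfun_apply (W i) x" if r: "r < norm x" for x r
  proof -
    have "ball x ((norm x - r) / 2) \<noteq> {}" using r by simp
    then obtain d where d: "d \<in> D" "dist x d < (norm x - r) / 2"
      using D(2)[of "ball x ((norm x - r) / 2)"] by auto
    then obtain i where i: "d = from_nat_into D i" using rng by blast
    have "\<bar>blinfun_apply (W i) (x - d)\<bar> \<le> norm (x - d)" by (rule blinfun_apply_le_norm[OF W(1)])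
    moreover have "norm x - norm d \<le> norm (x - d)" by norm
    ultimately have "r < blinfun_apply (W i) x"
      using d(2) W(2)[of i] unfolding i[symmetric] dist_norm blinfun.diff_right by argo
    then show ?thesis ..
  qed
  then show ?thesis using W(1) that[of W] by (auto simp: norming_sequence_def)
qed

lemma norming_sequence_norm_le:
  assumes "norming_sequence W" "\<And>i. blinfun_apply (W i) x \<le> K"
  shows "norm x \<le> K"
  using assms unfolding norming_sequence_def by (metis leD leI)

text \<open>A proper closed span would be annihilated by a nonzero functional on the dual. By
  reflexivity this functional is evaluation at some \<open>y\<close>, and a norming sequence that
  vanishes at \<open>y\<close> forces \<open>y = 0\<close>.\<close>

lemma norming_sequence_span_dense:
  fixes W :: "nat \<Rightarrow> 'a::real_normed_vector dual"
  assumes refl: "reflexive_space TYPE('a)" and W: "norming_sequence W"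
  shows "closure (span (range W)) = UNIV"
proof (rule ccontr)
  assume "closure (span (range W)) \<noteq> UNIV"
  then obtain v where v: "v \<notin> closure (span (range W))" by auto
  obtain \<Phi> :: "'a dual dual" and d where d: "0 < d"
    and \<Phi>: "\<And>s. s \<in> closure (span (range W)) \<Longrightarrow> blinfun_apply \<Phi> s + d \<le> blinfun_apply \<Phi> v"
    using separation_closed_convex_point[of "closure (span (range W))" v] v
    by (metis closed_closure closure_eq_empty convex_closure empty_iff span_zero subspace_imp_convex subspace_span)
  have zero: "blinfun_apply \<Phi> s = 0" if s: "s \<in> span (range W)" for s
  proof (rule ccontr)
    assume nz: "blinfun_apply \<Phi> s \<noteq> 0"
    \<comment> \<open>A nonzero value on the span could be scaled to the value at \<open>v\<close>,
      against the gap \<open>d\<close>.\<close>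
    define c where "c = blinfun_apply \<Phi> v / blinfun_apply \<Phi> s"
    have "c *\<^sub>R s \<in> closure (span (range W))"
      using s span_scale closure_subset by blast
    from \<Phi>[OF this] show False using d nz by (simp add: c_def blinfun.scaleR_right)
  qed
  obtain y where y: "\<And>w. blinfun_apply \<Phi> w = blinfun_apply w y"
    using refl unfolding reflexive_space_def by blast
  have "norm y \<le> 0"
  proof (rule norming_sequence_norm_le[OF W])
    show "blinfun_apply (W i) y \<le> 0" for i
      using zero[of "W i"] y[of "W i"] span_base[of "W i" "range W"] by auto
  qed
  then have "blinfun_apply \<Phi> v = 0" by (simp add: y)
  then show False
    using \<Phi>[of 0] d closure_subset[of "span (range W)"] span_zero[of "range W"] by (auto simp: blinfun.zero_right)
qed

lemma weakly_tendsto_norm_le: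
  assumes "weakly_tendsto u x F" "eventually (\<lambda>n. norm (u n) \<le> K) F" "F \<noteq> bot"
  shows "norm x \<le> K"
proof -
  obtain w where w: "norm w \<le> 1" "blinfun_apply w x = norm x" using norming_functional .
  have "((\<lambda>n. blinfun_apply w (u n)) \<longlongrightarrow> norm x) F"
    using assms(1) w unfolding weakly_tendsto_def by metis
  moreover have "eventually (\<lambda>n. blinfun_apply w (u n) \<le> K) F"
    using assms(2) by eventually_elim (use blinfun_apply_le_norm[OF w(1)] abs_le_D1 order_trans in blast)
  ultimately show ?thesis using assms(3) tendsto_upperbound by blast
qed

text \<open>Convergence against the \<open>W i\<close> extends to their span by linearity and to the
  whole dual by density and the bound \<open>K\<close>. The limit is a bounded functional on the
  dual, and reflexivity turns it into a point.\<close>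

lemma bounded_weakly_convergent:
  fixes W :: "nat \<Rightarrow> 'a::real_normed_vector dual"
  assumes refl: "reflexive_space TYPE('a)" and W: "norming_sequence W"
    and K: "\<And>n. norm (u n) \<le> K"
    and conv: "\<And>i. convergent (\<lambda>n. blinfun_apply (W i) (u n))"
  shows "\<exists>x. weakly_tendsto u x sequentially"
proof -
  have K0: "0 \<le> K" using K[of 0] norm_ge_zero order_trans by blast
  have conv_span: "convergent (\<lambda>n. blinfun_apply w (u n))" if "w \<in> span (range W)" for w
    using that
  proof (induction rule: span_induct_alt)
    case base
    then show ?case by (simp add: convergent_const)
  next
    case (step c x y)
    then show ?case using conv
      by (auto simp: blinfun.add_left blinfun.scaleR_left intro!: convergent_add convergent_mult convergent_const)
  qed
  have conv_all: "convergent (\<lambda>n. blinfun_apply w (u n))" for w :: "'a dual"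
  proof -
    have "Cauchy (\<lambda>n. blinfun_apply w (u n))"
    proof (rule metric_CauchyI)
      fix e :: real assume e: "0 < e"
      define \<delta> where "\<delta> = e / (3 * (K + 1))"
      have \<delta>: "0 < \<delta>" using e K0 by (simp add: \<delta>_def)
      have "w \<in> closure (span (range W))" using norming_sequence_span_dense[OF refl W] by simp
      then obtain v where v: "v \<in> span (range W)" "dist v w < \<delta>"
        using \<delta> closure_approachable by blast
      have near: "\<bar>blinfun_apply w (u n) - blinfun_apply v (u n)\<bar> \<le> e / 3" for n
      proof -
        have "\<bar>blinfun_apply w (u n) - blinfun_apply v (u n)\<bar> \<le> norm (w - v) * norm (u n)"
          using norm_blinfun[of "w - v" "u n"] by (simp add: blinfun.diff_left)
        also have "\<dots> \<le> \<delta> * (K + 1)"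
          using v(2) K[of n] K0 \<delta> by (intro mult_mono) (auto simp: dist_norm norm_minus_commute)
        also have "\<dots> = e / 3" using K0 by (simp add: \<delta>_def field_simps)
        finally show ?thesis .
      qed
      obtain M where M: "\<And>m n. m \<ge> M \<Longrightarrow> n \<ge> M \<Longrightarrow> dist (blinfun_apply v (u m)) (blinfun_apply v (u n)) < e / 3"
        using conv_span[OF v(1)] e by (metis convergent_Cauchy metric_CauchyD zero_less_divide_iff zero_less_numeral)
      have "dist (blinfun_apply w (u m)) (blinfun_apply w (u n)) < e" if "m \<ge> M" "n \<ge> M" for m n
        using near[of m] near[of n] M[OF that] unfolding dist_real_def by argo
      then show "\<exists>M. \<forall>m\<ge>M. \<forall>n\<ge>M. dist (blinfun_apply w (u m)) (blinfun_apply w (u n)) < e" by blast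
    qed
    then show ?thesis by (simp add: Cauchy_convergent)
  qed
  define \<Phi> where "\<Phi> = (\<lambda>w :: 'a dual. lim (\<lambda>n. blinfun_apply w (u n)))"
  have lim: "(\<lambda>n. blinfun_apply w (u n)) \<longlonglongrightarrow> \<Phi> w" for w
    unfolding \<Phi>_def using conv_all by (simp add: convergent_LIMSEQ_iff)
  have "bounded_linear \<Phi>"
  proof (rule bounded_linear_intro[where K = K])
    show "\<Phi> (v + w) = \<Phi> v + \<Phi> w" for v w
      by (rule LIMSEQ_unique[OF lim]) (simp add: blinfun.add_left tendsto_add lim)
    show "\<Phi> (c *\<^sub>R w) = c *\<^sub>R \<Phi> w" for c w
      by (rule LIMSEQ_unique[OF lim]) (simp add: blinfun.scaleR_left tendsto_mult_left lim)
    show "norm (\<Phi> w) \<le> norm w * K" for w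
    proof (rule tendsto_upperbound)
      show "(\<lambda>n. norm (blinfun_apply w (u n))) \<longlonglongrightarrow> norm (\<Phi> w)"
        by (intro tendsto_norm lim)
      have "norm (blinfun_apply w (u n)) \<le> norm w * K" for n
        using norm_blinfun[of w "u n"] mult_left_mono[OF K[of n], of "norm w"] by simp
      then show "\<forall>\<^sub>F n in sequentially. norm (blinfun_apply w (u n)) \<le> norm w * K" by simp
    qed simp
  qed
  then have "\<And>w. blinfun_apply (Blinfun \<Phi>) w = \<Phi> w" by (simp add: bounded_linear_Blinfun_apply)
  then obtain x where "\<And>w. \<Phi> w = blinfun_apply w x"
    using refl unfolding reflexive_space_def by metis
  then show ?thesis using lim unfolding weakly_tendsto_def by auto
qed

section \<open>Primitives of integrable vector-valued functions\<close>

lemma fine_partition: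
  fixes a b d :: real
  assumes "a \<le> b" "0 < d"
  obtains N :: nat and x :: "nat \<Rightarrow> real" where "x 0 = a" "x N = b"
    "\<And>i. i < N \<Longrightarrow> a \<le> x i \<and> x i \<le> x (Suc i) \<and> x (Suc i) \<le> b \<and> x (Suc i) - x i < d"
proof -
  obtain N :: nat where N: "(b - a) / d < real N" using reals_Archimedean2 by blast
  have N0: "0 < real N" using N assms by (smt (verit) divide_nonneg_pos)
  define x where "x = (\<lambda>i::nat. a + (b - a) * (real i / real N))"
  have step: "x (Suc i) - x i = (b - a) / real N" for i
    by (simp add: x_def field_simps add_divide_distrib diff_divide_distrib)
  have small: "(b - a) / real N < d" using N N0 assms by (simp add: field_simps)
  show ?thesis
  proof (rule that[of x N])
    show "x 0 = a" "x N = b" using N0 by (auto simp: x_def)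
    fix i assume i: "i < N"
    have "real i / real N \<ge> 0" by simp
    then have 1: "a \<le> x i" using assms by (simp add: x_def)
    have "real (Suc i) / real N \<le> 1" using i by simp
    then have "(b - a) * (real (Suc i) / real N) \<le> (b - a) * 1"
      using assms by (intro mult_left_mono) auto
    then have 2: "x (Suc i) \<le> b" by (simp add: x_def)
    have "0 \<le> (b - a) / real N" using assms by simp
    then show "a \<le> x i \<and> x i \<le> x (Suc i) \<and> x (Suc i) \<le> b \<and> x (Suc i) - x i < d"
      using 1 2 step[of i] small by linarith
  qed
qed

text \<open>A mean value inequality without derivatives: the increments telescope along a fine
  partition, and what remains is \<open>e\<close> times the total increment of the control function
  \<open>M\<close>, with \<open>e\<close> arbitrary. In the uses \<open>M\<close> is the primitive
  of an integrable majorant.\<close>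

lemma fine_increment_le:
  fixes P M :: "real \<Rightarrow> real"
  assumes ab: "a \<le> b"
    and fine: "\<And>e. 0 < e \<Longrightarrow> \<exists>d>0. \<forall>s t. a \<le> s \<longrightarrow> s \<le> t \<longrightarrow> t \<le> b \<longrightarrow> t - s < d \<longrightarrow>
      P t - P s \<le> e * (M t - M s)"
  shows "P b \<le> P a"
proof -
  have le: "P b - P a \<le> e * (M b - M a)" if e: "0 < e" for e
  proof -
    obtain d where d: "d > 0" and dP: "\<forall>s t. a \<le> s \<longrightarrow> s \<le> t \<longrightarrow> t \<le> b \<longrightarrow> t - s < d \<longrightarrow>
      P t - P s \<le> e * (M t - M s)" using fine[OF e] by (elim exE conjE)
    obtain N :: nat and x where x: "x 0 = a" "x N = b"
      "\<And>i. i < N \<Longrightarrow> a \<le> x i \<and> x i \<le> x (Suc i) \<and> x (Suc i) \<le> b \<and> x (Suc i) - x i < d"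
      using fine_partition[OF ab d] by metis
    have "(\<Sum>i<N. P (x (Suc i)) - P (x i)) \<le> (\<Sum>i<N. e * (M (x (Suc i)) - M (x i)))"
      using x(3) by (intro sum_mono dP[rule_format]) auto
    also have "\<dots> = e * (\<Sum>i<N. M (x (Suc i)) - M (x i))" by (simp add: sum_distrib_left)
    finally show ?thesis
      using x(1,2) sum_lessThan_telescope[of "\<lambda>i. P (x i)" N] sum_lessThan_telescope[of "\<lambda>i. M (x i)" N] by simp
  qed
  show ?thesis
  proof (rule field_le_epsilon)
    fix e :: real assume e: "0 < e"
    \<comment> \<open>\<open>M\<close> need not be monotone, and its total increment may vanish;
      \<open>m\<close> is a positive bound for it.\<close>
    define m where "m = \<bar>M b - M a\<bar> + 1"
    have m: "0 < m" by (simp add: m_def)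
    have "P b - P a \<le> (e / m) * (M b - M a)" using e m by (intro le) auto
    also have "\<dots> \<le> (e / m) * m" using e m by (intro mult_left_mono) (auto simp: m_def)
    also have "\<dots> = e" using m by simp
    finally show "P b \<le> P a + e" by simp
  qed
qed

lemma fine_increment_eq:
  fixes P :: "real \<Rightarrow> 'b::real_normed_vector" and M :: "real \<Rightarrow> real"
  assumes ab: "a \<le> b"
    and fine: "\<And>e. 0 < e \<Longrightarrow> \<exists>d>0. \<forall>s t. a \<le> s \<longrightarrow> s \<le> t \<longrightarrow> t \<le> b \<longrightarrow> t - s < d \<longrightarrow>
      norm (P t - P s) \<le> e * (M t - M s)"
  shows "P b = P a"
proof -
  have "norm (P b - P a) \<le> norm (P a - P a)"
  proof (rule fine_increment_le[OF ab])
    fix e :: real assume e: "0 < e"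
    from fine[OF e] obtain d where d: "d > 0" "\<forall>s t. a \<le> s \<longrightarrow> s \<le> t \<longrightarrow> t \<le> b \<longrightarrow> t - s < d \<longrightarrow>
      norm (P t - P s) \<le> e * (M t - M s)" by (elim exE conjE)
    have tri: "norm (P t - P a) - norm (P s - P a) \<le> norm (P t - P s)" for s t :: real
      using norm_triangle_ineq2[of "P t - P a" "P s - P a"] by simp
    then show "\<exists>d>0. \<forall>s t. a \<le> s \<longrightarrow> s \<le> t \<longrightarrow> t \<le> b \<longrightarrow> t - s < d \<longrightarrow>
      norm (P t - P a) - norm (P s - P a) \<le> e * (M t - M s)"
      using d by (intro exI[of _ d] conjI allI impI) (auto intro: order_trans[OF tri])
  qed
  then show ?thesis by simp
qed

section \<open>Set integrals and measurability of pairings\<close>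

lemma set_integral_combine:
  fixes f :: "real \<Rightarrow> 'b::{banach, second_countable_topology}"
  assumes f: "set_integrable lebesgue {a..c} f" and "a \<le> b" "b \<le> c"
  shows "(LINT r:{a..c}|lebesgue. f r) = (LINT r:{a..b}|lebesgue. f r) + (LINT r:{b..c}|lebesgue. f r)"
proof -
  have eq: "{a..b} \<union> {b..c} = {a..c}" using assms by auto
  have "AE x in lebesgue. x \<noteq> b"
    using AE_lborel_singleton[of b] by (rule AE_completion)
  then have "AE x in lebesgue. \<not> (x \<in> {a..b} \<and> x \<in> {b..c})"
    by eventually_elim auto
  then show ?thesis
    unfolding eq[symmetric] using assms
    by (intro set_integral_Un_AE) (auto intro: set_integrable_subset[OF f])
qed

lemma set_integral_Icc_singleton [simp]:
  fixes f :: "real \<Rightarrow> 'b::{banach, second_countable_topology}"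
  assumes "set_integrable lebesgue {a..a} f"
  shows "(LINT r:{a..a}|lebesgue. f r) = 0"
  using set_integral_combine[OF assms, of a] by simp

lemma norm_set_integral_le:
  fixes f :: "'s \<Rightarrow> 'b::{banach, second_countable_topology}"
  shows "norm (LINT r:S|M. f r) \<le> (LINT r:S|M. norm (f r))"
proof -
  have "norm (LINT r:S|M. f r) \<le> (\<integral>r. norm (indicat_real S r *\<^sub>R f r) \<partial>M)"
    unfolding set_lebesgue_integral_def by (rule integral_norm_bound)
  then show ?thesis by (simp add: set_lebesgue_integral_def)
qed

lemma set_integrable_norm':
  fixes f :: "'s \<Rightarrow> 'b::{banach, second_countable_topology}"
  assumes "set_integrable M S f"
  shows "set_integrable M S (\<lambda>r. norm (f r))"
  using integrable_norm[OF assms[unfolded set_integrable_def]] by (simp add: set_integrable_def)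

lemma set_integrable_bounded_linear:
  fixes f :: "'s \<Rightarrow> 'b::{banach, second_countable_topology}" and h :: "'b \<Rightarrow> 'c::{banach, second_countable_topology}"
  assumes h: "bounded_linear h" and f: "set_integrable M S f"
  shows "set_integrable M S (\<lambda>r. h (f r))"
    and "(LINT r:S|M. h (f r)) = h (LINT r:S|M. f r)"
proof -
  have eq: "indicat_real S r *\<^sub>R h (f r) = h (indicat_real S r *\<^sub>R f r)" for r
    using h by (simp add: linear_simps)
  show "set_integrable M S (\<lambda>r. h (f r))"
    using integrable_bounded_linear[OF h f[unfolded set_integrable_def]]
    by (simp add: set_integrable_def eq)
  show "(LINT r:S|M. h (f r)) = h (LINT r:S|M. f r)"
    using integral_bounded_linear[OF h f[unfolded set_integrable_def]]
    by (simp add: set_lebesgue_integral_def eq)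
qed

text \<open>The first factor may take values in the dual, which is not assumed second countable, so
  the two functions are not combined into one with values in a product space. For a constant second
  argument the map is a continuous function of \<open>f\<close>; a simple second argument glues
  finitely many such pieces, and pointwise limits finish.\<close>

lemma borel_measurable_bilinear:
  fixes f :: "'s \<Rightarrow> 'a::real_normed_vector" and g :: "'s \<Rightarrow> 'b::{real_normed_vector, second_countable_topology}"
    and B :: "'a \<Rightarrow> 'b \<Rightarrow> 'c::real_normed_vector"
  assumes B: "bounded_bilinear B"
    and f: "f \<in> borel_measurable M" and g: "g \<in> borel_measurable M"
  shows "(\<lambda>t. B (f t) (g t)) \<in> borel_measurable M"
proof -
  interpret bounded_bilinear B by (rule B)
  obtain s where s: "\<And>i. simple_function M (s i)" "\<And>x. x \<in> space M \<Longrightarrow> (\<lambda>i. s i x) \<longlonglongrightarrow> g x"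
    using borel_measurable_implies_sequence_metric[OF g, of 0] by blast
  show ?thesis
  proof (rule borel_measurable_LIMSEQ_metric)
    fix i :: nat
    have "continuous_on UNIV (\<lambda>x. B x c)" for c
      by (intro continuous_on continuous_on_id continuous_on_const)
    then have "(\<lambda>t. B (f t) c) \<in> borel_measurable M" for c
      using f by (rule borel_measurable_continuous_on)
    moreover have "s i \<in> measurable M (count_space (s i ` space M))"
      using s(1)[of i] by (auto simp: simple_function_def measurable_count_space_eq2)
    moreover have "countable (s i ` space M)"
      using s(1)[of i] by (auto simp: simple_function_def intro: countable_finite)
    ultimately show "(\<lambda>t. B (f t) (s i t)) \<in> borel_measurable M"
      by (rule measurable_compose_countable'[of "s i ` space M" "\<lambda>c t. B (f t) c"])
  next
    show "(\<lambda>i. B (f x) (s i x)) \<longlonglongrightarrow> B (f x) (g x)" if "x \<in> space M" for x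
      by (intro tendsto tendsto_const s(2) that)
  qed
qed

lemma set_integrable_bilinear:
  fixes w :: "real \<Rightarrow> 'a::real_normed_vector" and g :: "real \<Rightarrow> 'b::{banach, second_countable_topology}"
    and B :: "'a \<Rightarrow> 'b \<Rightarrow> 'c::{banach, second_countable_topology}"
  assumes B: "bounded_bilinear B" and w: "continuous_on {a..b} w"
    and g: "set_integrable lebesgue {a..b} g"
  shows "set_integrable lebesgue {a..b} (\<lambda>r. B (w r) (g r))"
proof -
  interpret bounded_bilinear B by (rule B)
  obtain K where K: "0 < K" "\<And>x y. norm (B x y) \<le> norm x * norm y * K" using pos_bounded by blast
  have "bounded (w ` {a..b})" using w compact_continuous_image compact_imp_bounded by blast
  then obtain C where C: "\<And>r. r \<in> {a..b} \<Longrightarrow> norm (w r) \<le> C"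
    unfolding bounded_iff by (metis imageI)
  have eq: "indicat_real {a..b} r *\<^sub>R B (w r) (g r) = B (indicat_real {a..b} r *\<^sub>R w r) (indicat_real {a..b} r *\<^sub>R g r)" for r
    by (simp add: indicator_def zero_left)
  have mw: "(\<lambda>r. indicat_real {a..b} r *\<^sub>R w r) \<in> borel_measurable lebesgue"
    using borel_measurable_continuous_on_indicator[OF _ w] by (intro measurable_completion) simp
  have mg: "(\<lambda>r. indicat_real {a..b} r *\<^sub>R g r) \<in> borel_measurable lebesgue"
    using g by (auto simp: set_integrable_def)
  show ?thesis
    unfolding set_integrable_def
  proof (rule Bochner_Integration.integrable_bound)
    show "integrable lebesgue (\<lambda>r. K * C * norm (indicat_real {a..b} r *\<^sub>R g r))"
      using g unfolding set_integrable_def by (intro integrable_mult_right integrable_norm)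
    show "(\<lambda>r. indicat_real {a..b} r *\<^sub>R B (w r) (g r)) \<in> borel_measurable lebesgue"
      unfolding eq by (rule borel_measurable_bilinear[OF B mw mg])
    have "norm (B (w r) (g r)) \<le> K * C * norm (g r)" if "r \<in> {a..b}" for r
    proof -
      have "norm (B (w r) (g r)) \<le> norm (w r) * norm (g r) * K" by (rule K)
      also have "\<dots> \<le> C * norm (g r) * K"
        using C[OF that] K(1) by (intro mult_right_mono) auto
      finally show ?thesis by (simp add: mult_ac)
    qed
    then show "AE r in lebesgue. norm (indicat_real {a..b} r *\<^sub>R B (w r) (g r))
        \<le> norm (K * C * norm (indicat_real {a..b} r *\<^sub>R g r))"
      by (intro AE_I2) (force simp: indicator_def)
  qed
qed

text \<open>Absolute continuity in the Bochner sense: \<open>u\<close> is a primitive of the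
  integrable \<open>g\<close>, and no pointwise differentiability is claimed. It agrees with the
  notion of weak derivative by \<open>is_weak_deriv_imp_has_deriv_ae\<close> and its converse
  \<open>has_deriv_ae_imp_is_weak_deriv\<close>.\<close>

definition has_deriv_ae :: "real \<Rightarrow> (real \<Rightarrow> 'a::{banach, second_countable_topology}) \<Rightarrow> (real \<Rightarrow> 'a) \<Rightarrow> bool" where
  "has_deriv_ae T u g \<longleftrightarrow> continuous_on {0..T} u \<and> set_integrable lebesgue {0..T} g \<and>
     (\<forall>s t. 0 \<le> s \<longrightarrow> s \<le> t \<longrightarrow> t \<le> T \<longrightarrow> u t - u s = (LINT r:{s..t}|lebesgue. g r))"

lemma has_deriv_aeD:
  assumes "has_deriv_ae T u g"
  shows "continuous_on {0..T} u" "set_integrable lebesgue {0..T} g"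
    and "\<And>s t. 0 \<le> s \<Longrightarrow> t \<le> T \<Longrightarrow> set_integrable lebesgue {s..t} g"
    and "\<And>s t. 0 \<le> s \<Longrightarrow> s \<le> t \<Longrightarrow> t \<le> T \<Longrightarrow> u t - u s = (LINT r:{s..t}|lebesgue. g r)"
    and "\<And>s t. 0 \<le> s \<Longrightarrow> t \<le> T \<Longrightarrow> continuous_on {s..t} u"
  using assms unfolding has_deriv_ae_def
  by (auto intro: set_integrable_subset[of lebesgue "{0..T}"] continuous_on_subset)

lemma has_deriv_ae_bounded_linear:
  fixes u :: "real \<Rightarrow> 'b::{banach, second_countable_topology}" and h :: "'b \<Rightarrow> 'c::{banach, second_countable_topology}"
  assumes h: "bounded_linear h" and u: "has_deriv_ae T u g"
  shows "has_deriv_ae T (\<lambda>t. h (u t)) (\<lambda>t. h (g t))"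
  unfolding has_deriv_ae_def
proof (intro conjI allI impI)
  show "continuous_on {0..T} (\<lambda>t. h (u t))"
    using has_deriv_aeD(1)[OF u] by (rule bounded_linear.continuous_on[OF h])
  show "set_integrable lebesgue {0..T} (\<lambda>t. h (g t))"
    by (rule set_integrable_bounded_linear[OF h has_deriv_aeD(2)[OF u]])
  fix s t assume st: "0 \<le> s" "s \<le> t" "t \<le> T"
  have "h (u t) - h (u s) = h (LINT r:{s..t}|lebesgue. g r)"
    using has_deriv_aeD(4)[OF u st] h by (metis bounded_linear.linear linear_diff)
  then show "h (u t) - h (u s) = (LINT r:{s..t}|lebesgue. h (g r))"
    using set_integrable_bounded_linear(2)[OF h has_deriv_aeD(3)[OF u st(1,3)]] by simp
qed

lemma has_deriv_ae_diff:
  assumes u: "has_deriv_ae T u g" and v: "has_deriv_ae T v h"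
  shows "has_deriv_ae T (\<lambda>t. u t - v t) (\<lambda>t. g t - h t)"
  unfolding has_deriv_ae_def
proof (intro conjI allI impI)
  show "continuous_on {0..T} (\<lambda>t. u t - v t)"
    using has_deriv_aeD(1)[OF u] has_deriv_aeD(1)[OF v] by (intro continuous_intros)
  show "set_integrable lebesgue {0..T} (\<lambda>t. g t - h t)"
    by (rule set_integral_diff[OF has_deriv_aeD(2)[OF u] has_deriv_aeD(2)[OF v]])
  fix s t assume st: "0 \<le> s" "s \<le> t" "t \<le> T"
  then show "u t - v t - (u s - v s) = (LINT r:{s..t}|lebesgue. g r - h r)"
    using set_integral_diff(2)[OF has_deriv_aeD(3)[OF u st(1,3)] has_deriv_aeD(3)[OF v st(1,3)]]
      has_deriv_aeD(4)[OF u st] has_deriv_aeD(4)[OF v st] by (simp add: algebra_simps)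
qed

lemma has_deriv_ae_const: "has_deriv_ae T (\<lambda>t. c) (\<lambda>t. 0)"
  by (simp add: has_deriv_ae_def set_integrable_def)

theorem has_deriv_ae_bilinear:
  fixes u :: "real \<Rightarrow> 'a::{banach, second_countable_topology}" and v :: "real \<Rightarrow> 'b::{banach, second_countable_topology}"
    and B :: "'a \<Rightarrow> 'b \<Rightarrow> 'c::{banach, second_countable_topology}"
  assumes B: "bounded_bilinear B" and u: "has_deriv_ae T u g" and v: "has_deriv_ae T v h"
  shows "has_deriv_ae T (\<lambda>t. B (u t) (v t)) (\<lambda>t. B (u t) (h t) + B (g t) (v t))"
proof -
  interpret bounded_bilinear B by (rule B)
  let ?F = "\<lambda>r. B (u r) (h r) + B (g r) (v r)"
  obtain K where K: "0 < K" "\<And>x y. norm (B x y) \<le> norm x * norm y * K" using pos_bounded by blast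
  have int1: "set_integrable lebesgue {s..t} (\<lambda>r. B (u r) (h r))" if "0 \<le> s" "t \<le> T" for s t
    using that by (intro set_integrable_bilinear[OF B] has_deriv_aeD(3)[OF v] has_deriv_aeD(5)[OF u])
  have int2: "set_integrable lebesgue {s..t} (\<lambda>r. B (g r) (v r))" if "0 \<le> s" "t \<le> T" for s t
    using that by (intro set_integrable_bilinear[OF flip] has_deriv_aeD(3)[OF u] has_deriv_aeD(5)[OF v])
  have intF: "set_integrable lebesgue {s..t} ?F" if "0 \<le> s" "t \<le> T" for s t
    using int1[OF that] int2[OF that] by (rule set_integral_add)
  let ?m = "\<lambda>r. norm (g r) + norm (h r)"
  have intm: "set_integrable lebesgue {s..t} ?m" if "0 \<le> s" "t \<le> T" for s t
    using has_deriv_aeD(3)[OF u that] has_deriv_aeD(3)[OF v that]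
    by (intro set_integral_add set_integrable_norm')
  have bound: "norm (B (u t) (v t) - B (u s) (v s) - (LINT r:{s..t}|lebesgue. ?F r))
      \<le> e * (LINT r:{s..t}|lebesgue. ?m r)"
    if st: "0 \<le> s" "s \<le> t" "t \<le> T" and e: "0 < e"
      and osc: "\<And>r. r \<in> {s..t} \<Longrightarrow> norm (u t - u r) \<le> e / K \<and> norm (v r - v s) \<le> e / K" for s t e
  proof -
    note gi = has_deriv_aeD(3)[OF u st(1,3)] and hi = has_deriv_aeD(3)[OF v st(1,3)]
    have 1: "set_integrable lebesgue {s..t} (\<lambda>r. B (u t) (h r))"
      "(LINT r:{s..t}|lebesgue. B (u t) (h r)) = B (u t) (v t - v s)"
      using set_integrable_bounded_linear[OF bounded_linear_right hi, of "u t"] has_deriv_aeD(4)[OF v st] by simp_all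
    have 2: "set_integrable lebesgue {s..t} (\<lambda>r. B (g r) (v s))"
      "(LINT r:{s..t}|lebesgue. B (g r) (v s)) = B (u t - u s) (v s)"
      using set_integrable_bounded_linear[OF bounded_linear_left gi, of "v s"] has_deriv_aeD(4)[OF u st] by simp_all
    have "B (u t) (v t) - B (u s) (v s) - (LINT r:{s..t}|lebesgue. ?F r)
      = (LINT r:{s..t}|lebesgue. B (u t) (h r) + B (g r) (v s)) - (LINT r:{s..t}|lebesgue. ?F r)"
      unfolding set_integral_add(2)[OF 1(1) 2(1)] 1(2) 2(2) by (simp add: diff_left diff_right)
    also have "\<dots> = (LINT r:{s..t}|lebesgue. (B (u t) (h r) + B (g r) (v s)) - ?F r)"
      by (rule set_integral_diff(2)[symmetric, OF set_integral_add(1)[OF 1(1) 2(1)] intF[OF st(1,3)]])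
    finally have eq: "B (u t) (v t) - B (u s) (v s) - (LINT r:{s..t}|lebesgue. ?F r) = \<dots>" .
    have "norm (\<dots>) \<le> (LINT r:{s..t}|lebesgue. norm ((B (u t) (h r) + B (g r) (v s)) - ?F r))"
      by (rule norm_set_integral_le)
    also have "\<dots> \<le> (LINT r:{s..t}|lebesgue. e * ?m r)"
    proof (rule set_integral_mono)
      show "set_integrable lebesgue {s..t} (\<lambda>r. norm ((B (u t) (h r) + B (g r) (v s)) - ?F r))"
        by (intro set_integrable_norm' set_integral_diff set_integral_add 1 2 int1 int2 st)
      show "set_integrable lebesgue {s..t} (\<lambda>r. e * ?m r)"
        using intm[OF st(1,3)] by simp
      fix r assume r: "r \<in> {s..t}"
      have "(B (u t) (h r) + B (g r) (v s)) - ?F r = B (u t - u r) (h r) - B (g r) (v r - v s)"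
        by (simp add: diff_left diff_right)
      also have "norm \<dots> \<le> norm (B (u t - u r) (h r)) + norm (B (g r) (v r - v s))"
        by (rule norm_triangle_ineq4)
      also have "norm (B (u t - u r) (h r)) \<le> (e / K) * norm (h r) * K"
        using osc[OF r] K(1) by (intro order_trans[OF K(2)] mult_right_mono) auto
      also have "norm (B (g r) (v r - v s)) \<le> norm (g r) * (e / K) * K"
        using osc[OF r] K(1) by (intro order_trans[OF K(2)] mult_right_mono mult_left_mono) auto
      finally show "norm ((B (u t) (h r) + B (g r) (v s)) - ?F r) \<le> e * ?m r"
        using K(1) by (simp add: algebra_simps)
    qed
    finally show ?thesis unfolding eq by simp
  qed
  have uc: "uniformly_continuous_on {0..T} u" "uniformly_continuous_on {0..T} v"
    using has_deriv_aeD(1)[OF u] has_deriv_aeD(1)[OF v] compact_uniformly_continuous by blast+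
  \<comment> \<open>\<open>P\<close> is the defect of the product rule; the local estimate makes it
    constant.\<close>
  define P where "P = (\<lambda>t. B (u t) (v t) - (LINT r:{0..t}|lebesgue. ?F r))"
  define M where "M = (\<lambda>t. LINT r:{0..t}|lebesgue. ?m r)"
  have P_diff: "P t - P s = B (u t) (v t) - B (u s) (v s) - (LINT r:{s..t}|lebesgue. ?F r)"
    if "0 \<le> s" "s \<le> t" "t \<le> T" for s t
    using set_integral_combine[OF intF[of 0 t], of s] that by (simp add: P_def)
  have M_diff: "M t - M s = (LINT r:{s..t}|lebesgue. ?m r)" if "0 \<le> s" "s \<le> t" "t \<le> T" for s t
    using set_integral_combine[OF intm[of 0 t], of s] that by (simp add: M_def)
  have P_eq: "P b = P a" if ab: "0 \<le> a" "a \<le> b" "b \<le> T" for a b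
  proof (rule fine_increment_eq[OF ab(2), of P M])
    fix e :: real assume e: "0 < e"
    then have "0 < e / K" using K by simp
    then obtain d1 d2 where d: "0 < d1" "0 < d2"
      "\<And>x y. x \<in> {0..T} \<Longrightarrow> y \<in> {0..T} \<Longrightarrow> dist x y < d1 \<Longrightarrow> dist (u x) (u y) < e / K"
      "\<And>x y. x \<in> {0..T} \<Longrightarrow> y \<in> {0..T} \<Longrightarrow> dist x y < d2 \<Longrightarrow> dist (v x) (v y) < e / K"
      using uc unfolding uniformly_continuous_on_def by metis
    show "\<exists>d>0. \<forall>s t. a \<le> s \<longrightarrow> s \<le> t \<longrightarrow> t \<le> b \<longrightarrow> t - s < d \<longrightarrow> norm (P t - P s) \<le> e * (M t - M s)"
    proof (intro exI[of _ "min d1 d2"] conjI allI impI)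
      show "0 < min d1 d2" using d by simp
      fix s t assume st: "a \<le> s" "s \<le> t" "t \<le> b" "t - s < min d1 d2"
      then have st': "0 \<le> s" "s \<le> t" "t \<le> T" using ab by auto
      have "norm (u t - u r) \<le> e / K \<and> norm (v r - v s) \<le> e / K" if "r \<in> {s..t}" for r
        using d(3)[of t r] d(4)[of r s] that st st' by (auto simp: dist_norm less_imp_le)
      from bound[OF st' e this]
      show "norm (P t - P s) \<le> e * (M t - M s)"
        by (simp add: P_diff[OF st'] M_diff[OF st'])
    qed
  qed
  show ?thesis
    unfolding has_deriv_ae_def
  proof (intro conjI allI impI)
    show "continuous_on {0..T} (\<lambda>t. B (u t) (v t))"
      using has_deriv_aeD(1)[OF u] has_deriv_aeD(1)[OF v] by (rule continuous_on)
    show "set_integrable lebesgue {0..T} ?F" by (rule intF) auto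
    fix s t assume st: "0 \<le> s" "s \<le> t" "t \<le> T"
    show "B (u t) (v t) - B (u s) (v s) = (LINT r:{s..t}|lebesgue. ?F r)"
      using P_diff[OF st] P_eq[OF st] by simp
  qed
qed

lemma sigma_finite_lebesgue: "sigma_finite_measure (lebesgue :: real measure)"
proof
  obtain A :: "real set set" where "countable A" "A \<subseteq> sets lborel" "\<Union>A = space lborel" "\<forall>a\<in>A. emeasure lborel a \<noteq> \<infinity>"
    using lborel.sigma_finite_countable by blast
  then show "\<exists>A::real set set. countable A \<and> A \<subseteq> sets lebesgue \<and> \<Union>A = space lebesgue \<and> (\<forall>a\<in>A. emeasure lebesgue a \<noteq> \<infinity>)"
    by (intro exI[of _ A]) (auto simp: subset_eq)
qed

lemma lebesgue_AE_eq_borel: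
  assumes "A \<in> sets lebesgue"
  obtains B where "B \<in> sets borel" "AE x in lebesgue. x \<in> A \<longleftrightarrow> x \<in> B"
proof -
  obtain S N N' where S: "A = S \<union> N" "S \<in> sets lborel" "N \<subseteq> N'" "N' \<in> null_sets lborel"
    using assms by (elim sets_completionE)
  have "AE x in lborel. x \<notin> N'" using S(4) by (rule AE_not_in)
  then have "AE x in lebesgue. x \<notin> N'" by (rule AE_completion)
  then have "AE x in lebesgue. x \<in> A \<longleftrightarrow> x \<in> S"
    by eventually_elim (use S in auto)
  then show ?thesis using S(2) that by simp
qed

text \<open>The sets with vanishing integral contain the intervals and are closed under complements
  and countable disjoint unions, hence contain all Borel sets; a Lebesgue set differs from a Borel
  set by a null set. Complements need the integral over the whole line, a limit over growing
  intervals.\<close>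

lemma AE_zero_if_Icc_integrals_zero:
  fixes f :: "real \<Rightarrow> 'b::{banach, second_countable_topology}"
  assumes f: "integrable lebesgue f" and zero: "\<And>a b. (LINT r:{a..b}|lebesgue. f r) = 0"
  shows "AE r in lebesgue. f r = 0"
proof (rule sigma_finite_measure.density_zero[OF sigma_finite_lebesgue f])
  have si: "set_integrable lebesgue A f" if "A \<in> sets lebesgue" for A
    unfolding set_integrable_def using f that by (intro integrable_mult_indicator)
  have total: "(LINT r|lebesgue. f r) = 0"
  proof -
    have "(\<lambda>i. LINT r:{- real i..real i}|lebesgue. f r) \<longlonglongrightarrow> (LINT r:(\<Union>i. {- real i..real i})|lebesgue. f r)"
    proof (rule set_integral_cont_up)
      show "incseq (\<lambda>i. {- real i..real i})" by (auto simp: incseq_def)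
    qed (auto intro!: si)
    moreover have "(\<Union>i. {- real i..real i}) = (UNIV :: real set)"
    proof -
      have "\<exists>i. - real i \<le> x \<and> x \<le> real i" for x :: real
        using real_arch_simple[of "\<bar>x\<bar>"] by (metis abs_le_iff minus_le_iff)
      then show ?thesis by auto
    qed
    ultimately have "(LINT r:UNIV|lebesgue. f r) = 0"
      using zero by (simp add: LIMSEQ_const_iff)
    then show ?thesis by (simp add: set_lebesgue_integral_def)
  qed
  have borel: "(LINT r:A|lebesgue. f r) = 0" if "A \<in> sets borel" for A
    using that
  proof (induction rule: borel_set_induct)
    case (compl A)
    have "(LINT r:A \<union> - A|lebesgue. f r) = (LINT r:A|lebesgue. f r) + (LINT r:- A|lebesgue. f r)"
      using compl by (intro set_integral_Un si) auto
    then show ?case using compl total by (simp add: set_lebesgue_integral_def)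
  next
    case (union A)
    note union = union.hyps(1) union.hyps(2) union.IH
    have "(LINT r:(\<Union>i. A i)|lebesgue. f r) = (\<Sum>i. LINT r:A i|lebesgue. f r)"
      using union by (intro lebesgue_integral_countable_add si) (auto simp: disjoint_family_on_def)
    then show ?case using union by simp
  qed (simp_all add: zero[unfolded set_lebesgue_integral_def] set_lebesgue_integral_def)
  fix A :: "real set" assume A: "A \<in> sets lebesgue"
  then obtain B where B: "B \<in> sets borel" "AE x in lebesgue. x \<in> A \<longleftrightarrow> x \<in> B"
    by (rule lebesgue_AE_eq_borel)
  have "(LINT r:A|lebesgue. f r) = (LINT r:B|lebesgue. f r)"
  proof (rule set_integral_cong_set)
    show "set_borel_measurable lebesgue B f" "set_borel_measurable lebesgue A f"
      using f A B unfolding set_borel_measurable_def by (auto intro!: borel_measurable_scaleR borel_measurable_indicator)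
    show "AE x in lebesgue. x \<in> B \<longleftrightarrow> x \<in> A" using B(2) by eventually_elim auto
  qed
  then show "(LINT r:A|lebesgue. f r) = 0" using borel[OF B(1)] by simp
qed

lemma AE_lebesgue_on_Ioo_iff:
  "(AE r in Leb T. P r) \<longleftrightarrow> (AE r in lebesgue. r \<in> {0<..<T} \<longrightarrow> P r)"
  by (subst AE_restrict_space_iff) auto

lemma has_deriv_ae_unique:
  assumes u: "has_deriv_ae T u g" and v: "has_deriv_ae T u h"
  shows "AE t in Leb T. g t = h t"
proof -
  define f where "f = (\<lambda>r. indicat_real {0..T} r *\<^sub>R (g r - h r))"
  have d: "has_deriv_ae T (\<lambda>t. 0) (\<lambda>t. g t - h t)"
    using has_deriv_ae_diff[OF u v] by simp
  have "AE r in lebesgue. f r = 0"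
  proof (rule AE_zero_if_Icc_integrals_zero)
    show "integrable lebesgue f"
      using has_deriv_aeD(2)[OF d] by (simp add: set_integrable_def f_def)
    fix a b :: real
    \<comment> \<open>\<open>{a..b}\<close> is clamped to \<open>{0..T}\<close>; an empty
      intersection shows up as \<open>s > t\<close>.\<close>
    define s t where "s = max 0 a" and "t = min T b"
    have "(LINT r:{a..b}|lebesgue. f r) = (LINT r:{s..t}|lebesgue. g r - h r)"
      unfolding set_lebesgue_integral_def f_def s_def t_def
      by (intro Bochner_Integration.integral_cong) (auto simp: indicator_def)
    also have "\<dots> = 0"
    proof (cases "s \<le> t")
      case True
      then show ?thesis using has_deriv_aeD(4)[OF d, of s t] by (simp add: s_def t_def)
    qed (simp add: set_lebesgue_integral_def)
    finally show "(LINT r:{a..b}|lebesgue. f r) = 0" .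
  qed
  then show ?thesis
    unfolding AE_lebesgue_on_Ioo_iff by eventually_elim (auto simp: f_def indicator_def)
qed

section \<open>Differentiability of Lipschitz functions with values in a reflexive space\<close>

text \<open>Pettis' argument: \<open>norm (g t - c) \<le> a\<close> is a countable conjunction of
  scalar conditions, so preimages of balls are measurable, and countably many balls form a
  base.\<close>

lemma borel_measurable_if_norming:
  fixes g :: "'s \<Rightarrow> 'a::{banach, second_countable_topology}"
  assumes W: "norming_sequence W" and m: "\<And>i. (\<lambda>t. blinfun_apply (W i) (g t)) \<in> borel_measurable M"
  shows "g \<in> borel_measurable M"
proof -
  have norm_m: "(\<lambda>t. norm (g t - c)) \<in> borel_measurable M" for c
  proof (subst borel_measurable_iff_le, intro allI)
    fix a
    have "(norm x \<le> a) = (\<forall>i. blinfun_apply (W i) x \<le> a)" for x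
      using norming_sequence_norm_le[OF W] W unfolding norming_sequence_def
      by (metis abs_le_D1 blinfun_apply_le_norm order_trans)
    then have "{t \<in> space M. norm (g t - c) \<le> a} = {t \<in> space M. \<forall>i. blinfun_apply (W i) (g t) - blinfun_apply (W i) c \<le> a}"
      by (simp add: blinfun.diff_right)
    also have "\<dots> \<in> sets M"
      using m by measurable
    finally show "{t \<in> space M. norm (g t - c) \<le> a} \<in> sets M" .
  qed
  obtain D :: "'a set" where D: "topological_basis (case_prod ball ` (D \<times> (\<rat> \<inter> {0<..})))" "countable D"
    using balls_countable_basis by metis
  have "countable (case_prod ball ` (D \<times> (\<rat> \<inter> {0<..})))"
    using D(2) countable_rat by (intro countable_image countable_SIGMA) auto
  then have eq: "borel = sigma UNIV (case_prod ball ` (D \<times> (\<rat> \<inter> {0<..})))"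
    using D(1) by (rule borel_eq_countable_basis)
  show ?thesis
    unfolding eq
  proof (rule measurable_measure_of)
    fix A :: "'a set" assume "A \<in> case_prod ball ` (D \<times> (\<rat> \<inter> {0<..}))"
    then obtain c r where A: "A = ball c r" by auto
    have "g -` A \<inter> space M = {t \<in> space M. norm (g t - c) < r}"
      by (auto simp: A dist_norm norm_minus_commute)
    also have "\<dots> \<in> sets M" using norm_m by measurable
    finally show "g -` A \<inter> space M \<in> sets M" .
  qed auto
qed

lemma set_integrable_const_bounded:
  fixes c :: "'b::{banach, second_countable_topology}"
  assumes "bounded S" "S \<in> sets lebesgue"
  shows "set_integrable lebesgue S (\<lambda>_. c)"
proof -
  have "S \<in> lmeasurable" using assms by (rule bounded_set_imp_lmeasurable)
  then have "integrable lebesgue (indicat_real S)"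
    by (intro integrable_real_indicator) (auto simp: fmeasurable_def)
  then show ?thesis unfolding set_integrable_def by (rule integrable_scaleR_left)
qed

section \<open>Dyadic difference quotients\<close>

lemma floor_cell_bounds:
  fixes t d :: real
  assumes "0 < d" "0 \<le> t"
  shows "real (nat \<lfloor>t / d\<rfloor>) * d \<le> t" "t < real (Suc (nat \<lfloor>t / d\<rfloor>)) * d"
proof -
  have "real (nat \<lfloor>t / d\<rfloor>) = of_int \<lfloor>t / d\<rfloor>" using assms by simp
  then have "real (nat \<lfloor>t / d\<rfloor>) \<le> t / d" "t / d < real (Suc (nat \<lfloor>t / d\<rfloor>))" by linarith+
  then show "real (nat \<lfloor>t / d\<rfloor>) * d \<le> t" "t < real (Suc (nat \<lfloor>t / d\<rfloor>)) * d"
    using assms(1) by (simp_all only: pos_le_divide_eq pos_divide_less_eq)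
qed

lemma step_function_integral:
  fixes F :: "nat \<Rightarrow> 'b::{banach, second_countable_topology}"
  assumes d: "0 < d"
  shows "set_integrable lebesgue {0..<real k * d} (\<lambda>t. F (nat \<lfloor>t / d\<rfloor>))
    \<and> (LINT t:{0..<real k * d}|lebesgue. F (nat \<lfloor>t / d\<rfloor>)) = (\<Sum>j<k. d *\<^sub>R F j)"
proof (induction k)
  case (Suc k)
  have le: "real k * d \<le> real (Suc k) * d" using d by simp
  have split: "{0..<real (Suc k) * d} = {0..<real k * d} \<union> {real k * d..<real (Suc k) * d}"
    by (rule ivl_disj_un_two(3)[symmetric]) (use d in auto)
  have cell: "nat \<lfloor>t / d\<rfloor> = k" if "t \<in> {real k * d..<real (Suc k) * d}" for t
  proof -
    have "\<lfloor>t / d\<rfloor> = int k"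
      using that d by (intro floor_unique) (auto simp: field_simps)
    then show ?thesis by simp
  qed
  have fin: "emeasure lebesgue {real k * d..<real (Suc k) * d} \<noteq> \<infinity>" using le by simp
  have meas: "measure lebesgue {real k * d..<real (Suc k) * d} = d"
    using le by (simp add: algebra_simps)
  have cI: "set_integrable lebesgue {real k * d..<real (Suc k) * d} (\<lambda>t. F k)"
    by (rule set_integrable_const_bounded) auto
  have eqI: "set_integrable lebesgue {real k * d..<real (Suc k) * d} (\<lambda>t. F (nat \<lfloor>t / d\<rfloor>))"
    using cI cell by (subst set_integrable_cong[OF refl refl, where f' = "\<lambda>t. F k"]) auto
  have "(LINT t:{real k * d..<real (Suc k) * d}|lebesgue. F (nat \<lfloor>t / d\<rfloor>)) = (LINT t:{real k * d..<real (Suc k) * d}|lebesgue. F k)"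
    using cell by (intro set_lebesgue_integral_cong) auto
  also have "\<dots> = d *\<^sub>R F k"
    using set_integral_const[of "{real k * d..<real (Suc k) * d}" lebesgue "F k"] fin meas by simp
  finally have int: "(LINT t:{real k * d..<real (Suc k) * d}|lebesgue. F (nat \<lfloor>t / d\<rfloor>)) = d *\<^sub>R F k" .
  show ?case
    unfolding split using Suc eqI int
    by (subst set_integral_Un) (auto intro!: set_integrable_Un)
qed (simp add: set_lebesgue_integral_def)

definition cell_quotient :: "real \<Rightarrow> (real \<Rightarrow> 'a::real_normed_vector) \<Rightarrow> nat \<Rightarrow> nat \<Rightarrow> 'a" where
  "cell_quotient T y n j =
     (1 / (T / 2 ^ n)) *\<^sub>R (y (real (Suc j) * (T / 2 ^ n)) - y (real j * (T / 2 ^ n)))"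

text \<open>For an absolutely continuous \<open>y\<close> this is the conditional expectation of the
  derivative on the cells of length \<open>T / 2 ^ n\<close>. The cells are half open, so at
  \<open>t = T\<close> values of \<open>y\<close> beyond \<open>T\<close> would enter; hence the
  restriction \<open>t < T\<close> in the estimates.\<close>

definition dyadic_quotient :: "real \<Rightarrow> (real \<Rightarrow> 'a::real_normed_vector) \<Rightarrow> nat \<Rightarrow> real \<Rightarrow> 'a" where
  "dyadic_quotient T y n t = cell_quotient T y n (nat \<lfloor>t / (T / 2 ^ n)\<rfloor>)"

lemma dyadic_quotient_bounded_linear:
  assumes "bounded_linear h"
  shows "dyadic_quotient T (\<lambda>t. h (y t)) n t = h (dyadic_quotient T y n t)"
  using assms by (simp add: dyadic_quotient_def cell_quotient_def linear_simps)

text \<open>Recasts the floor expression as a genuine increment over a cell inside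
  \<open>{0..T}\<close> around \<open>t\<close>, the form in which both the Lipschitz bound and the
  increment inequality of the limit can be applied.\<close>

lemma dyadic_quotient_tag:
  assumes T: "0 < T" and t: "0 \<le> t" "t < T"
  obtains a b where "0 \<le> a" "a \<le> t" "t < b" "b \<le> T" "b - a = T / 2 ^ n"
    "dyadic_quotient T y n t = (1 / (b - a)) *\<^sub>R (y b - y a)"
proof -
  define d where "d = T / 2 ^ n"
  have d: "0 < d" using T by (simp add: d_def)
  define j where "j = nat \<lfloor>t / d\<rfloor>"
  have j: "real j * d \<le> t" "t < real (Suc j) * d"
    using floor_cell_bounds[OF d t(1)] by (simp_all only: j_def)
  have Td: "T = 2 ^ n * d" by (simp add: d_def)
  have "real j * d < 2 ^ n * d" using j(1) t Td by linarith
  then have "real j < real (2 ^ n)" using d by simp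
  then have "Suc j \<le> 2 ^ n" by (simp only: of_nat_less_iff Suc_le_eq)
  then have "real (Suc j) \<le> 2 ^ n" by (metis of_nat_le_iff of_nat_numeral of_nat_power)
  then have "real (Suc j) * d \<le> T" unfolding Td using d by (intro mult_right_mono) auto
  moreover have "real (Suc j) * d - real j * d = d" by (simp add: algebra_simps)
  ultimately show ?thesis
    using j d by (intro that[of "real j * d" "real (Suc j) * d"])
      (auto simp only: d_def[symmetric] j_def[symmetric] dyadic_quotient_def cell_quotient_def mult_nonneg_nonneg of_nat_0_le_iff less_imp_le)
qed

lemma dyadic_quotient_norm_le:
  assumes T: "0 < T" and lip: "K-lipschitz_on {0..T} y" and t: "0 \<le> t" "t < T"
  shows "norm (dyadic_quotient T y n t) \<le> K"
proof -
  obtain a b where ab: "0 \<le> a" "a \<le> t" "t < b" "b \<le> T" "dyadic_quotient T y n t = (1 / (b - a)) *\<^sub>R (y b - y a)"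
    using dyadic_quotient_tag[OF T t] by metis
  have "norm (y b - y a) \<le> K * (b - a)"
    using lipschitz_onD[OF lip, of b a] ab by (simp add: dist_norm)
  then have "norm (y b - y a) / (b - a) \<le> K" using ab by (simp add: pos_divide_le_eq)
  then show ?thesis using ab by simp
qed

lemma dyadic_quotient_measurable:
  fixes y :: "real \<Rightarrow> 'a::{banach, second_countable_topology}"
  shows "dyadic_quotient T y n \<in> borel_measurable lebesgue"
proof -
  have "(\<lambda>t. dyadic_quotient T y n t) \<in> borel_measurable lborel"
    unfolding dyadic_quotient_def by measurable
  then show ?thesis by (rule measurable_completion)
qed

text \<open>The integral telescopes exactly up to the left end of the cell containing
  \<open>t\<close>. The incomplete cell contributes an integral and an increment of
  \<open>y\<close>, each at most \<open>K\<close> times the cell length, which explains the factor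
  \<open>2\<close>.\<close>

lemma dyadic_quotient_integral:
  fixes y :: "real \<Rightarrow> 'a::{banach, second_countable_topology}"
  assumes T: "0 < T" and lip: "K-lipschitz_on {0..T} y" and t: "0 \<le> t" "t < T"
  shows "norm ((LINT r:{0..t}|lebesgue. dyadic_quotient T y n r) - (y t - y 0)) \<le> 2 * K * (T / 2 ^ n)"
proof -
  define d where "d = T / 2 ^ n"
  have d: "0 < d" using T by (simp add: d_def)
  define k where "k = nat \<lfloor>t / d\<rfloor>"
  have k: "real k * d \<le> t" "t < real (Suc k) * d"
    using floor_cell_bounds[OF d t(1)] by (simp_all only: k_def)
  have K: "0 \<le> K" using lip by (rule lipschitz_on_nonneg)
  have "(LINT r:{0..<real k * d}|lebesgue. dyadic_quotient T y n r) = (\<Sum>j<k. d *\<^sub>R cell_quotient T y n j)"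
    using step_function_integral[OF d, of k "cell_quotient T y n"] by (simp add: dyadic_quotient_def d_def)
  also have "\<dots> = (\<Sum>j<k. y (real (Suc j) * d) - y (real j * d))"
    using d by (intro sum.cong refl) (simp add: cell_quotient_def d_def)
  also have "\<dots> = y (real k * d) - y 0"
    using sum_lessThan_telescope[of "\<lambda>j. y (real j * d)" k] by simp
  finally have 1: "(LINT r:{0..<real k * d}|lebesgue. dyadic_quotient T y n r) = y (real k * d) - y 0" .
  have meas: "set_borel_measurable lebesgue S (dyadic_quotient T y n)" if "S \<in> sets lebesgue" for S
    unfolding set_borel_measurable_def
    using that dyadic_quotient_measurable[of T y n]
    by (intro borel_measurable_scaleR borel_measurable_indicator) simp_all
  have si: "set_integrable lebesgue {0..t} (dyadic_quotient T y n)"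
  proof (rule set_integrable_bound)
    show "set_integrable lebesgue {0..t} (\<lambda>r. K)"
      by (rule set_integrable_const_bounded) auto
    show "AE r in lebesgue. r \<in> {0..t} \<longrightarrow> norm (dyadic_quotient T y n r) \<le> norm K"
      using dyadic_quotient_norm_le[OF T lip] t K by (intro AE_I2) auto
  qed (rule meas, simp)
  have kd: "0 \<le> real k * d" using d by simp
  have split: "{0..t} = {0..<real k * d} \<union> {real k * d..t}"
    using k(1) kd by auto
  have 2: "(LINT r:{0..t}|lebesgue. dyadic_quotient T y n r) = (LINT r:{0..<real k * d}|lebesgue. dyadic_quotient T y n r)
      + (LINT r:{real k * d..t}|lebesgue. dyadic_quotient T y n r)"
    using k(1) kd by (subst split, intro set_integral_Un) (auto intro!: set_integrable_subset[OF si])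
  have "norm (LINT r:{real k * d..t}|lebesgue. dyadic_quotient T y n r) \<le> (LINT r:{real k * d..t}|lebesgue. norm (dyadic_quotient T y n r))"
    by (rule norm_set_integral_le)
  also have "\<dots> \<le> (LINT r:{real k * d..t}|lebesgue. K)"
  proof (rule set_integral_mono)
    show "set_integrable lebesgue {real k * d..t} (\<lambda>r. norm (dyadic_quotient T y n r))"
      using d by (intro set_integrable_norm' set_integrable_subset[OF si]) auto
    show "set_integrable lebesgue {real k * d..t} (\<lambda>r. K)"
      by (rule set_integrable_const_bounded) auto
    have "0 \<le> real k * d" using d by simp
    then show "norm (dyadic_quotient T y n r) \<le> K" if "r \<in> {real k * d..t}" for r
      using dyadic_quotient_norm_le[OF T lip] t that by auto
  qed
  also have "\<dots> = (t - real k * d) * K"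
    using set_integral_const[of "{real k * d..t}" lebesgue K] k by simp
  also have "\<dots> \<le> d * K" using k K by (intro mult_right_mono) (auto simp: algebra_simps)
  finally have 3: "norm (LINT r:{real k * d..t}|lebesgue. dyadic_quotient T y n r) \<le> d * K" .
  have "norm (y (real k * d) - y t) \<le> K * (t - real k * d)"
    using lipschitz_onD[OF lip, of "real k * d" t] k(1) t d by (auto simp: dist_norm)
  also have "\<dots> \<le> K * d" using k K by (intro mult_left_mono) (auto simp: algebra_simps)
  finally have 4: "norm (y (real k * d) - y t) \<le> K * d" .
  have "norm ((LINT r:{0..t}|lebesgue. dyadic_quotient T y n r) - (y t - y 0))
      = norm ((y (real k * d) - y t) + (LINT r:{real k * d..t}|lebesgue. dyadic_quotient T y n r))"
    unfolding 2 1 by (simp add: algebra_simps)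
  also have "\<dots> \<le> K * d + d * K" using 3 4 norm_triangle_mono by blast
  finally show ?thesis by (simp add: d_def)
qed

text \<open>The dyadic quotients of a scalar function form a martingale. Orthogonality of its increments and
  the uniform bound make it Cauchy in \<open>L\<^sup>2\<close>, hence in \<open>L\<^sup>1\<close>.\<close>

lemma dyadic_quotient_orthogonal:
  fixes f :: "real \<Rightarrow> real"
  assumes T: "0 < T" and nm: "m \<le> n"
  shows "(LINT t:{0..<T}|lebesgue. dyadic_quotient T f n t * dyadic_quotient T f m t)
    = (LINT t:{0..<T}|lebesgue. dyadic_quotient T f m t * dyadic_quotient T f m t)"
    and "set_integrable lebesgue {0..<T} (\<lambda>t. dyadic_quotient T f n t * dyadic_quotient T f m t)"
proof -
  let ?c = "cell_quotient T f"
  define p :: nat where "p = 2 ^ (n - m)"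
  define d where "d = T / 2 ^ n"
  define d' where "d' = T / 2 ^ m"
  have p: "0 < p" and pow: "2 ^ n = 2 ^ m * p" using nm by (auto simp: p_def simp flip: power_add)
  have powr: "(2::real) ^ n = 2 ^ m * real p" using nm by (simp add: p_def flip: power_add)
  have d: "0 < d" "0 < d'" and d': "d' = real p * d"
    using T p by (auto simp: d_def d'_def powr)
  \<comment> \<open>A cell of level \<open>m\<close> consists of \<open>p\<close> consecutive cells
    of level \<open>n\<close>, so its index is the quotient by \<open>p\<close>.\<close>
  have idx: "nat \<lfloor>t / d'\<rfloor> = nat \<lfloor>t / d\<rfloor> div p" for t
  proof -
    have "\<lfloor>(t / d) / real_of_int (int p)\<rfloor> = \<lfloor>t / d\<rfloor> div int p"
      by (rule floor_divide_real_eq_div) simp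
    then have "\<lfloor>t / d'\<rfloor> = \<lfloor>t / d\<rfloor> div int p" using d' by (simp add: mult.commute)
    then show ?thesis by (simp add: nat_div_distrib')
  qed
  have prod: "dyadic_quotient T f n t * dyadic_quotient T f m t = (\<lambda>j. ?c n j * ?c m (j div p)) (nat \<lfloor>t / d\<rfloor>)" for t
    using idx[of t] by (simp add: dyadic_quotient_def d_def d'_def)
  have T1: "real (2 ^ n) * d = T" "real (2 ^ m) * d' = T" by (auto simp: d_def d'_def)
  show "set_integrable lebesgue {0..<T} (\<lambda>t. dyadic_quotient T f n t * dyadic_quotient T f m t)"
    unfolding prod using step_function_integral[OF d(1), of "2 ^ n" "\<lambda>j. ?c n j * ?c m (j div p)"] T1 by simp
  have "(LINT t:{0..<T}|lebesgue. dyadic_quotient T f n t * dyadic_quotient T f m t)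
      = (\<Sum>j<2 ^ n. d * (?c n j * ?c m (j div p)))"
    unfolding prod using step_function_integral[OF d(1), of "2 ^ n" "\<lambda>j. ?c n j * ?c m (j div p)"] T1 by simp
  \<comment> \<open>The fine cells are grouped by coarse cells: on each group the coarse quotient is
    constant and the fine increments telescope to the coarse increment.\<close>
  also have "\<dots> = (\<Sum>k<2 ^ m. \<Sum>j=k * p..<k * p + p. d * (?c n j * ?c m (j div p)))"
    unfolding pow by (rule sum.nat_group[symmetric])
  also have "\<dots> = (\<Sum>k<2 ^ m. d' * (?c m k * ?c m k))"
  proof (rule sum.cong[OF refl])
    fix k :: nat
    have "(\<Sum>j=k * p..<k * p + p. d * (?c n j * ?c m (j div p)))
        = (\<Sum>j=k * p..<k * p + p. (f (real (Suc j) * d) - f (real j * d)) * ?c m k)"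
    proof (rule sum.cong[OF refl])
      fix j assume j: "j \<in> {k * p..<k * p + p}"
      have "j div p = k" using j p by (intro div_nat_eqI) (auto simp: mult.commute)
      moreover have "d * ?c n j = f (real (Suc j) * d) - f (real j * d)"
        using d by (simp add: cell_quotient_def d_def)
      ultimately show "d * (?c n j * ?c m (j div p)) = (f (real (Suc j) * d) - f (real j * d)) * ?c m k"
        by (metis mult.assoc)
    qed
    also have "\<dots> = (f (real (k * p + p) * d) - f (real (k * p) * d)) * ?c m k"
      using sum_Suc_diff'[of "k * p" "k * p + p" "\<lambda>j. f (real j * d)"]
      by (simp flip: sum_distrib_right)
    also have "real (k * p + p) * d = real (Suc k) * d'" by (simp add: d' algebra_simps)
    also have "real (k * p) * d = real k * d'" by (simp add: d' algebra_simps)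
    also have "f (real (Suc k) * d') - f (real k * d') = d' * ?c m k"
      using d by (simp add: cell_quotient_def d'_def)
    finally show "(\<Sum>j=k * p..<k * p + p. d * (?c n j * ?c m (j div p))) = d' * (?c m k * ?c m k)"
      by (simp add: mult_ac)
  qed
  also have "\<dots> = (LINT t:{0..<T}|lebesgue. dyadic_quotient T f m t * dyadic_quotient T f m t)"
    using step_function_integral[OF d(2), of "2 ^ m" "\<lambda>j. ?c m j * ?c m j"] T1
    by (simp add: dyadic_quotient_def d'_def)
  finally show "(LINT t:{0..<T}|lebesgue. dyadic_quotient T f n t * dyadic_quotient T f m t)
    = (LINT t:{0..<T}|lebesgue. dyadic_quotient T f m t * dyadic_quotient T f m t)" .
qed

lemma dyadic_quotient_L1_Cauchy:
  fixes f :: "real \<Rightarrow> real"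
  assumes T: "0 < T" and lip: "K-lipschitz_on {0..T} f" and e: "0 < e"
  shows "\<exists>N. \<forall>m\<ge>N. \<forall>n\<ge>N. (LINT t:{0..<T}|lebesgue. \<bar>dyadic_quotient T f n t - dyadic_quotient T f m t\<bar>) < e"
proof -
  let ?q = "dyadic_quotient T f"
  define a where "a = (\<lambda>n. LINT t:{0..<T}|lebesgue. ?q n t * ?q n t)"
  have si: "set_integrable lebesgue {0..<T} (\<lambda>t. ?q n t * ?q m t)" for m n
    using dyadic_quotient_orthogonal(2)[OF T, of m n f] dyadic_quotient_orthogonal(2)[OF T, of n m f]
    by (cases "m \<le> n") (auto simp: mult.commute)
  have ci: "set_integrable lebesgue {0..<T} (\<lambda>r. c)" for c :: real
    by (rule set_integrable_const_bounded) auto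
  have sd: "set_integrable lebesgue {0..<T} (\<lambda>t. (?q n t - ?q m t)\<^sup>2)" for m n
  proof -
    have eq: "(?q n t - ?q m t)\<^sup>2 = ?q n t * ?q n t - ?q n t * ?q m t - ?q m t * ?q n t + ?q m t * ?q m t" for t
      by (simp add: power2_eq_square algebra_simps)
    show ?thesis unfolding eq by (intro set_integral_add set_integral_diff si)
  qed
  \<comment> \<open>Pythagoras: the squared distance is the difference of the squared norms
    \<open>a\<close>, so it is enough that the monotone sequence \<open>a\<close> is
    bounded.\<close>
  have diff: "(LINT t:{0..<T}|lebesgue. (?q n t - ?q m t)\<^sup>2) = a n - a m" if "m \<le> n" for m n
  proof -
    have eq: "(?q n t - ?q m t)\<^sup>2 = (?q n t * ?q n t + ?q m t * ?q m t) - (?q n t * ?q m t + ?q n t * ?q m t)" for t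
      by (simp add: power2_eq_square algebra_simps)
    have sym: "(LINT t:{0..<T}|lebesgue. ?q m t * ?q n t) = (LINT t:{0..<T}|lebesgue. ?q n t * ?q m t)"
      by (simp add: mult.commute)
    have "(LINT t:{0..<T}|lebesgue. (?q n t - ?q m t)\<^sup>2) = (a n + a m) - ((LINT t:{0..<T}|lebesgue. ?q n t * ?q m t) + (LINT t:{0..<T}|lebesgue. ?q n t * ?q m t))"
      unfolding eq a_def by (simp add: si sym)
    then show ?thesis using dyadic_quotient_orthogonal(1)[OF T that, of f] by (simp add: a_def)
  qed
  have "incseq a"
  proof (rule incseq_SucI)
    fix n
    have "0 \<le> (LINT t:{0..<T}|lebesgue. (?q (Suc n) t - ?q n t)\<^sup>2)"
      unfolding set_lebesgue_integral_def by (intro Bochner_Integration.integral_nonneg) (simp add: indicator_def)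
    then show "a n \<le> a (Suc n)" by (simp add: diff)
  qed
  moreover have "a n \<le> K * K * T" for n
  proof -
    have K: "0 \<le> K" using lip by (rule lipschitz_on_nonneg)
    have "a n \<le> (LINT t:{0..<T}|lebesgue. K * K)"
      unfolding a_def
    proof (intro set_integral_mono si ci)
      fix t assume "t \<in> {0..<T}"
      then have "\<bar>?q n t\<bar> \<le> K" using dyadic_quotient_norm_le[OF T lip, of t n] by simp
      then have "\<bar>?q n t\<bar> * \<bar>?q n t\<bar> \<le> K * K" using K by (intro mult_mono) auto
      then show "?q n t * ?q n t \<le> K * K" by (simp add: abs_mult_self_eq)
    qed
    also have "\<dots> = K * K * T" using set_integral_const[of "{0..<T}" lebesgue "K * K"] T by (simp add: mult.commute)
    finally show ?thesis .
  qed
  ultimately have "convergent a" using incseq_convergent by (metis convergentI)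
  then have "Cauchy a" by (rule convergent_Cauchy)
  \<comment> \<open>The pointwise bound \<open>|x| \<le> c + x\<^sup>2 / c\<close>, in place of the
    Cauchy-Schwarz inequality, bounds the \<open>L\<^sup>1\<close> distance by
    \<open>T * c + (a n - a m) / c\<close>. This \<open>c\<close> makes the first term
    \<open>e / 2\<close>, and \<open>N\<close> keeps the second below \<open>e / 2\<close>.\<close>
  define c where "c = e / (2 * T)"
  have c: "0 < c" using e T by (simp add: c_def)
  obtain N where N: "\<And>m n. N \<le> m \<Longrightarrow> N \<le> n \<Longrightarrow> dist (a m) (a n) < c * e / 2"
    using \<open>Cauchy a\<close> c e unfolding Cauchy_def by (metis half_gt_zero mult_pos_pos)
  have main: "(LINT t:{0..<T}|lebesgue. \<bar>?q n t - ?q m t\<bar>) < e" if mn: "N \<le> m" "m \<le> n" for m n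
  proof -
    have sd': "set_integrable lebesgue {0..<T} (\<lambda>t. (?q n t - ?q m t)\<^sup>2 / c)"
      by (intro set_integrable_divide impI sd)
    have "(LINT t:{0..<T}|lebesgue. \<bar>?q n t - ?q m t\<bar>) \<le> (LINT t:{0..<T}|lebesgue. c + (?q n t - ?q m t)\<^sup>2 / c)"
    proof (rule set_integral_mono)
      show "set_integrable lebesgue {0..<T} (\<lambda>t. c + (?q n t - ?q m t)\<^sup>2 / c)"
        by (intro set_integral_add ci sd')
      have le: "\<bar>x\<bar> \<le> c + x\<^sup>2 / c" for x :: real
      proof (cases "\<bar>x\<bar> \<le> c")
        case True
        then show ?thesis using c by (meson add_increasing2 less_imp_le zero_le_divide_iff zero_le_power2)
      next
        case False
        then have "c * \<bar>x\<bar> \<le> \<bar>x\<bar> * \<bar>x\<bar>" using c by (intro mult_right_mono) auto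
        then have "\<bar>x\<bar> \<le> x\<^sup>2 / c" using c by (simp add: field_simps power2_eq_square)
        then show ?thesis using c by simp
      qed
      show "\<bar>?q n t - ?q m t\<bar> \<le> c + (?q n t - ?q m t)\<^sup>2 / c" for t by (rule le)
      show "set_integrable lebesgue {0..<T} (\<lambda>t. \<bar>?q n t - ?q m t\<bar>)"
      proof (rule set_integrable_bound)
        show "set_integrable lebesgue {0..<T} (\<lambda>t. c + (?q n t - ?q m t)\<^sup>2 / c)"
          by (intro set_integral_add ci sd')
        show "set_borel_measurable lebesgue {0..<T} (\<lambda>t. \<bar>?q n t - ?q m t\<bar>)"
          unfolding set_borel_measurable_def
          using dyadic_quotient_measurable[of T f n]
            dyadic_quotient_measurable[of T f m]
          by (intro borel_measurable_scaleR borel_measurable_indicator borel_measurable_abs borel_measurable_diff) simp_all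
        show "AE t in lebesgue. t \<in> {0..<T} \<longrightarrow> norm \<bar>?q n t - ?q m t\<bar> \<le> norm (c + (?q n t - ?q m t)\<^sup>2 / c)"
          using le by (intro AE_I2) (smt (verit) real_norm_def)
      qed
    qed
    also have "\<dots> = (LINT t:{0..<T}|lebesgue. c) + (LINT t:{0..<T}|lebesgue. (?q n t - ?q m t)\<^sup>2 / c)"
      by (rule set_integral_add(2)[OF ci sd'])
    also have "\<dots> = T * c + (a n - a m) / c"
      using set_integral_const[of "{0..<T}" lebesgue c] T by (simp add: diff[OF mn(2)])
    also have "\<dots> < T * c + e / 2"
    proof -
      have "a n - a m < c * e / 2" using N[of n m] mn abs_ge_self[of "a n - a m"] unfolding dist_real_def by linarith
      then show ?thesis using c by (simp add: field_simps)
    qed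
    also have "\<dots> = e" using T by (simp add: c_def)
    finally show ?thesis .
  qed
  have "(LINT t:{0..<T}|lebesgue. \<bar>?q n t - ?q m t\<bar>) < e" if "N \<le> m" "N \<le> n" for m n
    using main[of m n] main[of n m] that by (cases "m \<le> n") (auto simp: abs_minus_commute)
  then show ?thesis by blast
qed

text \<open>The Radon-Nikodym property of a separable reflexive space. Against each functional of a
  norming sequence the dyadic quotients converge almost everywhere along a subsequence; a diagonal
  subsequence serves all functionals, and boundedness with reflexivity turns this into weak
  convergence. Dominated convergence identifies the limit as a density of \<open>y\<close>. The weak
  convergence is part of the conclusion because it later localises an inequality between
  increments.\<close>

theorem lipschitz_imp_has_deriv_ae:
  fixes y :: "real \<Rightarrow> 'a::{banach, second_countable_topology}"
  assumes refl: "reflexive_space TYPE('a)" and T: "0 < T" and lip: "K-lipschitz_on {0..T} y"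
  obtains g r where "strict_mono r" "has_deriv_ae T y g" "\<And>t. norm (g t) \<le> K"
    "AE t in lebesgue. t \<in> {0..<T} \<longrightarrow> weakly_tendsto (\<lambda>k. dyadic_quotient T y (r k) t) (g t) sequentially"
proof -
  obtain W :: "nat \<Rightarrow> 'a dual" where W: "norming_sequence W" by (rule norming_sequence_exists)
  let ?q = "dyadic_quotient T y"
  have K0: "0 \<le> K" using lip by (rule lipschitz_on_nonneg)
  define s where "s = (\<lambda>i n t. indicat_real {0..<T} t * blinfun_apply (W i) (?q n t))"
  have s_meas: "s i n \<in> borel_measurable lebesgue" for i n
    unfolding s_def using dyadic_quotient_measurable[of T y n]
    by (intro borel_measurable_times borel_measurable_indicator borel_measurable_bilinear[OF bounded_bilinear_blinfun_apply]) auto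
  have s_le: "\<bar>s i n t\<bar> \<le> K * indicat_real {0..<T} t" for i n t
    using dyadic_quotient_norm_le[OF T lip, of t n] W blinfun_apply_le_norm[of "W i" "?q n t"]
    by (auto simp: s_def norming_sequence_def indicator_def intro: order_trans)
  have ind_int: "integrable lebesgue (\<lambda>t. K * indicat_real {0..<T} t)"
    using set_integrable_const_bounded[of "{0..<T}" K] by (simp add: set_integrable_def mult.commute)
  have s_int: "integrable lebesgue (s i n)" for i n
    using s_le by (intro Bochner_Integration.integrable_bound[OF ind_int s_meas]) (auto simp: abs_mult K0)
  define P where "P = (\<lambda>i r. AE t in lebesgue. convergent (\<lambda>k. s i (r k) t))"
  have P_iff: "P i r \<longleftrightarrow> (AE t in lebesgue. convergent (\<lambda>k. s i (r k) t))" for i r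
    by (simp add: P_def)
  interpret subseqs P
  proof
    fix i :: nat and r0 :: "nat \<Rightarrow> nat" assume r0: "strict_mono r0"
    have lipi: "K-lipschitz_on {0..T} (\<lambda>t. blinfun_apply (W i) (y t))"
    proof (rule lipschitz_onI[OF _ K0])
      fix a b assume ab: "a \<in> {0..T}" "b \<in> {0..T}"
      have "\<bar>blinfun_apply (W i) (y a - y b)\<bar> \<le> norm (y a - y b)"
        using W by (intro blinfun_apply_le_norm) (simp add: norming_sequence_def)
      then show "dist (blinfun_apply (W i) (y a)) (blinfun_apply (W i) (y b)) \<le> K * dist a b"
        using lipschitz_onD[OF lip ab] by (simp add: dist_norm blinfun.diff_right)
    qed
    obtain r' where r': "strict_mono r'" "AE t in lebesgue. Cauchy (\<lambda>k. s i (r0 (r' k)) t)"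
    proof (rule cauchy_L1_AE_cauchy_subseq[of lebesgue "\<lambda>n. s i (r0 n)"])
      show "integrable lebesgue (s i (r0 n))" for n by (rule s_int)
      fix e :: real assume "0 < e"
      from dyadic_quotient_L1_Cauchy[OF T lipi this] obtain N where
        N: "\<And>m n. N \<le> m \<Longrightarrow> N \<le> n \<Longrightarrow> (LINT t:{0..<T}|lebesgue. \<bar>dyadic_quotient T (\<lambda>t. blinfun_apply (W i) (y t)) n t
          - dyadic_quotient T (\<lambda>t. blinfun_apply (W i) (y t)) m t\<bar>) < e" by blast
      have "(LINT t|lebesgue. norm (s i n t - s i m t)) < e" if "N \<le> m" "N \<le> n" for m n
      proof -
        have "(LINT t|lebesgue. norm (s i n t - s i m t)) = (LINT t:{0..<T}|lebesgue. \<bar>dyadic_quotient T (\<lambda>t. blinfun_apply (W i) (y t)) n t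
          - dyadic_quotient T (\<lambda>t. blinfun_apply (W i) (y t)) m t\<bar>)"
          unfolding set_lebesgue_integral_def s_def dyadic_quotient_bounded_linear[OF blinfun.bounded_linear_right]
          by (intro Bochner_Integration.integral_cong) (auto simp: indicator_def)
        then show ?thesis using N[OF that] by simp
      qed
      then show "\<exists>N. \<forall>n\<ge>N. \<forall>m\<ge>N. (LINT t|lebesgue. norm (s i (r0 n) t - s i (r0 m) t)) < e"
        using seq_suble[OF r0] order_trans by metis
    qed
    then show "\<exists>r'. strict_mono r' \<and> P i (r0 \<circ> r')"
      by (auto simp: P_def Cauchy_convergent_iff)
  qed
  \<comment> \<open>The diagonal sequence is a refinement of the \<open>i\<close>-th subsequence
    only after finitely many terms; dropping \<open>Suc i\<close> terms is harmless for
    convergence.\<close>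
  have shift: "P i (diagseq \<circ> (+) (Suc i))" for i
  proof (rule diagseq_holds)
    fix r s n assume r: "strict_mono (r :: nat \<Rightarrow> nat)" and P: "P n s"
    show "P n (s \<circ> r)"
      using P unfolding P_def
      by eventually_elim (use convergent_subseq_convergent[OF _ r] in \<open>simp add: o_def\<close>)
  qed
  define r where "r = diagseq"
  have r: "strict_mono r" unfolding r_def by (rule subseq_diagseq)
  have conv: "AE t in lebesgue. \<forall>i. convergent (\<lambda>k. s i (r k) t)"
    unfolding AE_all_countable
  proof
    fix i
    have imp: "convergent (\<lambda>k. s i (r k) t)" if "convergent (\<lambda>k. s i ((diagseq \<circ> (+) (Suc i)) k) t)" for t
      using that convergent_ignore_initial_segment[of "\<lambda>k. s i (diagseq k) t" "Suc i"]
      by (simp only: r_def o_def add.commute[of "Suc i"])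
    show "AE t in lebesgue. convergent (\<lambda>k. s i (r k) t)"
      using P_iff[THEN iffD1, OF shift[of i]] by eventually_elim (rule imp)
  qed
  \<comment> \<open>The Cauchy property makes the set visibly measurable. Off \<open>G\<close> the
    density receives the value \<open>0\<close>, which keeps it bounded by \<open>K\<close>
    everywhere.\<close>
  define G where "G = {t \<in> space lebesgue. \<forall>i. Cauchy (\<lambda>k. s i (r k) t)} \<inter> {0..<T}"
  have G: "G \<in> sets lebesgue"
  proof -
    have "{t \<in> space lebesgue. Cauchy (\<lambda>k. s i (r k) t)} \<in> sets lebesgue" for i
      by (rule sets_Collect_Cauchy) (rule s_meas)
    then have "{t \<in> space lebesgue. \<forall>i. Cauchy (\<lambda>k. s i (r k) t)} \<in> sets lebesgue"
      by (rule sets.sets_Collect_countable_All)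
    then show ?thesis unfolding G_def by auto
  qed
  define g where "g = (\<lambda>t. if t \<in> G then (SOME x. weakly_tendsto (\<lambda>k. ?q (r k) t) x sequentially) else 0)"
  have g: "weakly_tendsto (\<lambda>k. ?q (r k) t) (g t) sequentially" if t: "t \<in> G" for t
  proof -
    have t': "0 \<le> t" "t < T" using t by (auto simp: G_def)
    have "\<exists>x. weakly_tendsto (\<lambda>k. ?q (r k) t) x sequentially"
    proof (rule bounded_weakly_convergent[OF refl W])
      show "norm (?q (r k) t) \<le> K" for k by (rule dyadic_quotient_norm_le[OF T lip t'])
      show "convergent (\<lambda>k. blinfun_apply (W i) (?q (r k) t))" for i
        using t by (auto simp: G_def s_def Cauchy_convergent_iff)
    qed
    then show ?thesis unfolding g_def if_P[OF t] by (rule someI_ex)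
  qed
  have AE_G: "AE t in lebesgue. t \<in> {0..<T} \<longrightarrow> t \<in> G"
    using conv by eventually_elim (simp add: G_def Cauchy_convergent_iff)
  have g_norm: "norm (g t) \<le> K" for t
  proof (cases "t \<in> G")
    case True
    then have "0 \<le> t" "t < T" by (auto simp: G_def)
    then show ?thesis
      using weakly_tendsto_norm_le[OF g[OF True], of K] dyadic_quotient_norm_le[OF T lip] by simp
  qed (simp add: g_def K0)
  have lim_s: "(\<lambda>k. indicat_real G t * s i (r k) t) \<longlonglongrightarrow> blinfun_apply (W i) (g t)" for i t
  proof (cases "t \<in> G")
    case True
    then have "(\<lambda>k. blinfun_apply (W i) (?q (r k) t)) \<longlonglongrightarrow> blinfun_apply (W i) (g t)"
      using g[OF True] unfolding weakly_tendsto_def by blast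
    moreover have "t \<in> {0..<T}" using True by (simp add: G_def)
    ultimately show ?thesis using True by (simp add: s_def)
  qed (simp add: g_def)
  have g_meas: "g \<in> borel_measurable lebesgue"
  proof (rule borel_measurable_if_norming[OF W])
    fix i
    show "(\<lambda>t. blinfun_apply (W i) (g t)) \<in> borel_measurable lebesgue"
      by (rule borel_measurable_LIMSEQ_metric[OF _ lim_s])
        (intro borel_measurable_times borel_measurable_indicator G s_meas)
  qed
  have g_int: "set_integrable lebesgue {a..b} g" for a b
    unfolding set_integrable_def
  proof (rule Bochner_Integration.integrable_bound)
    show "integrable lebesgue (\<lambda>t. K * indicat_real {a..b} t)"
      using set_integrable_const_bounded[of "{a..b}" K] by (simp add: set_integrable_def mult.commute)
    show "AE t in lebesgue. norm (indicat_real {a..b} t *\<^sub>R g t) \<le> norm (K * indicat_real {a..b} t)"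
      using g_norm K0 by (intro AE_I2) (simp add: indicator_def)
  qed (intro borel_measurable_scaleR borel_measurable_indicator g_meas, simp)
  \<comment> \<open>The half-open cells restrict this to \<open>t < T\<close>; \<open>prim_T\<close>
    reaches the end point by the Lipschitz bounds for \<open>y\<close> and for the integral.\<close>
  have prim_lt: "y t - y 0 = (LINT r:{0..t}|lebesgue. g r)" if t: "0 \<le> t" "t < T" for t
  proof -
    let ?x = "y t - y 0 - (LINT r:{0..t}|lebesgue. g r)"
    have "blinfun_apply (W i) ?x = 0" for i
    proof -
      let ?w = "blinfun_apply (W i)"
      have lim1: "(\<lambda>k. LINT x:{0..t}|lebesgue. ?w (?q (r k) x)) \<longlonglongrightarrow> (LINT x:{0..t}|lebesgue. ?w (g x))"
        unfolding set_lebesgue_integral_def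
      proof (rule integral_dominated_convergence)
        show "integrable lebesgue (\<lambda>t. K * indicat_real {0..<T} t)" by (rule ind_int)
        show "(\<lambda>x. indicat_real {0..t} x *\<^sub>R ?w (g x)) \<in> borel_measurable lebesgue"
          using borel_measurable_bilinear[OF bounded_bilinear_blinfun_apply borel_measurable_const g_meas]
          by (intro borel_measurable_scaleR borel_measurable_indicator) auto
        have eq: "indicat_real {0..t} x *\<^sub>R ?w (?q (r k) x) = indicat_real {0..t} x * s i (r k) x" for x k
          using t by (auto simp: s_def indicator_def)
        show "(\<lambda>x. indicat_real {0..t} x *\<^sub>R ?w (?q (r k) x)) \<in> borel_measurable lebesgue" for k
          unfolding eq by (intro borel_measurable_times borel_measurable_indicator s_meas) simp
        show "AE x in lebesgue. norm (indicat_real {0..t} x *\<^sub>R ?w (?q (r k) x)) \<le> K * indicat_real {0..<T} x" for k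
          unfolding eq
        proof (rule AE_I2)
          fix x
          have "norm (indicat_real {0..t} x * s i (r k) x) \<le> \<bar>s i (r k) x\<bar>" by (simp add: indicator_def)
          then show "norm (indicat_real {0..t} x * s i (r k) x) \<le> K * indicat_real {0..<T} x"
            using s_le[of i "r k" x] by (rule order_trans)
        qed
        show "AE x in lebesgue. (\<lambda>k. indicat_real {0..t} x *\<^sub>R ?w (?q (r k) x)) \<longlonglongrightarrow> indicat_real {0..t} x *\<^sub>R ?w (g x)"
          using AE_G
        proof eventually_elim
          fix x assume x: "x \<in> {0..<T} \<longrightarrow> x \<in> G"
          show "(\<lambda>k. indicat_real {0..t} x *\<^sub>R ?w (?q (r k) x)) \<longlonglongrightarrow> indicat_real {0..t} x *\<^sub>R ?w (g x)"
          proof (cases "x \<in> {0..t}")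
            case True
            then have "x \<in> G" using x t by auto
            from g[OF this] show ?thesis unfolding weakly_tendsto_def by (intro tendsto_scaleR tendsto_const) blast
          qed simp
        qed
      qed
      have q_int: "set_integrable lebesgue {0..t} (?q n)" for n
      proof -
        have "set_integrable lebesgue {0..<real (2 ^ n) * (T / 2 ^ n)} (?q n)"
          using step_function_integral[of "T / 2 ^ n" "2 ^ n" "cell_quotient T y n"] T
          unfolding dyadic_quotient_def by simp
        then show ?thesis by (rule set_integrable_subset) (use t in auto)
      qed
      have "(\<lambda>k. (LINT x:{0..t}|lebesgue. ?q (r k) x) - (y t - y 0)) \<longlonglongrightarrow> 0"
      proof (rule Lim_null_comparison)
        show "\<forall>\<^sub>F k in sequentially. norm ((LINT x:{0..t}|lebesgue. ?q (r k) x) - (y t - y 0)) \<le> 2 * K * (T / 2 ^ r k)"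
          using dyadic_quotient_integral[OF T lip t] by simp
        have "(\<lambda>n. 2 * K * (T / 2 ^ n)) \<longlonglongrightarrow> 2 * K * 0"
          by (intro tendsto_mult tendsto_const) (simp add: LIMSEQ_divide_realpow_zero)
        then show "(\<lambda>k. 2 * K * (T / 2 ^ r k)) \<longlonglongrightarrow> 0"
          using LIMSEQ_subseq_LIMSEQ[OF _ r] by (fastforce simp: o_def)
      qed
      then have "(\<lambda>k. LINT x:{0..t}|lebesgue. ?q (r k) x) \<longlonglongrightarrow> y t - y 0" by (rule LIM_zero_cancel)
      then have "(\<lambda>k. ?w (LINT x:{0..t}|lebesgue. ?q (r k) x)) \<longlonglongrightarrow> ?w (y t - y 0)"
        by (intro blinfun.tendsto tendsto_const)
      moreover have "?w (LINT x:{0..t}|lebesgue. ?q (r k) x) = (LINT x:{0..t}|lebesgue. ?w (?q (r k) x))" for k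
        by (rule set_integrable_bounded_linear(2)[symmetric, OF blinfun.bounded_linear_right q_int])
      ultimately have "(\<lambda>k. LINT x:{0..t}|lebesgue. ?w (?q (r k) x)) \<longlonglongrightarrow> ?w (y t - y 0)" by simp
      then have "?w (y t - y 0) = (LINT x:{0..t}|lebesgue. ?w (g x))"
        using lim1 by (rule LIMSEQ_unique)
      also have "\<dots> = ?w (LINT x:{0..t}|lebesgue. g x)"
        by (rule set_integrable_bounded_linear(2)[OF blinfun.bounded_linear_right g_int])
      finally show ?thesis by (simp add: blinfun.diff_right)
    qed
    then have "norm ?x \<le> 0" by (intro norming_sequence_norm_le[OF W]) simp
    then show ?thesis by simp
  qed
  have inc: "norm (LINT r:{a..b}|lebesgue. g r) \<le> K * (b - a)" if "a \<le> b" for a b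
  proof -
    have "norm (LINT r:{a..b}|lebesgue. g r) \<le> (LINT r:{a..b}|lebesgue. norm (g r))"
      by (rule norm_set_integral_le)
    also have "\<dots> \<le> (LINT r:{a..b}|lebesgue. K)"
      by (intro set_integral_mono set_integrable_norm' g_int g_norm set_integrable_const_bounded) auto
    also have "\<dots> = K * (b - a)"
      using set_integral_const[of "{a..b}" lebesgue K] that by (simp add: mult.commute)
    finally show ?thesis .
  qed
  have prim_T: "y T - y 0 = (LINT r:{0..T}|lebesgue. g r)"
  proof -
    have "norm (y T - y 0 - (LINT r:{0..T}|lebesgue. g r)) \<le> 0 + e" if e: "0 < e" for e
    proof -
      \<comment> \<open>So close to \<open>T\<close> that the increment of \<open>y\<close> and the
        remaining integral are each at most \<open>e / 2\<close>.\<close>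
      define t where "t = max 0 (T - e / (2 * (K + 1)))"
      have t: "0 \<le> t" "t < T" "T - t \<le> e / (2 * (K + 1))" using T e K0 by (auto simp: t_def)
      have "norm (y T - y t) \<le> K * (T - t)"
        using lipschitz_onD[OF lip, of T t] t by (simp add: dist_norm)
      moreover have "norm (LINT r:{t..T}|lebesgue. g r) \<le> K * (T - t)" using inc t by simp
      moreover have "K * (T - t) \<le> e / 2"
      proof -
        have "K * (T - t) \<le> (K + 1) * (e / (2 * (K + 1)))" using t K0 by (intro mult_mono) auto
        also have "\<dots> = e / 2" using K0 by (simp add: field_simps)
        finally show ?thesis .
      qed
      moreover have dec: "y T - y 0 - (LINT r:{0..T}|lebesgue. g r) = (y T - y t) - (LINT r:{t..T}|lebesgue. g r)"
        using set_integral_combine[OF g_int, of 0 t T] prim_lt[OF t(1,2)] t by (simp add: algebra_simps)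
      ultimately show ?thesis
        using norm_triangle_ineq4[of "y T - y t" "LINT r:{t..T}|lebesgue. g r"] unfolding dec by linarith
    qed
    then have "norm (y T - y 0 - (LINT r:{0..T}|lebesgue. g r)) \<le> 0" by (rule field_le_epsilon)
    then show ?thesis by simp
  qed
  have prim: "y t - y 0 = (LINT r:{0..t}|lebesgue. g r)" if "0 \<le> t" "t \<le> T" for t
    using prim_lt[of t] prim_T that by (cases "t = T") auto
  have "has_deriv_ae T y g"
    unfolding has_deriv_ae_def
  proof (intro conjI allI impI)
    show "continuous_on {0..T} y" using lip by (rule lipschitz_on_continuous_on)
    fix a b assume "0 \<le> a" "a \<le> b" "b \<le> T"
    then show "y b - y a = (LINT r:{a..b}|lebesgue. g r)"
      using prim[of a] prim[of b] set_integral_combine[OF g_int, of 0 a b] by (simp add: algebra_simps)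
  qed (rule g_int)
  moreover have "AE t in lebesgue. t \<in> {0..<T} \<longrightarrow> weakly_tendsto (\<lambda>k. ?q (r k) t) (g t) sequentially"
    using AE_G by eventually_elim (use g in blast)
  ultimately show ?thesis using that r g_norm by blast
qed

section \<open>Weak derivatives\<close>

lemma set_integrable_Ioo_iff_Icc:
  fixes f :: "real \<Rightarrow> 'b::{banach, second_countable_topology}"
  shows "set_integrable lebesgue {a<..<b} f \<longleftrightarrow> set_integrable lebesgue {a..b} f"
proof
  assume f: "set_integrable lebesgue {a<..<b} f"
  have single: "set_integrable lebesgue {c} f" for c
    using set_integrable_const_bounded[of "{c}" "f c"] by (subst set_integrable_cong[OF refl refl, where f' = "\<lambda>_. f c"]) auto
  show "set_integrable lebesgue {a..b} f"
  proof (cases "a \<le> b")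
    case True
    then have eq: "{a..b} = ({a<..<b} \<union> {a}) \<union> {b}" by auto
    show ?thesis unfolding eq by (intro set_integrable_Un f single) auto
  qed (simp add: set_integrable_def)
qed (rule set_integrable_subset, auto)

lemma set_integral_Ioo_eq_Icc:
  fixes f :: "real \<Rightarrow> 'b::{banach, second_countable_topology}"
  assumes f: "set_integrable lebesgue {a..b} f"
  shows "(LINT r:{a<..<b}|lebesgue. f r) = (LINT r:{a..b}|lebesgue. f r)"
proof (rule set_integral_cong_set)
  show "set_borel_measurable lebesgue {a..b} f" "set_borel_measurable lebesgue {a<..<b} f"
    using f set_integrable_Ioo_iff_Icc[of a b f] by (auto simp: set_integrable_def set_borel_measurable_def)
  have "AE x in lebesgue. x \<noteq> c" for c :: real
    using AE_lborel_singleton[of c] by (rule AE_completion)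
  from this[of a] this[of b] show "AE x in lebesgue. x \<in> {a..b} \<longleftrightarrow> x \<in> {a<..<b}"
    by eventually_elim auto
qed

lemma integrable_Leb_iff:
  fixes f :: "real \<Rightarrow> 'b::{banach, second_countable_topology}"
  shows "integrable (Leb T) f \<longleftrightarrow> set_integrable lebesgue {0..T} f"
  unfolding set_integrable_Ioo_iff_Icc[symmetric]
  by (subst integrable_restrict_space) (auto simp: set_integrable_def)

lemma integral_Leb:
  fixes f :: "real \<Rightarrow> 'b::{banach, second_countable_topology}"
  assumes "set_integrable lebesgue {0..T} f"
  shows "integral\<^sup>L (Leb T) f = (LINT r:{0..T}|lebesgue. f r)"
  unfolding set_integral_Ioo_eq_Icc[OF assms, symmetric]
  by (subst integral_restrict_space) (auto simp: set_lebesgue_integral_def)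

lemma set_integrable_continuous:
  fixes f :: "real \<Rightarrow> 'b::{banach, second_countable_topology}"
  assumes "continuous_on {a..b} f"
  shows "set_integrable lebesgue {a..b} f"
proof -
  have "set_integrable lborel {a..b} f" using assms by (intro borel_integrable_atLeastAtMost') auto
  then show ?thesis
    unfolding set_integrable_def by (subst integrable_completion) auto
qed

lemma set_integral_FTC:
  fixes f :: "real \<Rightarrow> real"
  assumes "a \<le> b" "\<And>x. (f has_real_derivative f' x) (at x)" "continuous_on UNIV f'"
  shows "(LINT r:{a..b}|lebesgue. f' r) = f b - f a"
proof -
  have "(LBINT r. indicator {a..b} r *\<^sub>R f' r) = f b - f a"
  proof (rule integral_FTC_Icc)
    show "(f has_vector_derivative f' x) (at x within {a..b})" for x
      using assms(2)[of x] has_vector_derivative_at_within has_real_derivative_iff_has_vector_derivative by blast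
    show "continuous_on {a..b} f'" using assms(3) continuous_on_subset by blast
  qed (rule assms)
  moreover have "(\<lambda>r. indicat_real {a..b} r *\<^sub>R f' r) \<in> borel_measurable lborel"
    using borel_measurable_continuous_on_indicator[of "{a..b}" f'] assms(3) continuous_on_subset by auto
  ultimately show ?thesis
    unfolding set_lebesgue_integral_def by (simp add: integral_completion)
qed

lemma has_deriv_ae_C1:
  fixes f :: "real \<Rightarrow> real"
  assumes "\<And>x. (f has_real_derivative f' x) (at x)" "continuous_on UNIV f'"
  shows "has_deriv_ae T f f'"
  unfolding has_deriv_ae_def
proof (intro conjI allI impI)
  show "continuous_on {0..T} f" using assms(1) DERIV_isCont continuous_at_imp_continuous_on by blast
  show "set_integrable lebesgue {0..T} f'"
    using assms(2) by (intro set_integrable_continuous) (rule continuous_on_subset, auto)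
  fix s t :: real assume "s \<le> t"
  then show "f t - f s = (LINT r:{s..t}|lebesgue. f' r)"
    using set_integral_FTC[OF _ assms] by simp
qed

lemma test_functions_deriv:
  assumes "\<eta> \<in> test_functions T"
  shows "(\<eta> has_real_derivative deriv \<eta> x) (at x)" "continuous_on UNIV (deriv \<eta>)"
    "\<eta> 0 = 0" "\<eta> T = 0"
proof -
  obtain D where D: "\<And>x. (\<eta> has_vector_derivative D x) (at x)" "continuous_on UNIV D"
    using assms unfolding test_functions_def C1_differentiable_on_def by auto
  have D': "(\<eta> has_real_derivative D x) (at x)" for x
    using D(1) by (simp add: has_real_derivative_iff_has_vector_derivative)
  have eq: "deriv \<eta> = D" using D' DERIV_imp_deriv by blast
  show "(\<eta> has_real_derivative deriv \<eta> x) (at x)" "continuous_on UNIV (deriv \<eta>)"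
    using D' D(2) by (auto simp: eq)
  obtain C where "C \<subseteq> {0<..<T}" "\<And>t. t \<notin> C \<Longrightarrow> \<eta> t = 0"
    using assms unfolding test_functions_def by auto
  then show "\<eta> 0 = 0" "\<eta> T = 0" by force+
qed

lemma has_deriv_ae_imp_is_weak_deriv:
  assumes T: "0 < T" and u: "has_deriv_ae T u g"
  shows "is_weak_deriv T u g"
  unfolding is_weak_deriv_def Bochner_integral_eq
proof
  fix \<eta> assume \<eta>: "\<eta> \<in> test_functions T"
  have d\<eta>: "has_deriv_ae T \<eta> (deriv \<eta>)"
    using test_functions_deriv[OF \<eta>] by (intro has_deriv_ae_C1) auto
  have prod: "has_deriv_ae T (\<lambda>t. \<eta> t *\<^sub>R u t) (\<lambda>t. \<eta> t *\<^sub>R g t + deriv \<eta> t *\<^sub>R u t)"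
    by (rule has_deriv_ae_bilinear[OF bounded_bilinear_scaleR d\<eta> u])
  have 1: "set_integrable lebesgue {0..T} (\<lambda>t. \<eta> t *\<^sub>R g t)"
    by (rule set_integrable_bilinear[OF bounded_bilinear_scaleR has_deriv_aeD(1)[OF d\<eta>] has_deriv_aeD(2)[OF u]])
  have 2: "set_integrable lebesgue {0..T} (\<lambda>t. deriv \<eta> t *\<^sub>R u t)"
    by (rule set_integrable_bilinear[OF bounded_bilinear.flip[OF bounded_bilinear_scaleR] has_deriv_aeD(1)[OF u] has_deriv_aeD(2)[OF d\<eta>]])
  have "(LINT t:{0..T}|lebesgue. \<eta> t *\<^sub>R g t) + (LINT t:{0..T}|lebesgue. deriv \<eta> t *\<^sub>R u t) = 0"
    using has_deriv_aeD(4)[OF prod, of 0 T] T test_functions_deriv(3,4)[OF \<eta>] set_integral_add(2)[OF 1 2] by simp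
  then show "(\<integral>t. deriv \<eta> t *\<^sub>R u t \<partial>Leb T) = - (\<integral>t. \<eta> t *\<^sub>R g t \<partial>Leb T)"
    unfolding integral_Leb[OF 1] integral_Leb[OF 2] by (simp add: add_eq_0_iff)
qed

text \<open>A \<open>C\<^sup>1\<close> step from \<open>0\<close> to \<open>1\<close> on \<open>[0,1]\<close>: a quadratic spline.\<close>

definition sq_plus :: "real \<Rightarrow> real" where "sq_plus x = (max 0 x)\<^sup>2"

definition ramp :: "real \<Rightarrow> real" where
  "ramp x = 2 * sq_plus x - 4 * sq_plus (x - 1 / 2) + 2 * sq_plus (x - 1)"

definition ramp_deriv :: "real \<Rightarrow> real" where
  "ramp_deriv x = 4 * max 0 x - 8 * max 0 (x - 1 / 2) + 4 * max 0 (x - 1)"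

lemma sq_plus_deriv: "(sq_plus has_real_derivative 2 * max 0 x) (at x)"
proof -
  consider "x < 0" | "x = 0" | "x > 0" by linarith
  then show ?thesis
  proof cases
    case 1
    have "((\<lambda>x::real. 0) has_real_derivative 0) (at x)" by simp
    moreover have "eventually (\<lambda>y. sq_plus y = 0) (nhds x)"
      using eventually_nhds_in_open[of "{..<0}" x] 1 by (auto elim!: eventually_mono simp: sq_plus_def)
    ultimately show ?thesis using 1 by (simp add: DERIV_cong_ev)
  next
    case 3
    have "((\<lambda>x::real. x\<^sup>2) has_real_derivative 2 * x) (at x)" by (auto intro!: derivative_eq_intros)
    moreover have "eventually (\<lambda>y. sq_plus y = y\<^sup>2) (nhds x)"
      using eventually_nhds_in_open[of "{0<..}" x] 3 by (auto elim!: eventually_mono simp: sq_plus_def)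
    ultimately show ?thesis using 3 by (simp add: DERIV_cong_ev)
  next
    case 2
    have "((\<lambda>h. (sq_plus (0 + h) - sq_plus 0) / h) \<longlongrightarrow> 0) (at 0)"
    proof (rule Lim_null_comparison)
      show "((\<lambda>h::real. \<bar>h\<bar>) \<longlongrightarrow> 0) (at 0)" by (auto intro!: tendsto_eq_intros)
      show "\<forall>\<^sub>F h in at 0. norm ((sq_plus (0 + h) - sq_plus 0) / h) \<le> \<bar>h\<bar>"
        by (intro always_eventually allI) (auto simp: sq_plus_def max_def power2_eq_square)
    qed
    then show ?thesis using 2 by (simp add: DERIV_def)
  qed
qed

lemma ramp_has_deriv: "(ramp has_real_derivative ramp_deriv x) (at x)"
proof -
  have "((\<lambda>x. 2 * sq_plus x - 4 * sq_plus (x - 1 / 2) + 2 * sq_plus (x - 1)) has_real_derivative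
      2 * (2 * max 0 x) - 4 * (2 * max 0 (x - 1 / 2) * 1) + 2 * (2 * max 0 (x - 1) * 1)) (at x)"
    by (intro DERIV_add DERIV_diff DERIV_cmult DERIV_chain2[OF sq_plus_deriv] sq_plus_deriv)
      (auto intro!: derivative_eq_intros)
  then show ?thesis by (simp add: ramp_def[abs_def] ramp_deriv_def)
qed

lemma ramp_deriv_continuous: "continuous_on UNIV ramp_deriv"
  unfolding ramp_deriv_def by (intro continuous_intros)

lemma ramp_deriv_nonneg: "0 \<le> ramp_deriv x"
  by (auto simp: ramp_deriv_def max_def)

lemma ramp_eq_0: "x \<le> 0 \<Longrightarrow> ramp x = 0"
  by (simp add: ramp_def sq_plus_def)

lemma ramp_eq_1: "1 \<le> x \<Longrightarrow> ramp x = 1"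
  by (simp add: ramp_def sq_plus_def power2_eq_square algebra_simps)

lemma ramp_deriv_eq_0: "x \<le> 0 \<or> 1 \<le> x \<Longrightarrow> ramp_deriv x = 0"
  by (auto simp: ramp_deriv_def)

lemma ramp_bounds: "0 \<le> ramp x" "ramp x \<le> 1"
proof -
  have mono: "ramp a \<le> ramp b" if "a \<le> b" for a b
    by (rule DERIV_nonneg_imp_nondecreasing[OF that]) (use ramp_has_deriv ramp_deriv_nonneg in blast)
  show "0 \<le> ramp x" using mono[of "min 0 x" x] ramp_eq_0[of "min 0 x"] by simp
  show "ramp x \<le> 1" using mono[of x "max 1 x"] ramp_eq_1[of "max 1 x"] by simp
qed

lemma ramp_scaled_deriv:
  assumes "0 < e"
  shows "((\<lambda>x. ramp ((x - s) / e)) has_real_derivative ramp_deriv ((x - s) / e) / e) (at x)"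
proof -
  have "((\<lambda>x. (x - s) / e) has_real_derivative 1 / e) (at x)"
    using assms by (auto intro!: derivative_eq_intros)
  from DERIV_chain2[OF ramp_has_deriv this] show ?thesis by simp
qed

lemma ramp_scaled_continuous: "0 < e \<Longrightarrow> continuous_on UNIV (\<lambda>x. ramp_deriv ((x - s) / e) / e)"
proof -
  assume e: "0 < e"
  have "continuous_on UNIV (\<lambda>x. (x - s) / e)" using e by (intro continuous_intros) auto
  then have "continuous_on UNIV (\<lambda>x. ramp_deriv ((x - s) / e))"
    by (rule continuous_on_compose2[OF ramp_deriv_continuous]) simp
  then show ?thesis using e by (intro continuous_on_divide continuous_on_const) auto
qed

text \<open>The scaled \<open>ramp_deriv\<close> is a nonnegative kernel of mass one supported in
  \<open>{s..s + e}\<close>, a one-sided mollifier, so the integral is an average of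
  \<open>u\<close> over that interval.\<close>

lemma ramp_mollifies:
  fixes u :: "real \<Rightarrow> 'a::{banach, second_countable_topology}"
  assumes u: "continuous_on {0..T} u" and s: "0 < s" and e: "0 < e" "s + e < T"
    and osc: "\<And>x. x \<in> {s..s + e} \<Longrightarrow> norm (u x - u s) \<le> c"
  shows "norm ((LINT x:{0..T}|lebesgue. (ramp_deriv ((x - s) / e) / e) *\<^sub>R u x) - u s) \<le> c"
    and "set_integrable lebesgue {0..T} (\<lambda>x. (ramp_deriv ((x - s) / e) / e) *\<^sub>R u x)"
proof -
  let ?k = "\<lambda>x. ramp_deriv ((x - s) / e) / e"
  have kc: "continuous_on A ?k" for A
    using ramp_scaled_continuous[OF e(1), of s] continuous_on_subset by blast
  have k0: "?k x = 0" if "x \<notin> {s..s + e}" for x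
  proof -
    have "(x - s) / e \<le> 0 \<or> 1 \<le> (x - s) / e" using that e by (auto simp: field_simps)
    then show ?thesis by (simp add: ramp_deriv_eq_0)
  qed
  have kp: "0 \<le> ?k x" for x using ramp_deriv_nonneg e by simp
  have ki: "set_integrable lebesgue {0..T} ?k" by (intro set_integrable_continuous kc)
  have k1: "(LINT x:{0..T}|lebesgue. ?k x) = 1"
    using set_integral_FTC[of 0 T "\<lambda>x. ramp ((x - s) / e)" ?k, OF _ ramp_scaled_deriv[OF e(1)] kc] s e
      ramp_eq_0[of "- s / e"] ramp_eq_1[of "(T - s) / e"] by (simp add: field_simps)
  show i: "set_integrable lebesgue {0..T} (\<lambda>x. ?k x *\<^sub>R u x)"
    by (intro set_integrable_continuous continuous_on_scaleR kc u)
  have ks: "set_integrable lebesgue {0..T} (\<lambda>x. ?k x *\<^sub>R u s)"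
    by (intro set_integrable_continuous continuous_on_scaleR kc continuous_on_const)
  have "(LINT x:{0..T}|lebesgue. ?k x *\<^sub>R u s) = u s"
    using set_integrable_bounded_linear(2)[OF bounded_linear_scaleR_left ki, of "u s"] k1 by simp
  then have eq: "(LINT x:{0..T}|lebesgue. ?k x *\<^sub>R u x) - u s = (LINT x:{0..T}|lebesgue. ?k x *\<^sub>R u x - ?k x *\<^sub>R u s)"
    using set_integral_diff(2)[OF i ks] by simp
  have "norm (LINT x:{0..T}|lebesgue. ?k x *\<^sub>R u x - ?k x *\<^sub>R u s) \<le> (LINT x:{0..T}|lebesgue. norm (?k x *\<^sub>R u x - ?k x *\<^sub>R u s))"
    by (rule norm_set_integral_le)
  also have "\<dots> \<le> (LINT x:{0..T}|lebesgue. c * ?k x)"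
  proof (rule set_integral_mono)
    show "set_integrable lebesgue {0..T} (\<lambda>x. norm (?k x *\<^sub>R u x - ?k x *\<^sub>R u s))"
      by (rule set_integrable_norm'[OF set_integral_diff(1)[OF i ks]])
    show "set_integrable lebesgue {0..T} (\<lambda>x. c * ?k x)" by (intro set_integrable_mult_right impI ki)
    fix x
    show "norm (?k x *\<^sub>R u x - ?k x *\<^sub>R u s) \<le> c * ?k x"
    proof (cases "x \<in> {s..s + e}")
      case True
      have "norm (?k x *\<^sub>R u x - ?k x *\<^sub>R u s) = ?k x * norm (u x - u s)"
        unfolding scaleR_diff_right[symmetric] norm_scaleR abs_of_nonneg[OF kp] ..
      also have "\<dots> \<le> ?k x * c" by (intro mult_left_mono osc True kp)
      finally show ?thesis by (simp add: mult.commute)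
    qed (simp add: k0)
  qed
  also have "\<dots> = c" using k1 by simp
  finally show "norm ((LINT x:{0..T}|lebesgue. ?k x *\<^sub>R u x) - u s) \<le> c" unfolding eq .
qed

lemma ramp_mollifies_tendsto:
  fixes u :: "real \<Rightarrow> 'a::{banach, second_countable_topology}"
  assumes u: "continuous_on {0..T} u" and s: "0 < s" "s < T"
  shows "((\<lambda>e. LINT x:{0..T}|lebesgue. (ramp_deriv ((x - s) / e) / e) *\<^sub>R u x) \<longlongrightarrow> u s) (at_right 0)"
proof (rule tendstoI)
  fix c :: real assume c: "0 < c"
  obtain d where d: "0 < d" "\<And>x. x \<in> {0..T} \<Longrightarrow> dist x s < d \<Longrightarrow> dist (u x) (u s) < c / 2"
    using u s c unfolding continuous_on_iff by (metis atLeastAtMost_iff half_gt_zero less_imp_le)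
  have "eventually (\<lambda>e. e \<in> {0<..<min d (T - s)}) (at_right 0)"
    using d s by (intro eventually_at_right_real) auto
  then show "\<forall>\<^sub>F e in at_right 0. dist (LINT x:{0..T}|lebesgue. (ramp_deriv ((x - s) / e) / e) *\<^sub>R u x) (u s) < c"
  proof eventually_elim
    case (elim e)
    have "norm ((LINT x:{0..T}|lebesgue. (ramp_deriv ((x - s) / e) / e) *\<^sub>R u x) - u s) \<le> c / 2"
    proof (rule ramp_mollifies[OF u s(1)])
      fix x assume "x \<in> {s..s + e}"
      then have "dist (u x) (u s) < c / 2" using elim s by (intro d(2)) (auto simp: dist_real_def)
      then show "norm (u x - u s) \<le> c / 2" by (simp add: dist_norm)
    qed (use elim in auto)
    then show ?case using c by (simp add: dist_norm)
  qed
qed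

text \<open>The test function \<open>h e\<close> rises from \<open>0\<close> to \<open>1\<close>
  just after \<open>s\<close> and falls back just after \<open>t\<close>; its derivative is a
  mollifier at \<open>s\<close> minus one at \<open>t\<close>. As \<open>e\<close> tends to
  \<open>0\<close>, the defining identity of the weak derivative becomes
  \<open>u s - u t = - \<integral> g\<close> over \<open>{s<..t}\<close>. The strict bounds on
  \<open>s\<close> and \<open>t\<close> keep the support inside the open interval.\<close>

lemma weak_deriv_interior:
  fixes u :: "real \<Rightarrow> 'a::{banach, second_countable_topology}"
  assumes u: "continuous_on {0..T} u" and g: "set_integrable lebesgue {0..T} g"
    and w: "is_weak_deriv T u g" and st: "0 < s" "s < t" "t < T"
  shows "u t - u s = (LINT r:{s..t}|lebesgue. g r)"
proof -
  define h where "h = (\<lambda>e x. ramp ((x - s) / e) - ramp ((x - t) / e))"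
  define k where "k = (\<lambda>s e x. ramp_deriv ((x - s) / e) / e)"
  have dh: "(h e has_real_derivative k s e x - k t e x) (at x)" if "0 < e" for e x
    unfolding h_def k_def by (intro DERIV_diff ramp_scaled_deriv that)
  have deriv_h: "deriv (h e) x = k s e x - k t e x" if "0 < e" for e x
    using dh[OF that] by (rule DERIV_imp_deriv)
  have kc: "continuous_on A (k c e)" if "0 < e" for A c e
    using ramp_scaled_continuous[OF that, of c] continuous_on_subset unfolding k_def by blast
  have small: "eventually (\<lambda>e. e \<in> {0<..<T - t}) (at_right 0)"
    using st by (intro eventually_at_right_real) auto
  have eq: "(LINT x:{0..T}|lebesgue. k s e x *\<^sub>R u x) - (LINT x:{0..T}|lebesgue. k t e x *\<^sub>R u x)
      = - (LINT x:{0..T}|lebesgue. h e x *\<^sub>R g x)" if e: "e \<in> {0<..<T - t}" for e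
  proof -
    have e0: "0 < e" using e by simp
    have "h e \<in> test_functions T"
      unfolding test_functions_def
    proof (intro CollectI conjI exI[of _ "{s..t + e}"] allI impI)
      show "h e C1_differentiable_on UNIV"
        unfolding C1_differentiable_on_def
        using dh[OF e0] kc[OF e0] by (intro exI[of _ "\<lambda>x. k s e x - k t e x"])
          (auto simp: has_real_derivative_iff_has_vector_derivative intro!: continuous_intros)
      show "{s..t + e} \<subseteq> {0<..<T}" using st e by auto
      fix x assume x: "x \<notin> {s..t + e}"
      then consider "x < s" | "x > t + e" by force
      then show "h e x = 0"
      proof cases
        case 1
        then have "(x - s) / e \<le> 0" "(x - t) / e \<le> 0" using st e0 by (auto simp: field_simps)
        then show ?thesis by (simp add: h_def ramp_eq_0)
      next
        case 2
        then have "1 \<le> (x - s) / e" "1 \<le> (x - t) / e" using st e0 by (auto simp: field_simps)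
        then show ?thesis by (simp add: h_def ramp_eq_1)
      qed
    qed simp
    then have "(\<integral>x. deriv (h e) x *\<^sub>R u x \<partial>Leb T) = - (\<integral>x. h e x *\<^sub>R g x \<partial>Leb T)"
      using w unfolding is_weak_deriv_def Bochner_integral_eq by blast
    moreover have hg: "set_integrable lebesgue {0..T} (\<lambda>x. h e x *\<^sub>R g x)"
    proof (rule set_integrable_bilinear[OF bounded_bilinear_scaleR _ g])
      show "continuous_on {0..T} (h e)"
        using dh[OF e0] DERIV_isCont continuous_at_imp_continuous_on by blast
    qed
    moreover have ci: "set_integrable lebesgue {0..T} (\<lambda>x. k c e x *\<^sub>R u x)" for c
      by (intro set_integrable_continuous continuous_on_scaleR kc[OF e0] u)
    moreover have eq: "deriv (h e) x *\<^sub>R u x = k s e x *\<^sub>R u x - k t e x *\<^sub>R u x" for x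
      by (simp add: deriv_h[OF e0] scaleR_diff_left)
    moreover have "set_integrable lebesgue {0..T} (\<lambda>x. deriv (h e) x *\<^sub>R u x)"
      unfolding eq by (intro set_integral_diff ci)
    ultimately show ?thesis
      using set_integral_diff(2)[OF ci[of s] ci[of t]] by (simp add: integral_Leb)
  qed
  have lim1: "((\<lambda>e. (LINT x:{0..T}|lebesgue. k s e x *\<^sub>R u x) - (LINT x:{0..T}|lebesgue. k t e x *\<^sub>R u x)) \<longlongrightarrow> u s - u t) (at_right 0)"
    unfolding k_def using st by (intro tendsto_diff ramp_mollifies_tendsto u) auto
  \<comment> \<open>Dominated convergence is applied along a sequence; \<open>n + 2\<close> keeps
    every \<open>ee n\<close> strictly below \<open>T - t\<close>, so that \<open>h (ee n)\<close>
    is an admissible test function.\<close>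
  define ee where "ee = (\<lambda>n. (T - t) / real (n + 2))"
  have ee: "ee n \<in> {0<..<T - t}" for n
    using st by (simp add: ee_def divide_less_eq)
  have ee_lim: "filterlim ee (at_right 0) sequentially"
    unfolding filterlim_at
  proof
    show "\<forall>\<^sub>F n in sequentially. ee n \<in> {0<..} \<and> ee n \<noteq> 0" using ee by (auto intro!: always_eventually) (metis less_irrefl)
    show "ee \<longlonglongrightarrow> 0" unfolding ee_def by real_asymp
  qed
  have lim1': "(\<lambda>n. - (LINT x:{0..T}|lebesgue. h (ee n) x *\<^sub>R g x)) \<longlonglongrightarrow> u s - u t"
    using filterlim_compose[OF lim1 ee_lim] by (simp add: eq[OF ee])
  have lim2: "(\<lambda>n. LINT x:{0..T}|lebesgue. h (ee n) x *\<^sub>R g x) \<longlonglongrightarrow> (LINT x:{s<..t}|lebesgue. g x)"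
    unfolding set_lebesgue_integral_def
  proof (rule integral_dominated_convergence)
    let ?G = "\<lambda>x. indicat_real {0..T} x *\<^sub>R g x"
    show "integrable lebesgue (\<lambda>x. norm (?G x))"
      using g unfolding set_integrable_def by (rule integrable_norm)
    have "set_integrable lebesgue {s<..t} g"
      by (rule set_integrable_subset[OF g]) (use st in auto)
    then show "(\<lambda>x. indicat_real {s<..t} x *\<^sub>R g x) \<in> borel_measurable lebesgue"
      by (auto simp: set_integrable_def)
    have eqh: "indicat_real {0..T} x *\<^sub>R h (ee n) x *\<^sub>R g x = h (ee n) x *\<^sub>R ?G x" for n x by simp
    have "continuous_on UNIV (h (ee n))" for n
      using dh ee DERIV_isCont continuous_at_imp_continuous_on by (metis greaterThanLessThan_iff)
    then have "h (ee n) \<in> borel_measurable borel" for n by (rule borel_measurable_continuous_onI)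
    then have "h (ee n) \<in> borel_measurable lebesgue" for n by (intro measurable_completion) simp
    then show "(\<lambda>x. indicat_real {0..T} x *\<^sub>R h (ee n) x *\<^sub>R g x) \<in> borel_measurable lebesgue" for n
      unfolding eqh using g by (intro borel_measurable_scaleR[where g = ?G]) (auto simp: set_integrable_def)
    have "\<bar>h e x\<bar> \<le> 1" for e x
      using ramp_bounds[of "(x - s) / e"] ramp_bounds[of "(x - t) / e"] by (simp add: h_def)
    then show "AE x in lebesgue. norm (indicat_real {0..T} x *\<^sub>R h (ee n) x *\<^sub>R g x) \<le> norm (?G x)" for n
      by (intro AE_I2) (auto simp: indicator_def mult_left_le_one_le)
    have ramp_lim: "(\<lambda>n. ramp ((x - c) / ee n)) \<longlonglongrightarrow> (if x \<le> c then 0 else 1)" for x c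
    proof (cases "x \<le> c")
      case True
      then have "ramp ((x - c) / ee n) = 0" for n
        using ee[of n] by (intro ramp_eq_0) (auto simp: divide_nonpos_pos)
      then show ?thesis using True by simp
    next
      case False
      have "eventually (\<lambda>e. e \<in> {0<..<x - c}) (at_right 0)"
        using False by (intro eventually_at_right_real) auto
      then have "eventually (\<lambda>n. ee n \<in> {0<..<x - c}) sequentially"
        using ee_lim unfolding filterlim_iff by blast
      then have "eventually (\<lambda>n. ramp ((x - c) / ee n) = 1) sequentially"
        by eventually_elim (auto intro!: ramp_eq_1 simp: field_simps)
      then show ?thesis using False by (simp add: tendsto_eventually)
    qed
    show "AE x in lebesgue. (\<lambda>n. indicat_real {0..T} x *\<^sub>R h (ee n) x *\<^sub>R g x) \<longlonglongrightarrow> indicat_real {s<..t} x *\<^sub>R g x"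
    proof (rule AE_I2)
      fix x
      have "(\<lambda>n. h (ee n) x) \<longlonglongrightarrow> (if x \<le> s then 0 else 1) - (if x \<le> t then 0 else 1)"
        unfolding h_def by (intro tendsto_diff ramp_lim)
      then have "(\<lambda>n. h (ee n) x) \<longlonglongrightarrow> indicat_real {s<..t} x"
        using st by (auto simp: indicator_def split: if_splits)
      then have "(\<lambda>n. h (ee n) x *\<^sub>R ?G x) \<longlonglongrightarrow> indicat_real {s<..t} x *\<^sub>R ?G x"
        by (intro tendsto_scaleR tendsto_const)
      moreover have "indicat_real {s<..t} x *\<^sub>R ?G x = indicat_real {s<..t} x *\<^sub>R g x"
        using st by (auto simp: indicator_def)
      ultimately show "(\<lambda>n. indicat_real {0..T} x *\<^sub>R h (ee n) x *\<^sub>R g x) \<longlonglongrightarrow> indicat_real {s<..t} x *\<^sub>R g x"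
        by (simp only: eqh)
    qed
  qed
  have gst: "set_integrable lebesgue {s..t} g" "set_integrable lebesgue {s<..t} g"
    by (rule set_integrable_subset[OF g]; use st in auto)+
  have "u s - u t = - (LINT x:{s<..t}|lebesgue. g x)"
    by (rule LIMSEQ_unique[OF lim1' tendsto_minus[OF lim2]])
  moreover have "(LINT x:{s<..t}|lebesgue. g x) = (LINT x:{s..t}|lebesgue. g x)"
  proof (rule set_integral_cong_set)
    show "set_borel_measurable lebesgue {s..t} g" "set_borel_measurable lebesgue {s<..t} g"
      using gst by (auto simp: set_integrable_def set_borel_measurable_def)
    have "AE x in lebesgue. x \<noteq> s" using AE_lborel_singleton[of s] by (rule AE_completion)
    then show "AE x in lebesgue. x \<in> {s..t} \<longleftrightarrow> x \<in> {s<..t}" by eventually_elim auto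
  qed
  ultimately show ?thesis by (simp add: algebra_simps)
qed

text \<open>Test functions only reach the interior, so \<open>{s..t}\<close> is exhausted by
  slightly smaller intervals; continuity of \<open>u\<close> and of the integral carries the
  identity to the end points.\<close>

lemma is_weak_deriv_imp_has_deriv_ae:
  fixes u :: "real \<Rightarrow> 'a::{banach, second_countable_topology}"
  assumes u: "continuous_on {0..T} u" and g: "set_integrable lebesgue {0..T} g"
    and w: "is_weak_deriv T u g"
  shows "has_deriv_ae T u g"
  unfolding has_deriv_ae_def
proof (intro conjI allI impI u g)
  fix s t assume st: "0 \<le> s" "s \<le> t" "t \<le> T"
  have gst: "set_integrable lebesgue {s..t} g"
    by (rule set_integrable_subset[OF g]) (use st in auto)
  show "u t - u s = (LINT r:{s..t}|lebesgue. g r)"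
  proof (cases "s = t")
    case True
    then show ?thesis using gst set_integral_Icc_singleton by simp
  next
    case False
    then have lt: "s < t" using st by simp
    \<comment> \<open>With \<open>n + 3\<close> the interval from \<open>s + d n\<close> to
      \<open>t - d n\<close> keeps at least a third of the length and never degenerates.\<close>
    define d where "d = (\<lambda>n. (t - s) / real (n + 3))"
    have d: "0 < d n" "2 * d n < t - s" for n
    proof -
      have "d n \<le> (t - s) / 3" unfolding d_def using lt by (intro divide_left_mono) auto
      then show "2 * d n < t - s" using lt by simp
      show "0 < d n" using lt by (simp add: d_def)
    qed
    have d_dec: "d n \<le> d m" if "m \<le> n" for m n
      unfolding d_def using that lt by (intro divide_left_mono) auto
    have d_lim: "d \<longlonglongrightarrow> 0" unfolding d_def by real_asymp
    have eq: "u (t - d n) - u (s + d n) = (LINT r:{s + d n..t - d n}|lebesgue. g r)" for n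
      using d[of n] st by (intro weak_deriv_interior[OF u g w]) auto
    have U: "(\<Union>n. {s + d n..t - d n}) = {s<..<t}"
    proof (intro equalityI subsetI)
      fix x assume x: "x \<in> {s<..<t}"
      then have "eventually (\<lambda>n. d n < min (x - s) (t - x)) sequentially"
        using d_lim by (intro order_tendstoD(2)[of d 0]) auto
      then obtain n where "d n < min (x - s) (t - x)" by (metis eventually_happens' sequentially_bot)
      then have "x \<in> {s + d n..t - d n}" by auto
      then show "x \<in> (\<Union>n. {s + d n..t - d n})" by blast
    next
      fix x assume "x \<in> (\<Union>n. {s + d n..t - d n})"
      then obtain n where "s + d n \<le> x" "x \<le> t - d n" by auto
      then show "x \<in> {s<..<t}" using d(1)[of n] by simp
    qed
    have "(\<lambda>n. LINT r:{s + d n..t - d n}|lebesgue. g r) \<longlonglongrightarrow> (LINT r:(\<Union>n. {s + d n..t - d n})|lebesgue. g r)"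
    proof (rule set_integral_cont_up)
      show "incseq (\<lambda>n. {s + d n..t - d n})"
        using d_dec unfolding incseq_def by force
      show "set_integrable lebesgue (\<Union>n. {s + d n..t - d n}) g"
        unfolding U set_integrable_Ioo_iff_Icc by (rule gst)
    qed simp
    then have lim: "(\<lambda>n. LINT r:{s + d n..t - d n}|lebesgue. g r) \<longlonglongrightarrow> (LINT r:{s..t}|lebesgue. g r)"
      unfolding U set_integral_Ioo_eq_Icc[OF gst] .
    have mem: "t - d n \<in> {0..T}" "s + d n \<in> {0..T}" for n using d[of n] st by auto
    have "(\<lambda>n. t - d n) \<longlonglongrightarrow> t" using tendsto_diff[OF tendsto_const d_lim, of t] by simp
    then have "(\<lambda>n. u (t - d n)) \<longlonglongrightarrow> u t"
      by (rule continuous_on_tendsto_compose[OF u]) (use mem st in auto)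
    moreover have "(\<lambda>n. s + d n) \<longlonglongrightarrow> s" using tendsto_add[OF tendsto_const d_lim, of s] by simp
    then have "(\<lambda>n. u (s + d n)) \<longlonglongrightarrow> u s"
      by (rule continuous_on_tendsto_compose[OF u]) (use mem st in auto)
    ultimately have "(\<lambda>n. u (t - d n) - u (s + d n)) \<longlonglongrightarrow> u t - u s" by (rule tendsto_diff)
    then show ?thesis using lim unfolding eq by (rule LIMSEQ_unique)
  qed
qed

lemma W11_iff_has_deriv_ae:
  fixes u :: "real \<Rightarrow> 'a::{banach, second_countable_topology}"
  assumes "0 < T"
  shows "u \<in> W11 T \<longleftrightarrow> (\<exists>g. has_deriv_ae T u g)"
proof
  assume "u \<in> W11 T"
  then show "\<exists>g. has_deriv_ae T u g"
    unfolding W11_def Bochner_integrable_eq integrable_Leb_iff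
    by (auto intro: is_weak_deriv_imp_has_deriv_ae)
next
  assume "\<exists>g. has_deriv_ae T u g"
  then obtain g where g: "has_deriv_ae T u g" ..
  then show "u \<in> W11 T"
    unfolding W11_def Bochner_integrable_eq integrable_Leb_iff
    using has_deriv_ae_imp_is_weak_deriv[OF assms g] has_deriv_aeD(1,2)[OF g] by (intro CollectI conjI exI[of _ g])
qed

lemma has_deriv_ae_weak_deriv:
  fixes u :: "real \<Rightarrow> 'a::{banach, second_countable_topology}"
  assumes "u \<in> W11 T"
  shows "has_deriv_ae T u (weak_deriv T u)"
proof -
  have cont: "continuous_on {0..T} u"
    and ex: "\<exists>g. Bochner_integrable (Leb T) g \<and> is_weak_deriv T u g"
    using assms by (auto simp: W11_def)
  from someI_ex[OF ex] have "Bochner_integrable (Leb T) (weak_deriv T u) \<and> is_weak_deriv T u (weak_deriv T u)"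
    unfolding weak_deriv_def .
  then show ?thesis
    using is_weak_deriv_imp_has_deriv_ae[OF cont, of "weak_deriv T u"]
    unfolding Bochner_integrable_eq integrable_Leb_iff by blast
qed

lemma weak_deriv_AE_eq:
  fixes u :: "real \<Rightarrow> 'a::{banach, second_countable_topology}"
  assumes "0 < T" "has_deriv_ae T u g"
  shows "AE t in Leb T. weak_deriv T u t = g t"
proof -
  have "u \<in> W11 T" using assms(2) by (auto simp: W11_iff_has_deriv_ae[OF assms(1)])
  then have "has_deriv_ae T u (weak_deriv T u)" by (rule has_deriv_ae_weak_deriv)
  then show ?thesis using assms(2) by (rule has_deriv_ae_unique)
qed

lemma lipschitz_imp_W1inf:
  fixes u :: "real \<Rightarrow> 'a::{banach, second_countable_topology}"
  assumes refl: "reflexive_space TYPE('a)" and T: "0 < T" and lip: "K-lipschitz_on {0..T} u"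
  shows "u \<in> W1inf T" "u \<in> W11 T" "AE t in Leb T. norm (weak_deriv T u t) \<le> K"
proof -
  obtain g :: "real \<Rightarrow> 'a" and r where g: "has_deriv_ae T u g" "\<And>t. norm (g t) \<le> K"
    using lipschitz_imp_has_deriv_ae[OF refl T lip] by metis
  show "u \<in> W1inf T"
    unfolding W1inf_def Bochner_integrable_eq integrable_Leb_iff
    using has_deriv_aeD(1,2)[OF g(1)] has_deriv_ae_imp_is_weak_deriv[OF T g(1)] g(2)
    by (intro CollectI conjI exI[of _ g] exI[of _ K]) auto
  show "u \<in> W11 T" using g(1) W11_iff_has_deriv_ae[OF T] by blast
  show "AE t in Leb T. norm (weak_deriv T u t) \<le> K"
    using weak_deriv_AE_eq[OF T g(1)] by eventually_elim (simp add: g(2))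
qed

section \<open>Closed sublinear functions with values in the extended reals\<close>

definition closed_sublinear :: "('a::real_normed_vector \<Rightarrow> ereal) \<Rightarrow> bool" where
  "closed_sublinear f \<longleftrightarrow> proper_fun f \<and> convex_fun f \<and> lsc_fun f \<and> pos_homogeneous f"

text \<open>For a \<open>closed_sublinear\<close> function, which vanishes at \<open>0\<close>, this
  is membership in \<open>subdifferential f 0\<close>.\<close>

definition stable :: "('a::real_normed_vector \<Rightarrow> ereal) \<Rightarrow> 'a dual \<Rightarrow> bool" where
  "stable f w \<longleftrightarrow> (\<forall>v. ereal (blinfun_apply w v) \<le> f v)"

definition epi :: "('a \<Rightarrow> ereal) \<Rightarrow> ('a \<times> real) set" where
  "epi f = {(x, r). f x \<le> ereal r}"

context
  fixes f :: "'a::real_normed_vector \<Rightarrow> ereal"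
  assumes f: "closed_sublinear f"
begin

lemma closed_sublinear_not_MInf: "f x \<noteq> -\<infinity>"
  using f by (auto simp: closed_sublinear_def proper_fun_def)

lemma closed_sublinear_scale: "0 < c \<Longrightarrow> f (c *\<^sub>R x) = ereal c * f x"
  using f by (auto simp: closed_sublinear_def pos_homogeneous_def)

lemma lsc_eventually_greater:
  assumes "a < f x"
  shows "eventually (\<lambda>y. a < f y) (nhds x)"
proof -
  have "a < Liminf (at x) f"
    using assms f by (auto simp: closed_sublinear_def lsc_fun_def intro: less_le_trans)
  then have "eventually (\<lambda>y. a < f y) (at x)" by (rule less_LiminfD)
  then show ?thesis using assms unfolding eventually_at_filter by (auto elim!: eventually_mono)
qed

lemma open_greater_closed_sublinear: "open {x. a < f x}"
proof (rule Topological_Spaces.openI)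
  fix x assume "x \<in> {x. a < f x}"
  then obtain S where "open S" "x \<in> S" "\<forall>y\<in>S. a < f y"
    using lsc_eventually_greater[of a x] unfolding eventually_nhds by auto
  then show "\<exists>T. open T \<and> x \<in> T \<and> T \<subseteq> {x. a < f x}" by blast
qed

lemma closed_sublinear_measurable: "f \<in> borel_measurable borel"
  by (rule borel_measurableI_greater) (simp add: open_greater_closed_sublinear)

text \<open>Homogeneity is required for positive factors only, which alone would allow
  \<open>\<infinity>\<close> at the origin. Along \<open>v / (n + 1)\<close> the values stay
  bounded, so lower semicontinuity excludes it, and a finite value equal to its double is
  \<open>0\<close>.\<close>

lemma closed_sublinear_zero: "f 0 = 0"
proof -
  obtain v where v: "f v < \<infinity>"
    using f by (auto simp: closed_sublinear_def proper_fun_def eff_dom_def)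
  then obtain p where p: "f v = ereal p"
    using closed_sublinear_not_MInf[of v] by (cases "f v") auto
  have fin: "f 0 \<noteq> \<infinity>"
  proof
    assume "f 0 = \<infinity>"
    then have "eventually (\<lambda>y. ereal \<bar>p\<bar> < f y) (nhds 0)"
      by (intro lsc_eventually_greater) simp
    moreover have "(\<lambda>n. (1 / real (Suc n)) *\<^sub>R v) \<longlonglongrightarrow> 0"
      using tendsto_scaleR[OF LIMSEQ_inverse_real_of_nat tendsto_const[of v]] by (simp add: inverse_eq_divide)
    ultimately have "eventually (\<lambda>n. ereal \<bar>p\<bar> < f ((1 / real (Suc n)) *\<^sub>R v)) sequentially"
      unfolding filterlim_iff by blast
    from eventually_happens[OF this] obtain n where n: "ereal \<bar>p\<bar> < f ((1 / real (Suc n)) *\<^sub>R v)"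
      by auto
    have "f ((1 / real (Suc n)) *\<^sub>R v) = ereal (p / real (Suc n))"
      by (simp add: closed_sublinear_scale p)
    moreover have "p / real (Suc n) \<le> \<bar>p\<bar> / real (Suc n)"
      by (rule divide_right_mono) simp_all
    moreover have "\<bar>p\<bar> / real (Suc n) \<le> \<bar>p\<bar>"
      using divide_left_mono[of 1 "real (Suc n)" "\<bar>p\<bar>"] by simp
    ultimately show False using n by simp
  qed
  then obtain r where r: "f 0 = ereal r" using closed_sublinear_not_MInf[of 0] by (cases "f 0") auto
  have "f (2 *\<^sub>R 0) = ereal 2 * f 0" by (rule closed_sublinear_scale) simp
  then show ?thesis using r by (simp add: zero_ereal_def)
qed

lemma convex_epi: "convex (epi f)"
  unfolding convex_alt
proof (intro ballI allI impI)
  fix z z' and c :: real assume z: "z \<in> epi f" "z' \<in> epi f" and c: "0 \<le> c \<and> c \<le> 1"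
  obtain x r y s where eq: "z = (x, r)" "z' = (y, s)" by (metis surj_pair)
  have le: "f x \<le> ereal r" "f y \<le> ereal s" using z by (auto simp: eq epi_def)
  consider "c = 0" | "c = 1" | "0 < c" "c < 1" using c by linarith
  then show "(1 - c) *\<^sub>R z + c *\<^sub>R z' \<in> epi f"
  proof cases
    case 3
    have "f ((1 - c) *\<^sub>R x + c *\<^sub>R y) \<le> ereal (1 - c) * f x + ereal c * f y"
      using f 3 by (auto simp: closed_sublinear_def convex_fun_def)
    also have "\<dots> \<le> ereal (1 - c) * ereal r + ereal c * ereal s"
      using 3 le by (intro add_mono ereal_mult_left_mono) auto
    finally show ?thesis by (simp add: eq epi_def)
  qed (use z in auto)
qed

lemma closed_epi: "closed (epi f)"
  unfolding closed_def
proof (rule Topological_Spaces.openI)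
  fix z assume "z \<in> - epi f"
  moreover obtain x r where z: "z = (x, r)" by (metis surj_pair)
  ultimately have "ereal r < f x" by (auto simp: epi_def)
  then obtain a where a: "ereal r < ereal a" "ereal a < f x"
    using ereal_dense2 by blast
  have "open ({x. ereal a < f x} \<times> {..<a})"
    by (intro open_Times open_greater_closed_sublinear) simp
  moreover have "z \<in> {x. ereal a < f x} \<times> {..<a}" using a z by simp
  moreover have "{x. ereal a < f x} \<times> {..<a} \<subseteq> - epi f"
    by (auto simp: epi_def) (meson ereal_less_eq(3) leD less_imp_le order_trans)
  ultimately show "\<exists>T. open T \<and> z \<in> T \<and> T \<subseteq> - epi f" by blast
qed

text \<open>The epigraph is a closed convex cone, and a functional bounded above on a cone is
  nonpositive there. Working in the product admits vertical hyperplanes, as needed at points outside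
  the effective domain.\<close>

lemma epi_separation:
  assumes "\<not> f x \<le> ereal c"
  obtains W :: "('a \<times> real) dual" where
    "\<And>y r. f y \<le> ereal r \<Longrightarrow> blinfun_apply W (y, r) \<le> 0" "0 < blinfun_apply W (x, c)"
proof -
  have zero: "(0, 0) \<in> epi f" by (simp add: epi_def closed_sublinear_zero)
  then obtain W :: "('a \<times> real) dual" and d where d: "0 < d"
    and W: "\<And>z. z \<in> epi f \<Longrightarrow> blinfun_apply W z + d \<le> blinfun_apply W (x, c)"
    using separation_closed_convex_point[OF convex_epi closed_epi, of "(x, c)"] assms by (auto simp: epi_def)
  have "blinfun_apply W (y, r) \<le> 0" if "f y \<le> ereal r" for y r
  proof (rule ccontr)
    assume pos: "\<not> blinfun_apply W (y, r) \<le> 0"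
    \<comment> \<open>Scaling by \<open>k\<close> lifts the value at \<open>(y, r)\<close> above the
      value at \<open>(x, c)\<close>.\<close>
    define k where "k = \<bar>blinfun_apply W (x, c)\<bar> / blinfun_apply W (y, r) + 1"
    have k: "0 < k" using pos by (simp add: k_def add_nonneg_pos)
    have "ereal k * f y \<le> ereal k * ereal r" using that k by (intro ereal_mult_left_mono) auto
    then have "k *\<^sub>R (y, r) \<in> epi f" using k by (simp add: epi_def closed_sublinear_scale)
    then have "k * blinfun_apply W (y, r) + d \<le> blinfun_apply W (x, c)"
      using W by (metis blinfun.scaleR_right real_scaleR_def)
    moreover have "k * blinfun_apply W (y, r) = \<bar>blinfun_apply W (x, c)\<bar> + blinfun_apply W (y, r)"
      using pos by (simp add: k_def algebra_simps)
    ultimately show False using d pos by linarith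
  qed
  moreover have "0 < blinfun_apply W (x, c)"
    using W[OF zero] d blinfun.zero_right[of W] by (simp add: zero_prod_def)
  ultimately show ?thesis by (rule that)
qed

text \<open>A functional as in \<open>epi_separation\<close> would be nonpositive along
  \<open>(u n, c n)\<close> and positive at the limit, although its values along the sequence
  converge to the value there.\<close>

lemma closed_sublinear_weakly_lsc:
  assumes u: "weakly_tendsto u x F" and c: "(c \<longlongrightarrow> c0) F" and F: "F \<noteq> bot"
    and le: "eventually (\<lambda>n. f (u n) \<le> ereal (c n)) F"
  shows "f x \<le> ereal c0"
proof (rule ccontr)
  assume "\<not> ?thesis"
  then obtain W :: "('a \<times> real) dual" where W:
    "\<And>y r. f y \<le> ereal r \<Longrightarrow> blinfun_apply W (y, r) \<le> 0" "0 < blinfun_apply W (x, c0)"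
    by (rule epi_separation) blast
  have W_split: "blinfun_apply W (y, r) = blinfun_apply W (y, 0) + r * blinfun_apply W (0, 1)" for y r
    using blinfun.add_right[of W "(y, 0)" "(0, r)"] blinfun.scaleR_right[of W r "(0, 1)"] by simp
  have bl: "bounded_linear (\<lambda>y. blinfun_apply W (y, 0))"
    by (rule bounded_linear_compose[OF blinfun.bounded_linear_right])
      (intro bounded_linear_Pair bounded_linear_ident bounded_linear_zero)
  have "((\<lambda>n. blinfun_apply (Blinfun (\<lambda>y. blinfun_apply W (y, 0))) (u n)) \<longlongrightarrow> blinfun_apply (Blinfun (\<lambda>y. blinfun_apply W (y, 0))) x) F"
    using u unfolding weakly_tendsto_def by blast
  then have "((\<lambda>n. blinfun_apply W (u n, 0)) \<longlongrightarrow> blinfun_apply W (x, 0)) F"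
    by (simp add: bounded_linear_Blinfun_apply[OF bl])
  then have "((\<lambda>n. blinfun_apply W (u n, 0) + c n * blinfun_apply W (0, 1))
      \<longlongrightarrow> blinfun_apply W (x, 0) + c0 * blinfun_apply W (0, 1)) F"
    by (intro tendsto_add tendsto_mult c tendsto_const)
  then have "((\<lambda>n. blinfun_apply W (u n, c n)) \<longlongrightarrow> blinfun_apply W (x, c0)) F"
    unfolding W_split[symmetric] .
  moreover have "eventually (\<lambda>n. blinfun_apply W (u n, c n) \<le> 0) F"
    using le by eventually_elim (rule W(1))
  ultimately have "blinfun_apply W (x, c0) \<le> 0" using F by (intro tendsto_upperbound)
  then show False using W(2) by simp
qed

lemma stable_conjugate:
  assumes "stable f w"
  shows "conjugate f w = 0"
proof (rule antisym)
  show "conjugate f w \<le> 0"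
    unfolding conjugate_def
  proof (rule SUP_least)
    fix v
    have "ereal (blinfun_apply w v) \<le> f v" using assms by (simp add: stable_def)
    then show "ereal (blinfun_apply w v) - f v \<le> 0"
      by (cases "f v") auto
  qed
  show "0 \<le> conjugate f w"
    unfolding conjugate_def by (rule SUP_upper2[of 0]) (simp_all add: closed_sublinear_zero blinfun.zero_right)
qed

lemma conjugate_nonneg: "0 \<le> conjugate f w"
  unfolding conjugate_def by (rule SUP_upper2[of 0]) (simp_all add: closed_sublinear_zero blinfun.zero_right)

lemma conjugate_finite_imp_stable:
  assumes fin: "conjugate f w < \<infinity>"
  shows "stable f w"
  unfolding stable_def
proof (rule allI, rule ccontr)
  fix v assume neg: "\<not> ereal (blinfun_apply w v) \<le> f v"
  then obtain p where p: "f v = ereal p" "p < blinfun_apply w v"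
    using closed_sublinear_not_MInf[of v] by (cases "f v") auto
  obtain q where q: "conjugate f w = ereal q" using fin conjugate_nonneg[of w] by (cases "conjugate f w") auto
  \<comment> \<open>Chosen so that the scaled test vector gives the value \<open>|q| + 1\<close>,
    more than the supremum \<open>q\<close>.\<close>
  define k where "k = (\<bar>q\<bar> + 1) / (blinfun_apply w v - p)"
  have k: "0 < k" using p by (simp add: k_def)
  have "ereal (blinfun_apply w (k *\<^sub>R v)) - f (k *\<^sub>R v) \<le> conjugate f w"
    unfolding conjugate_def by (rule SUP_upper) simp
  then have "k * (blinfun_apply w v - p) \<le> q"
    using k p(1) q by (simp add: closed_sublinear_scale blinfun.scaleR_right algebra_simps)
  then show False using p by (simp add: k_def)
qed

lemma Fenchel_nonneg: "0 \<le> f v + conjugate f w - ereal (blinfun_apply w v)"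
proof (cases "conjugate f w < \<infinity>")
  case True
  then have s: "stable f w" by (rule conjugate_finite_imp_stable)
  then have "ereal (blinfun_apply w v) \<le> f v" by (simp add: stable_def)
  then show ?thesis using stable_conjugate[OF s] closed_sublinear_not_MInf[of v] by (cases "f v") auto
next
  case False
  then show ?thesis using closed_sublinear_not_MInf[of v] by (cases "f v") auto
qed

lemma Fenchel_eq_0_iff:
  "f v + conjugate f w - ereal (blinfun_apply w v) = 0 \<longleftrightarrow> stable f w \<and> f v = ereal (blinfun_apply w v)"
proof (cases "conjugate f w < \<infinity>")
  case True
  then have s: "stable f w" by (rule conjugate_finite_imp_stable)
  then show ?thesis using stable_conjugate[OF s] closed_sublinear_not_MInf[of v] by (cases "f v") auto
next
  case False
  moreover from this have "\<not> stable f w" using stable_conjugate by auto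
  ultimately show ?thesis using closed_sublinear_not_MInf[of v] by (cases "f v") auto
qed

end

text \<open>A separating functional of the epigraph is linear and so commutes with the integral. The
  majorant \<open>p\<close> takes the place of \<open>f (g r)\<close>, so that no extended-real
  integral occurs.\<close>

lemma Jensen_closed_sublinear:
  fixes f :: "'a::{banach, second_countable_topology} \<Rightarrow> ereal" and g :: "'s \<Rightarrow> 'a"
  assumes f: "closed_sublinear f" and g: "set_integrable M S g" and p: "set_integrable M S p"
    and le: "AE r\<in>S in M. f (g r) \<le> ereal (p r)"
  shows "f (LINT r:S|M. g r) \<le> ereal (LINT r:S|M. p r)"
proof (rule ccontr)
  assume "\<not> ?thesis"
  then obtain W :: "('a \<times> real) dual" where W:
    "\<And>y r. f y \<le> ereal r \<Longrightarrow> blinfun_apply W (y, r) \<le> 0"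
    "0 < blinfun_apply W ((LINT r:S|M. g r), (LINT r:S|M. p r))"
    by (rule epi_separation[OF f]) blast
  let ?W1 = "\<lambda>y. blinfun_apply W (y, 0)" and ?W2 = "\<lambda>r. blinfun_apply W (0, r)"
  have bl1: "bounded_linear ?W1" and bl2: "bounded_linear ?W2"
    by (rule bounded_linear_compose[OF blinfun.bounded_linear_right],
        intro bounded_linear_Pair bounded_linear_ident bounded_linear_zero)+
  have split: "blinfun_apply W (y, r) = ?W1 y + ?W2 r" for y r
    using blinfun.add_right[of W "(y, 0)" "(0, r)"] by simp
  have pt: "?W1 y + ?W2 r \<le> 0" if "f y \<le> ereal r" for y r
    using W(1)[OF that] split[of y r] by linarith
  have i1: "set_integrable M S (\<lambda>r. ?W1 (g r))" and i2: "set_integrable M S (\<lambda>r. ?W2 (p r))"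
    by (rule set_integrable_bounded_linear(1)[OF bl1 g], rule set_integrable_bounded_linear(1)[OF bl2 p])
  have "blinfun_apply W ((LINT r:S|M. g r), (LINT r:S|M. p r)) = (LINT r:S|M. ?W1 (g r) + ?W2 (p r))"
    using split[of "LINT r:S|M. g r" "LINT r:S|M. p r"] set_integral_add(2)[OF i1 i2]
      set_integrable_bounded_linear(2)[OF bl1 g] set_integrable_bounded_linear(2)[OF bl2 p] by linarith
  moreover have "(LINT r:S|M. ?W1 (g r) + ?W2 (p r)) \<le> (LINT r:S|M. 0)"
  proof (rule set_integral_mono_AE)
    show "set_integrable M S (\<lambda>r. ?W1 (g r) + ?W2 (p r))" by (rule set_integral_add(1)[OF i1 i2])
    show "set_integrable M S (\<lambda>r. 0 :: real)" by (simp add: set_integrable_def)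
    show "AE r\<in>S in M. ?W1 (g r) + ?W2 (p r) \<le> 0"
      using le by eventually_elim (blast intro: pt)
  qed
  ultimately show False using W(2) by simp
qed

section \<open>Vanishing of the Fenchel functional\<close>

text \<open>The supremum runs over an uncountable set, but each competitor is continuous in
  \<open>t\<close> or identically \<open>-\<infinity>\<close>, so the superlevel sets are unions of
  open sets.\<close>

lemma conjugate_measurable:
  assumes f: "closed_sublinear f" and w: "continuous_on {0<..<T} w"
  shows "(\<lambda>t. conjugate f (w t)) \<in> borel_measurable (Leb T)"
proof (rule borel_measurableI_greater)
  fix a :: ereal
  have op: "open {t \<in> {0<..<T}. a < ereal (blinfun_apply (w t) v) - f v}" for v
  proof (cases "f v")
    case (real p)
    have "continuous_on {0<..<T} (\<lambda>t. ereal (blinfun_apply (w t) v - p))"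
      using w by (intro continuous_intros)
    then have "open ({0<..<T} \<inter> (\<lambda>t. ereal (blinfun_apply (w t) v - p)) -` {a<..})"
      by (rule continuous_open_preimage) auto
    moreover have "{t \<in> {0<..<T}. a < ereal (blinfun_apply (w t) v) - f v}
        = {0<..<T} \<inter> (\<lambda>t. ereal (blinfun_apply (w t) v - p)) -` {a<..}" using real by auto
    ultimately show ?thesis by simp
  next
    case PInf
    then show ?thesis by simp
  next
    case MInf
    then show ?thesis using closed_sublinear_not_MInf[OF f, of v] by simp
  qed
  have "{t \<in> space (Leb T). a < conjugate f (w t)} = (\<Union>v. {t \<in> {0<..<T}. a < ereal (blinfun_apply (w t) v) - f v})"
    by (auto simp: conjugate_def less_SUP_iff space_restrict_space)
  also have "open \<dots>" using op by blast
  finally have "open {t \<in> space (Leb T). a < conjugate f (w t)}" .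
  then have "{t \<in> space (Leb T). a < conjugate f (w t)} \<in> sets lebesgue" by (intro sets_completionI_sets) simp
  then show "{t \<in> space (Leb T). a < conjugate f (w t)} \<in> sets (Leb T)"
    by (subst sets_restrict_space_iff) (auto simp: space_restrict_space)
qed

lemma ereal_integral_nonneg_eq:
  assumes "\<And>t. 0 \<le> F t"
  shows "ereal_integral M F = enn2ereal (\<integral>\<^sup>+t. e2ennreal (F t) \<partial>M)"
proof -
  have "e2ennreal (- F t) = 0" for t
    using assms[of t] by (intro e2ennreal_neg) (metis ereal_uminus_le_0_iff)
  then show ?thesis by (simp add: ereal_integral_def zero_ennreal.rep_eq)
qed

lemma Fenchel_integral_nonneg:
  assumes f: "closed_sublinear f"
  shows "0 \<le> Fenchel_integral T f A l y"
  unfolding Fenchel_integral_def by (subst ereal_integral_nonneg_eq) (rule Fenchel_nonneg[OF f], simp)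

lemma Fenchel_integral_eq_0_imp:
  fixes f :: "'a::{banach, second_countable_topology} \<Rightarrow> ereal"
  assumes f: "closed_sublinear f" and l: "continuous_on {0..T} l" and y: "y \<in> W11 T"
    and zero: "Fenchel_integral T f A l y = 0"
  shows "AE t in Leb T. stable f (l t - blinfun_apply A (y t)) \<and>
    f (weak_deriv T y t) = ereal (blinfun_apply (l t - blinfun_apply A (y t)) (weak_deriv T y t))"
proof -
  define w where "w = (\<lambda>t. l t - blinfun_apply A (y t))"
  define F where "F = (\<lambda>t. f (weak_deriv T y t) + conjugate f (w t) - ereal (blinfun_apply (w t) (weak_deriv T y t)))"
  have d: "has_deriv_ae T y (weak_deriv T y)" by (rule has_deriv_ae_weak_deriv[OF y])
  have "continuous_on {0..T} w"
    unfolding w_def using l has_deriv_aeD(1)[OF d] by (intro continuous_intros)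
  then have wc: "continuous_on {0<..<T} w" by (rule continuous_on_subset) auto
  have d_meas: "weak_deriv T y \<in> borel_measurable (Leb T)"
    using has_deriv_aeD(2)[OF d] unfolding integrable_Leb_iff[symmetric] by (rule borel_measurable_integrable)
  have w_meas: "w \<in> borel_measurable (Leb T)"
  proof -
    have "(\<lambda>t. indicat_real {0<..<T} t *\<^sub>R w t) \<in> borel_measurable lebesgue"
      using borel_measurable_continuous_on_indicator[OF _ wc] by (intro measurable_completion) simp
    then show ?thesis by (subst borel_measurable_restrict_space_iff) auto
  qed
  have F_meas: "F \<in> borel_measurable (Leb T)"
    unfolding F_def
    by (intro borel_measurable_ereal_diff borel_measurable_ereal_add borel_measurable_ereal conjugate_measurable[OF f wc]
        measurable_compose[OF d_meas closed_sublinear_measurable[OF f]]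
        borel_measurable_bilinear[OF bounded_bilinear_blinfun_apply w_meas d_meas])
  have nn: "0 \<le> F t" for t unfolding F_def by (rule Fenchel_nonneg[OF f])
  have "Fenchel_integral T f A l y = enn2ereal (\<integral>\<^sup>+t. e2ennreal (F t) \<partial>Leb T)"
    using ereal_integral_nonneg_eq[of F "Leb T", OF nn] unfolding Fenchel_integral_def F_def w_def .
  then have "(\<integral>\<^sup>+t. e2ennreal (F t) \<partial>Leb T) = 0"
    using zero by (metis enn2ereal_inject zero_ennreal.rep_eq)
  then have "AE t in Leb T. e2ennreal (F t) = 0"
    using F_meas by (subst (asm) nn_integral_0_iff_AE) auto
  then have "AE t in Leb T. F t = 0"
  proof eventually_elim
    case (elim t)
    then have "enn2ereal (e2ennreal (F t)) = 0" by (simp add: zero_ennreal.rep_eq)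
    then show ?case using enn2ereal_e2ennreal[OF nn] by simp
  qed
  then show ?thesis
    unfolding F_def Fenchel_eq_0_iff[OF f] w_def .
qed

lemma Fenchel_integral_eq_0I:
  assumes f: "closed_sublinear f"
    and ae: "AE t in Leb T. stable f (l t - blinfun_apply A (y t)) \<and>
      f (weak_deriv T y t) = ereal (blinfun_apply (l t - blinfun_apply A (y t)) (weak_deriv T y t))"
  shows "Fenchel_integral T f A l y = 0"
proof -
  define F where "F = (\<lambda>t. f (weak_deriv T y t) + conjugate f (l t - blinfun_apply A (y t))
    - ereal (blinfun_apply (l t - blinfun_apply A (y t)) (weak_deriv T y t)))"
  have "AE t in Leb T. F t = 0"
    using ae unfolding F_def Fenchel_eq_0_iff[OF f] .
  then have "AE t in Leb T. e2ennreal (F t) = 0 \<and> e2ennreal (- F t) = 0"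
    by eventually_elim (simp add: e2ennreal_neg)
  then have "(\<integral>\<^sup>+t. e2ennreal (F t) \<partial>Leb T) = (\<integral>\<^sup>+t. 0 \<partial>Leb T)" "(\<integral>\<^sup>+t. e2ennreal (- F t) \<partial>Leb T) = (\<integral>\<^sup>+t. 0 \<partial>Leb T)"
    by (intro nn_integral_cong_AE; eventually_elim, simp)+
  then show ?thesis 
    unfolding Fenchel_integral_def ereal_integral_def F_def by simp
qed

text \<open>An open null set is empty, which gives the inequality in the interior; continuity
  extends it to the end points. This promotes stability from almost every time to every
  time.\<close>

lemma continuous_AE_le_imp_le:
  fixes p :: "real \<Rightarrow> real"
  assumes T: "0 < T" and p: "continuous_on {0..T} p" and ae: "AE t in Leb T. p t \<le> c" and t: "t \<in> {0..T}"
  shows "p t \<le> c"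
proof -
  define N where "N = {0<..<T} \<inter> p -` {c<..}"
  have "continuous_on {0<..<T} p" using p by (rule continuous_on_subset) auto
  then have "open N" unfolding N_def by (rule continuous_open_preimage) auto
  moreover have "negligible N"
  proof -
    have "AE t in lebesgue. t \<notin> N"
      using ae unfolding AE_lebesgue_on_Ioo_iff by eventually_elim (auto simp: N_def)
    moreover have "N \<in> sets lebesgue" using \<open>open N\<close> by simp
    ultimately show ?thesis
      by (simp add: negligible_iff_null_sets AE_iff_null_sets)
  qed
  ultimately have "N = {}" using open_not_negligible by blast
  then have "p x \<le> c" if "x \<in> {0<..<T}" for x using that by (force simp: N_def)
  moreover have cl: "closure {0<..<T} = {0..T}" using T by simp
  ultimately show ?thesis using t p by (intro continuous_le_on_closure[of "{0<..<T}" p t c]) auto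
qed

text \<open>For homogeneous \<open>f\<close> the inclusion of the force \<open>l - A u\<close> in
  the subdifferential of \<open>f\<close> at the velocity splits into stability and the power
  identity. Stability is demanded at every time because it is tested at a fixed time with velocities
  from other times.\<close>

definition evolution :: "real \<Rightarrow> ('a::{banach, second_countable_topology} \<Rightarrow> ereal) \<Rightarrow>
    ('a \<Rightarrow>\<^sub>L 'a dual) \<Rightarrow> (real \<Rightarrow> 'a dual) \<Rightarrow> (real \<Rightarrow> 'a) \<Rightarrow> (real \<Rightarrow> 'a) \<Rightarrow> bool" where
  "evolution T f A l u g \<longleftrightarrow> has_deriv_ae T u g \<and> (\<forall>t\<in>{0..T}. stable f (l t - blinfun_apply A (u t))) \<and>
     (AE t in Leb T. f (g t) = ereal (blinfun_apply (l t - blinfun_apply A (u t)) (g t)))"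

lemma Fenchel_integral_eq_0_imp_evolution:
  fixes f :: "'a::{banach, second_countable_topology} \<Rightarrow> ereal"
  assumes T: "0 < T" and f: "closed_sublinear f" and l: "continuous_on {0..T} l" and y: "y \<in> W11 T"
    and zero: "Fenchel_integral T f A l y = 0"
  shows "evolution T f A l y (weak_deriv T y)"
  unfolding evolution_def
proof (intro conjI ballI)
  note ae = Fenchel_integral_eq_0_imp[OF f l y zero]
  show d: "has_deriv_ae T y (weak_deriv T y)" by (rule has_deriv_ae_weak_deriv[OF y])
  show "AE t in Leb T. f (weak_deriv T y t) = ereal (blinfun_apply (l t - blinfun_apply A (y t)) (weak_deriv T y t))"
    using ae by eventually_elim simp
  fix t assume t: "t \<in> {0..T}"
  show "stable f (l t - blinfun_apply A (y t))"
    unfolding stable_def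
  proof
    fix v
    show "ereal (blinfun_apply (l t - blinfun_apply A (y t)) v) \<le> f v"
    proof (cases "f v")
      case (real p)
      have "blinfun_apply (l t - blinfun_apply A (y t)) v \<le> p"
      proof (rule continuous_AE_le_imp_le[OF T _ _ t])
        show "continuous_on {0..T} (\<lambda>t. blinfun_apply (l t - blinfun_apply A (y t)) v)"
          using l has_deriv_aeD(1)[OF d] by (intro continuous_intros)
        show "AE t in Leb T. blinfun_apply (l t - blinfun_apply A (y t)) v \<le> p"
          using ae
        proof eventually_elim
          case (elim t)
          then have "ereal (blinfun_apply (l t - blinfun_apply A (y t)) v) \<le> f v"
            unfolding stable_def by blast
          then show ?case using real by simp
        qed
      qed
      then show ?thesis using real by simp
    next
      case MInf
      then show ?thesis using closed_sublinear_not_MInf[OF f, of v] by simp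
    qed simp
  qed
qed

section \<open>A priori estimate and uniqueness\<close>

lemma AE_Leb_imp_AE_Icc:
  assumes "AE t in Leb T. P t"
  shows "AE t\<in>{0..T} in lebesgue. P t"
proof -
  have "AE x in lebesgue. x \<noteq> c" for c :: real
    using AE_lborel_singleton[of c] by (rule AE_completion)
  from this[of 0] this[of T] assms[unfolded AE_lebesgue_on_Ioo_iff] show ?thesis
    by eventually_elim auto
qed

lemma has_deriv_ae_phi:
  fixes A :: "'a::{banach, second_countable_topology} \<Rightarrow>\<^sub>L 'a dual"
  assumes sym: "\<And>x y. blinfun_apply (blinfun_apply A x) y = blinfun_apply (blinfun_apply A y) x"
    and u: "has_deriv_ae T u g"
  shows "has_deriv_ae T (\<lambda>t. phi A (u t - c)) (\<lambda>t. blinfun_apply (blinfun_apply A (u t - c)) (g t))"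
proof -
  have B: "bounded_bilinear (\<lambda>x y. blinfun_apply (blinfun_apply A x) y)"
    by (rule bounded_bilinear.comp1[OF bounded_bilinear_blinfun_apply blinfun.bounded_linear_right])
  have d: "has_deriv_ae T (\<lambda>t. u t - c) g"
    using has_deriv_ae_diff[OF u has_deriv_ae_const[of T c]] by simp
  have "has_deriv_ae T (\<lambda>t. 1 / 2 * blinfun_apply (blinfun_apply A (u t - c)) (u t - c))
     (\<lambda>t. 1 / 2 * (blinfun_apply (blinfun_apply A (u t - c)) (g t) + blinfun_apply (blinfun_apply A (g t)) (u t - c)))"
    by (rule has_deriv_ae_bounded_linear[OF bounded_linear_mult_right has_deriv_ae_bilinear[OF B d d]])
  then show ?thesis by (simp add: phi_def sym[of "g _" "u _ - c"])
qed

context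
  fixes f :: "'a::{banach, second_countable_topology} \<Rightarrow> ereal" and A :: "'a \<Rightarrow>\<^sub>L 'a dual"
    and l :: "real \<Rightarrow> 'a dual" and T :: real
  assumes f: "closed_sublinear f" and T: "0 < T" and l: "continuous_on {0..T} l"
    and sym: "\<And>x y. blinfun_apply (blinfun_apply A x) y = blinfun_apply (blinfun_apply A y) x"
begin

lemma evolutionD:
  assumes "evolution T f A l u g"
  shows "has_deriv_ae T u g" "\<And>t v. t \<in> {0..T} \<Longrightarrow> ereal (blinfun_apply (l t - blinfun_apply A (u t)) v) \<le> f v"
    and "AE t\<in>{0..T} in lebesgue. f (g t) = ereal (blinfun_apply (l t - blinfun_apply A (u t)) (g t))"
  using assms AE_Leb_imp_AE_Icc unfolding evolution_def stable_def by blast+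

lemma evolution_force_continuous:
  assumes "evolution T f A l u g"
  shows "continuous_on {0..T} (\<lambda>t. l t - blinfun_apply A (u t))"
  using l has_deriv_aeD(1)[OF evolutionD(1)[OF assms]] by (intro continuous_intros)

lemma evolution_power_integrable:
  assumes e: "evolution T f A l u g" and st: "0 \<le> s" "t \<le> T"
  shows "set_integrable lebesgue {s..t} (\<lambda>r. blinfun_apply (l r - blinfun_apply A (u r)) (g r))"
proof (rule set_integrable_bilinear[OF bounded_bilinear_blinfun_apply])
  show "continuous_on {s..t} (\<lambda>r. l r - blinfun_apply A (u r))"
    using evolution_force_continuous[OF e] by (rule continuous_on_subset) (use st in auto)
  show "set_integrable lebesgue {s..t} g" by (rule has_deriv_aeD(3)[OF evolutionD(1)[OF e] st])
qed

text \<open>Jensen's inequality and the power identity. The velocity is traded for an increment of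
  \<open>u\<close>, a quantity at fixed times that passes to weak limits; moreover increments of
  \<open>u\<close> are thereby placed in the effective domain, where coercivity is
  available.\<close>

lemma evolution_increment_le:
  assumes e: "evolution T f A l u g" and st: "0 \<le> s" "s \<le> t" "t \<le> T"
  shows "f (u t - u s) \<le> ereal (LINT r:{s..t}|lebesgue. blinfun_apply (l r - blinfun_apply A (u r)) (g r))"
  unfolding has_deriv_aeD(4)[OF evolutionD(1)[OF e] st]
proof (rule Jensen_closed_sublinear[OF f has_deriv_aeD(3)[OF evolutionD(1)[OF e] st(1,3)] evolution_power_integrable[OF e st(1,3)]])
  show "AE r\<in>{s..t} in lebesgue. f (g r) \<le> ereal (blinfun_apply (l r - blinfun_apply A (u r)) (g r))"
    using evolutionD(3)[OF e] by eventually_elim (use st in auto)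
qed

text \<open>Testing the stability at time \<open>s\<close> with the velocity at time \<open>r\<close>.\<close>

lemma evolution_phi_le:
  assumes e: "evolution T f A l u g" and st: "0 \<le> s" "s \<le> t" "t \<le> T"
  shows "phi A (u t - u s) \<le> (LINT r:{s..t}|lebesgue. blinfun_apply (l r - l s) (g r))"
proof -
  note u = evolutionD(1)[OF e]
  have p: "has_deriv_ae T (\<lambda>t. phi A (u t - u s)) (\<lambda>r. blinfun_apply (blinfun_apply A (u r - u s)) (g r))"
    by (rule has_deriv_ae_phi[OF sym u])
  have "phi A (u t - u s) = (LINT r:{s..t}|lebesgue. blinfun_apply (blinfun_apply A (u r - u s)) (g r))"
    using has_deriv_aeD(4)[OF p st] by (simp add: phi_def blinfun.zero_right)
  also have "\<dots> \<le> (LINT r:{s..t}|lebesgue. blinfun_apply (l r - l s) (g r))"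
  proof (rule set_integral_mono_AE)
    show "set_integrable lebesgue {s..t} (\<lambda>r. blinfun_apply (blinfun_apply A (u r - u s)) (g r))"
      by (rule has_deriv_aeD(3)[OF p st(1,3)])
    have "continuous_on {s..t} (\<lambda>r. l r - l s)"
      using continuous_on_subset[OF l, of "{s..t}"] st by (intro continuous_intros) auto
    then show "set_integrable lebesgue {s..t} (\<lambda>r. blinfun_apply (l r - l s) (g r))"
      using has_deriv_aeD(3)[OF u st(1,3)] by (rule set_integrable_bilinear[OF bounded_bilinear_blinfun_apply])
    show "AE r\<in>{s..t} in lebesgue. blinfun_apply (blinfun_apply A (u r - u s)) (g r) \<le> blinfun_apply (l r - l s) (g r)"
      using evolutionD(3)[OF e]
    proof eventually_elim
      case (elim r)
      show ?case
      proof
        assume r: "r \<in> {s..t}"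
        have "ereal (blinfun_apply (l s - blinfun_apply A (u s)) (g r)) \<le> f (g r)"
          using st by (intro evolutionD(2)[OF e]) auto
        also have "f (g r) = ereal (blinfun_apply (l r - blinfun_apply A (u r)) (g r))"
          using elim r st by auto
        finally show "blinfun_apply (blinfun_apply A (u r - u s)) (g r) \<le> blinfun_apply (l r - l s) (g r)"
          by (simp add: blinfun.diff_left blinfun.diff_right)
      qed
    qed
  qed
  finally show ?thesis .
qed

text \<open>Integration by parts in time; \<open>l\<close> is only Lipschitz, so the derivative falls on difference quotients.\<close>

lemma lipschitz_pairing_le:
  assumes u: "has_deriv_ae T u g" and lip: "L-lipschitz_on {0..T} l"
    and st: "0 \<le> s" "s \<le> t" "t \<le> T" and M: "\<And>r. r \<in> {s..t} \<Longrightarrow> norm (u r - u s) \<le> M"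
  shows "(LINT r:{s..t}|lebesgue. blinfun_apply (l r - l s) (g r)) \<le> 2 * L * M * (t - s)"
proof -
  have L: "0 \<le> L" using lip by (rule lipschitz_on_nonneg)
  have li: "norm (l b - l a) \<le> L * (b - a)" if "0 \<le> a" "a \<le> b" "b \<le> T" for a b
    using lipschitz_onD[OF lip, of b a] that by (simp add: dist_norm)
  have gi: "set_integrable lebesgue {a..b} g" if "0 \<le> a" "b \<le> T" for a b
    by (rule has_deriv_aeD(3)[OF u that])
  have pi: "set_integrable lebesgue {a..b} (\<lambda>r. blinfun_apply (l r - c) (g r))" if "0 \<le> a" "b \<le> T" for a b c
  proof -
    have "continuous_on {a..b} (\<lambda>r. l r - c)"
      using continuous_on_subset[OF l, of "{a..b}"] that by (intro continuous_intros) auto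
    then show ?thesis using gi[OF that] by (rule set_integrable_bilinear[OF bounded_bilinear_blinfun_apply])
  qed
  \<comment> \<open>The defect of an integration by parts: the boundary term is subtracted, and
    \<open>L * M * \<tau>\<close> pays for the variation of \<open>l\<close> against
    \<open>u - u s\<close>. A second \<open>L * M * (t - s)\<close> bounds the boundary term, hence
    the factor \<open>2\<close>.\<close>
  define P where "P = (\<lambda>\<tau>. (LINT r:{s..\<tau>}|lebesgue. blinfun_apply (l r - l s) (g r))
    - blinfun_apply (l \<tau> - l s) (u \<tau> - u s) - L * M * \<tau>)"
  define N where "N = (\<lambda>\<tau>. LINT r:{s..\<tau>}|lebesgue. norm (g r))"
  have M0: "0 \<le> M" using M[of s] st by auto
  have "P t \<le> P s"
  proof (rule fine_increment_le[OF st(2), of P N])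
    fix e :: real assume e: "0 < e"
    show "\<exists>d>0. \<forall>a b. s \<le> a \<longrightarrow> a \<le> b \<longrightarrow> b \<le> t \<longrightarrow> b - a < d \<longrightarrow> P b - P a \<le> e * (N b - N a)"
    proof (intro exI[of _ "e / (L + 1)"] conjI allI impI)
      show "0 < e / (L + 1)" using e L by simp
      fix a b assume ab: "s \<le> a" "a \<le> b" "b \<le> t" "b - a < e / (L + 1)"
      then have ab': "0 \<le> a" "a \<le> b" "b \<le> T" "0 \<le> b" using st by auto
      have "L * (b - a) \<le> (L + 1) * (b - a)" using ab by (intro mult_right_mono) auto
      also have "\<dots> \<le> (L + 1) * (e / (L + 1))" using ab L by (intro mult_left_mono) auto
      also have "\<dots> = e" using L by simp
      finally have Le: "L * (b - a) \<le> e" .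
      have I: "(LINT r:{s..b}|lebesgue. blinfun_apply (l r - l s) (g r)) = (LINT r:{s..a}|lebesgue. blinfun_apply (l r - l s) (g r))
          + (LINT r:{a..b}|lebesgue. blinfun_apply (l r - l s) (g r))"
        using ab st by (intro set_integral_combine pi) auto
      have c: "set_integrable lebesgue {a..b} (\<lambda>r. blinfun_apply (l b - l s) (g r))"
        "(LINT r:{a..b}|lebesgue. blinfun_apply (l b - l s) (g r)) = blinfun_apply (l b - l s) (u b - u a)"
        unfolding has_deriv_aeD(4)[OF u ab'(1-3)]
        by (rule set_integrable_bounded_linear[OF blinfun.bounded_linear_right gi[OF ab'(1,3)]])+
      \<comment> \<open>\<open>l r\<close> is compared with \<open>l b\<close>; on a short interval
        the remainder is at most \<open>e\<close> times the integral of
        \<open>norm (g r)\<close>.\<close>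
      have J: "(LINT r:{a..b}|lebesgue. blinfun_apply (l r - l s) (g r)) - blinfun_apply (l b - l s) (u b - u a)
          = (LINT r:{a..b}|lebesgue. blinfun_apply (l r - l b) (g r))"
      proof -
        have "(LINT r:{a..b}|lebesgue. blinfun_apply (l r - l s) (g r)) - blinfun_apply (l b - l s) (u b - u a)
          = (LINT r:{a..b}|lebesgue. blinfun_apply (l r - l s) (g r) - blinfun_apply (l b - l s) (g r))"
          using set_integral_diff(2)[OF pi[OF ab'(1,3), of "l s"] c(1)] c(2) by simp
        then show ?thesis by (simp add: blinfun.diff_left)
      qed
      have "(LINT r:{a..b}|lebesgue. blinfun_apply (l r - l b) (g r)) \<le> (LINT r:{a..b}|lebesgue. e * norm (g r))"
      proof (rule set_integral_mono)
        show "set_integrable lebesgue {a..b} (\<lambda>r. e * norm (g r))"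
          by (intro set_integrable_mult_right impI set_integrable_norm' gi ab')
        fix r assume r: "r \<in> {a..b}"
        have "norm (l r - l b) \<le> L * (b - r)"
          using li[of r b] r ab' by (simp add: norm_minus_commute)
        also have "\<dots> \<le> L * (b - a)" using r L by (intro mult_left_mono) auto
        finally have "norm (l r - l b) \<le> e" using Le by simp
        then have "norm (l r - l b) * norm (g r) \<le> e * norm (g r)" by (intro mult_right_mono) auto
        then show "blinfun_apply (l r - l b) (g r) \<le> e * norm (g r)"
          using norm_blinfun[of "l r - l b" "g r"] by (simp del: blinfun.diff_left)
      qed (rule pi[OF ab'(1,3)])
      moreover have "(LINT r:{a..b}|lebesgue. e * norm (g r)) = e * (N b - N a)"
      proof -
        have "N b = N a + (LINT r:{a..b}|lebesgue. norm (g r))"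
          unfolding N_def using ab st by (intro set_integral_combine set_integrable_norm' gi) auto
        then show ?thesis by simp
      qed
      moreover have "- (blinfun_apply (l b - l a) (u a - u s)) \<le> L * M * (b - a)"
      proof -
        have "- (blinfun_apply (l b - l a) (u a - u s)) \<le> norm (l b - l a) * norm (u a - u s)"
          using norm_blinfun[of "l b - l a" "u a - u s"] by (simp add: abs_le_iff)
        also have "\<dots> \<le> (L * (b - a)) * M"
          using ab ab' L by (intro mult_mono li M) auto
        finally show ?thesis by (simp add: mult_ac)
      qed
      moreover have "P b - P a = ((LINT r:{a..b}|lebesgue. blinfun_apply (l r - l s) (g r)) - blinfun_apply (l b - l s) (u b - u a))
          - blinfun_apply (l b - l a) (u a - u s) - L * M * (b - a)"
        unfolding P_def I by (simp add: blinfun.diff_left blinfun.diff_right algebra_simps)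
      ultimately show "P b - P a \<le> e * (N b - N a)" unfolding J by linarith
    qed
  qed
  then have "(LINT r:{s..t}|lebesgue. blinfun_apply (l r - l s) (g r)) \<le> blinfun_apply (l t - l s) (u t - u s) + L * M * (t - s)"
    using set_integral_Icc_singleton[OF pi[of s s "l s"]] st by (simp add: P_def algebra_simps)
  also have "blinfun_apply (l t - l s) (u t - u s) \<le> norm (l t - l s) * norm (u t - u s)"
    using norm_blinfun[of "l t - l s" "u t - u s"] by (simp add: abs_le_iff)
  also have "\<dots> \<le> (L * (t - s)) * M"
    using st L by (intro mult_mono li M) auto
  finally show ?thesis by (simp add: algebra_simps)
qed

text \<open>The pairing bound involves the largest deviation \<open>M\<close> from
  \<open>u s\<close> on \<open>{s..t}\<close>, so the energy estimate is applied at a time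
  \<open>r\<close> where it is attained:
  \<open>\<alpha> / 2 * M\<^sup>2 \<le> 2 * L * M * (t - s)\<close>. Division by \<open>M\<close>
  gives the constant, which depends on \<open>f\<close> only through \<alpha>.\<close>

theorem evolution_lipschitz:
  assumes e: "evolution T f A l u g" and lip: "L-lipschitz_on {0..T} l" and \<alpha>: "0 < \<alpha>"
    and coercive: "\<And>x. x \<in> eff_dom f \<Longrightarrow> \<alpha> / 2 * (norm x)\<^sup>2 \<le> phi A x"
  shows "(4 * L / \<alpha>)-lipschitz_on {0..T} u"
proof -
  have L: "0 \<le> L" using lip by (rule lipschitz_on_nonneg)
  note u = evolutionD(1)[OF e]
  have main: "norm (u t - u s) \<le> 4 * L / \<alpha> * (t - s)" if st: "0 \<le> s" "s \<le> t" "t \<le> T" for s t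
  proof -
    have "continuous_on {s..t} (\<lambda>r. norm (u r - u s))"
      using has_deriv_aeD(5)[OF u st(1,3)] by (intro continuous_intros)
    then obtain r where r: "r \<in> {s..t}" "\<And>x. x \<in> {s..t} \<Longrightarrow> norm (u x - u s) \<le> norm (u r - u s)"
      using continuous_attains_sup[of "{s..t}" "\<lambda>r. norm (u r - u s)"] st by auto
    define M where "M = norm (u r - u s)"
    have sr: "0 \<le> s" "s \<le> r" "r \<le> T" using r st by auto
    have "u r - u s \<in> eff_dom f"
      using evolution_increment_le[OF e sr] by (auto simp: eff_dom_def intro: le_less_trans)
    then have "\<alpha> / 2 * M\<^sup>2 \<le> phi A (u r - u s)" unfolding M_def by (rule coercive)
    also have "\<dots> \<le> (LINT \<tau>:{s..r}|lebesgue. blinfun_apply (l \<tau> - l s) (g \<tau>))"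
      by (rule evolution_phi_le[OF e sr])
    also have "\<dots> \<le> 2 * L * M * (r - s)"
      unfolding M_def using r by (intro lipschitz_pairing_le[OF u lip sr]) auto
    also have "\<dots> \<le> 2 * L * M * (t - s)"
      using r L by (intro mult_left_mono) (auto simp: M_def)
    finally have "M * (\<alpha> * M) \<le> M * (4 * L * (t - s))" by (simp add: power2_eq_square algebra_simps)
    moreover have "0 \<le> M" by (simp add: M_def)
    ultimately have "M \<le> 4 * L / \<alpha> * (t - s)"
    proof (cases "M = 0")
      case True
      then show ?thesis using L \<alpha> st by simp
    next
      case False
      then have "\<alpha> * M \<le> 4 * L * (t - s)"
        using \<open>M * (\<alpha> * M) \<le> M * (4 * L * (t - s))\<close> \<open>0 \<le> M\<close> by (simp add: mult_le_cancel_left)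
      then show ?thesis using \<alpha> by (simp add: field_simps)
    qed
    moreover have "norm (u t - u s) \<le> M" using r(2)[of t] st by (simp add: M_def)
    ultimately show ?thesis by simp
  qed
  show ?thesis
  proof (rule lipschitz_onI)
    show "0 \<le> 4 * L / \<alpha>" using L \<alpha> by simp
    fix s t assume "s \<in> {0..T}" "t \<in> {0..T}"
    then show "dist (u s) (u t) \<le> 4 * L / \<alpha> * dist s t"
      using main[of s t] main[of t s] by (cases "s \<le> t") (auto simp: dist_norm norm_minus_commute)
  qed
qed

text \<open>Monotonicity: the stability of each solution is tested with the velocity of the other,
  and the sum says that \<open>phi A (u t - v t)\<close> has nonpositive derivative. Coercivity is
  asked of the differences \<open>u t - v t\<close> only, since \<open>phi\<close> may fail to be
  coercive elsewhere.\<close>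

theorem evolution_unique:
  assumes u: "evolution T f A l u g" and v: "evolution T f A l v h" and init: "u 0 = v 0" and \<alpha>: "0 < \<alpha>"
    and coercive: "\<And>t. t \<in> {0..T} \<Longrightarrow> \<alpha> / 2 * (norm (u t - v t))\<^sup>2 \<le> phi A (u t - v t)"
    and t: "t \<in> {0..T}"
  shows "u t = v t"
proof -
  have d: "has_deriv_ae T (\<lambda>t. u t - v t) (\<lambda>t. g t - h t)"
    by (rule has_deriv_ae_diff[OF evolutionD(1)[OF u] evolutionD(1)[OF v]])
  have p: "has_deriv_ae T (\<lambda>t. phi A (u t - v t)) (\<lambda>r. blinfun_apply (blinfun_apply A (u r - v r)) (g r - h r))"
    using has_deriv_ae_phi[OF sym d, of 0] by simp
  have t': "0 \<le> t" "t \<le> T" using t by auto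
  have "phi A (u t - v t) = (LINT r:{0..t}|lebesgue. blinfun_apply (blinfun_apply A (u r - v r)) (g r - h r))"
    using has_deriv_aeD(4)[OF p order_refl t'] init by (simp add: phi_def blinfun.zero_right)
  also have "\<dots> \<le> (LINT r:{0..t}|lebesgue. 0)"
  proof (rule set_integral_mono_AE)
    show "set_integrable lebesgue {0..t} (\<lambda>r. blinfun_apply (blinfun_apply A (u r - v r)) (g r - h r))"
      by (rule has_deriv_aeD(3)[OF p order_refl t'(2)])
    show "set_integrable lebesgue {0..t} (\<lambda>r. 0 :: real)" by (simp add: set_integrable_def)
    show "AE r\<in>{0..t} in lebesgue. blinfun_apply (blinfun_apply A (u r - v r)) (g r - h r) \<le> 0"
      using evolutionD(3)[OF u] evolutionD(3)[OF v]
    proof eventually_elim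
      case (elim r)
      show ?case
      proof
        assume "r \<in> {0..t}"
        then have r: "r \<in> {0..T}" using t' by auto
        have "ereal (blinfun_apply (l r - blinfun_apply A (v r)) (g r)) \<le> ereal (blinfun_apply (l r - blinfun_apply A (u r)) (g r))"
          using evolutionD(2)[OF v r, of "g r"] elim r by simp
        moreover have "ereal (blinfun_apply (l r - blinfun_apply A (u r)) (h r)) \<le> ereal (blinfun_apply (l r - blinfun_apply A (v r)) (h r))"
          using evolutionD(2)[OF u r, of "h r"] elim r by simp
        ultimately show "blinfun_apply (blinfun_apply A (u r - v r)) (g r - h r) \<le> 0"
          by (simp add: blinfun.diff_left blinfun.diff_right)
      qed
    qed
  qed
  also have "\<dots> = 0" by simp
  finally have "\<alpha> / 2 * (norm (u t - v t))\<^sup>2 \<le> 0" using coercive[OF t] by linarith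
  then have "(norm (u t - v t))\<^sup>2 \<le> 0" using \<alpha> by (simp add: mult_le_0_iff)
  then show ?thesis by simp
qed

end

section \<open>Passage to the limit\<close>

text \<open>An asymptotic version of \<open>fine_increment_le\<close>. The threshold in
  \<open>n\<close> may depend on the subinterval; a partition has only finitely many, so induction
  over its points combines them, each step spending half of its tolerance.\<close>

lemma fine_limit_le:
  fixes X :: "nat \<Rightarrow> real \<Rightarrow> real"
  assumes ab: "a \<le> b"
    and fine: "\<And>e. 0 < e \<Longrightarrow> \<exists>d>0. \<forall>s t. a \<le> s \<longrightarrow> s \<le> t \<longrightarrow> t \<le> b \<longrightarrow> t - s < d \<longrightarrow>
      (\<forall>\<eta>>0. eventually (\<lambda>n. X n t - X n s \<le> e * (t - s) + \<eta>) sequentially)"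
    and \<eta>: "0 < \<eta>"
  shows "eventually (\<lambda>n. X n b - X n a \<le> \<eta>) sequentially"
proof -
  define e where "e = \<eta> / (2 * (b - a + 1))"
  have e: "0 < e" using \<eta> ab by (simp add: e_def)
  obtain d where d: "0 < d" and dX: "\<forall>s t. a \<le> s \<longrightarrow> s \<le> t \<longrightarrow> t \<le> b \<longrightarrow> t - s < d \<longrightarrow>
      (\<forall>\<eta>>0. eventually (\<lambda>n. X n t - X n s \<le> e * (t - s) + \<eta>) sequentially)"
    using fine[OF e] by (elim exE conjE)
  obtain N :: nat and x where x: "x 0 = a" "x N = b"
    "\<And>i. i < N \<Longrightarrow> a \<le> x i \<and> x i \<le> x (Suc i) \<and> x (Suc i) \<le> b \<and> x (Suc i) - x i < d"
    using fine_partition[OF ab d] by metis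
  have "\<forall>\<eta>>0. eventually (\<lambda>n. X n (x i) - X n a \<le> e * (x i - a) + \<eta>) sequentially" if "i \<le> N" for i
    using that
  proof (induction i)
    case (Suc i)
    show ?case
    proof (intro allI impI)
      fix \<eta> :: real assume "0 < \<eta>"
      then have "0 < \<eta> / 2" by simp
      then have "eventually (\<lambda>n. X n (x i) - X n a \<le> e * (x i - a) + \<eta> / 2) sequentially"
        "eventually (\<lambda>n. X n (x (Suc i)) - X n (x i) \<le> e * (x (Suc i) - x i) + \<eta> / 2) sequentially"
        using Suc x(3)[of i] dX by auto
      then show "eventually (\<lambda>n. X n (x (Suc i)) - X n a \<le> e * (x (Suc i) - a) + \<eta>) sequentially"
        by eventually_elim (simp add: algebra_simps)
    qed
  qed (simp add: x(1))
  then have "eventually (\<lambda>n. X n b - X n a \<le> e * (b - a) + \<eta> / 2) sequentially"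
    using x(2) \<eta> by (metis half_gt_zero order_refl)
  moreover have "e * (b - a) \<le> e * (b - a + 1)" using e by simp
  moreover have "e * (b - a + 1) = \<eta> / 2" unfolding e_def using ab by (simp add: field_simps)
  ultimately show ?thesis by (elim eventually_mono) linarith
qed

lemma weakly_tendsto_diff:
  assumes "weakly_tendsto u x F" "weakly_tendsto v y F"
  shows "weakly_tendsto (\<lambda>n. u n - v n) (x - y) F"
  using assms unfolding weakly_tendsto_def by (auto simp: blinfun.diff_right intro!: tendsto_diff)

lemma tendsto_imp_weakly_tendsto:
  assumes "(u \<longlongrightarrow> x) F"
  shows "weakly_tendsto u x F"
  unfolding weakly_tendsto_def using assms by (auto intro!: tendsto_intros)

text \<open>The zero sequence \<open>u n - u n\<close> converges weakly to
  \<open>x - y\<close>.\<close>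

lemma weakly_tendsto_unique:
  assumes "weakly_tendsto u x F" "weakly_tendsto u y F" "F \<noteq> bot"
  shows "x = y"
proof -
  have "norm (x - y) \<le> 0"
    using weakly_tendsto_diff[OF assms(1,2)] assms(3) by (intro weakly_tendsto_norm_le[of "\<lambda>n. u n - u n" _ F]) auto
  then show ?thesis by simp
qed

lemma weak_strong_pairing:
  fixes w :: "'i \<Rightarrow> 'a::real_normed_vector dual"
  assumes u: "weakly_tendsto u x F" and R: "eventually (\<lambda>n. norm (u n) \<le> R) F" and w: "(w \<longlongrightarrow> w0) F"
  shows "((\<lambda>n. blinfun_apply (w n) (u n)) \<longlongrightarrow> blinfun_apply w0 x) F"
proof -
  have "((\<lambda>n. blinfun_apply (w n - w0) (u n)) \<longlongrightarrow> 0) F"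
  proof (rule Lim_null_comparison)
    show "eventually (\<lambda>n. norm (blinfun_apply (w n - w0) (u n)) \<le> norm (w n - w0) * R) F"
      using R
    proof eventually_elim
      case (elim n)
      then have "norm (w n - w0) * norm (u n) \<le> norm (w n - w0) * R" by (intro mult_left_mono) auto
      then show ?case using norm_blinfun[of "w n - w0" "u n"] by linarith
    qed
    have "((\<lambda>n. norm (w n - w0)) \<longlongrightarrow> 0) F" using w by (simp add: tendsto_norm_zero_iff LIM_zero_iff)
    then show "((\<lambda>n. norm (w n - w0) * R) \<longlongrightarrow> 0) F" by (rule tendsto_mult_left_zero)
  qed
  moreover have "((\<lambda>n. blinfun_apply w0 (u n)) \<longlongrightarrow> blinfun_apply w0 x) F"
    using u unfolding weakly_tendsto_def by blast
  ultimately have "((\<lambda>n. blinfun_apply (w n - w0) (u n) + blinfun_apply w0 (u n)) \<longlongrightarrow> 0 + blinfun_apply w0 x) F"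
    by (rule tendsto_add)
  then show ?thesis by (simp add: blinfun.diff_left)
qed

lemma has_deriv_ae_lipschitz_bound:
  fixes u :: "real \<Rightarrow> 'a::{banach, second_countable_topology}"
  assumes refl: "reflexive_space TYPE('a)" and T: "0 < T" and lip: "K-lipschitz_on {0..T} u" and u: "has_deriv_ae T u g"
  shows "AE t\<in>{0..T} in lebesgue. norm (g t) \<le> K"
proof (rule AE_Leb_imp_AE_Icc)
  show "AE t in Leb T. norm (g t) \<le> K"
    using lipschitz_imp_W1inf(3)[OF refl T lip] weak_deriv_AE_eq[OF T u] by eventually_elim simp
qed

text \<open>A one-point quadrature with a free tag \<open>t\<close>: moving \<open>w r\<close> to
  \<open>w t\<close> costs at most \<open>C * (b - a)\<close>, against a velocity bounded by
  \<open>K\<close> on an interval of length \<open>b - a\<close>. The quadrature contains only the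
  increment of \<open>u\<close>, and the quadratic error vanishes when summed over fine partitions
  or divided by \<open>b - a\<close>.\<close>

lemma pairing_quadrature:
  fixes w :: "real \<Rightarrow> 'a::{banach, second_countable_topology} dual"
  assumes u: "has_deriv_ae T u g" and g: "AE t\<in>{0..T} in lebesgue. norm (g t) \<le> K"
    and lip: "C-lipschitz_on {0..T} w" and ab: "0 \<le> a" "a \<le> b" "b \<le> T" and t: "t \<in> {a..b}"
  shows "\<bar>(LINT r:{a..b}|lebesgue. blinfun_apply (w r) (g r)) - blinfun_apply (w t) (u b - u a)\<bar> \<le> C * K * (b - a)\<^sup>2"
proof -
  note gi = has_deriv_aeD(3)[OF u ab(1,3)]
  have C: "0 \<le> C" using lip by (rule lipschitz_on_nonneg)
  have "continuous_on {a..b} w"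
    using lipschitz_on_continuous_on[OF lip] by (rule continuous_on_subset) (use ab in auto)
  then have wi: "set_integrable lebesgue {a..b} (\<lambda>r. blinfun_apply (w r) (g r))"
    using gi by (rule set_integrable_bilinear[OF bounded_bilinear_blinfun_apply])
  have ci: "set_integrable lebesgue {a..b} (\<lambda>r. blinfun_apply (w t) (g r))"
    "(LINT r:{a..b}|lebesgue. blinfun_apply (w t) (g r)) = blinfun_apply (w t) (u b - u a)"
    unfolding has_deriv_aeD(4)[OF u ab]
    by (rule set_integrable_bounded_linear[OF blinfun.bounded_linear_right gi])+
  have eq: "(LINT r:{a..b}|lebesgue. blinfun_apply (w r) (g r)) - blinfun_apply (w t) (u b - u a)
      = (LINT r:{a..b}|lebesgue. blinfun_apply (w r - w t) (g r))"
    using set_integral_diff(2)[OF wi ci(1)] ci(2) by (simp add: blinfun.diff_left)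
  have di: "set_integrable lebesgue {a..b} (\<lambda>r. blinfun_apply (w r - w t) (g r))"
    using set_integral_diff(1)[OF wi ci(1)] by (simp add: blinfun.diff_left)
  have "\<bar>LINT r:{a..b}|lebesgue. blinfun_apply (w r - w t) (g r)\<bar> \<le> (LINT r:{a..b}|lebesgue. \<bar>blinfun_apply (w r - w t) (g r)\<bar>)"
    using norm_set_integral_le[of lebesgue "{a..b}" "\<lambda>r. blinfun_apply (w r - w t) (g r)"] by simp
  also have "\<dots> \<le> (LINT r:{a..b}|lebesgue. C * (b - a) * K)"
  proof (rule set_integral_mono_AE)
    show "set_integrable lebesgue {a..b} (\<lambda>r. \<bar>blinfun_apply (w r - w t) (g r)\<bar>)"
      using di by (rule set_integrable_abs)
    show "set_integrable lebesgue {a..b} (\<lambda>r. C * (b - a) * K)"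
      by (rule set_integrable_const_bounded) auto
    show "AE r\<in>{a..b} in lebesgue. \<bar>blinfun_apply (w r - w t) (g r)\<bar> \<le> C * (b - a) * K"
      using g
    proof eventually_elim
      case (elim r)
      show ?case
      proof
        assume r: "r \<in> {a..b}"
        have "norm (w r - w t) \<le> C * \<bar>r - t\<bar>"
          using lipschitz_onD[OF lip, of r t] r t ab by (simp add: dist_norm)
        also have "\<dots> \<le> C * (b - a)" using r t C by (intro mult_left_mono) auto
        finally have "norm (w r - w t) * norm (g r) \<le> C * (b - a) * K"
          using elim r ab C by (intro mult_mono) auto
        then show "\<bar>blinfun_apply (w r - w t) (g r)\<bar> \<le> C * (b - a) * K"
          using norm_blinfun[of "w r - w t" "g r"] unfolding real_norm_def by linarith
      qed
    qed
  qed
  also have "\<dots> = C * K * (b - a)\<^sup>2"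
    using set_integral_const[of "{a..b}" lebesgue "C * (b - a) * K"] ab by (simp add: power2_eq_square mult_ac)
  finally show ?thesis unfolding eq .
qed

lemma ereal_le_of_all_greater:
  assumes "\<And>c. x < ereal c \<Longrightarrow> a \<le> c"
  shows "ereal a \<le> x"
proof (rule ccontr)
  assume "\<not> ereal a \<le> x"
  then have "x < ereal a" by simp
  then obtain c where "x < ereal c" "ereal c < ereal a" using ereal_dense2 by blast
  then show False using assms[of c] by simp
qed

lemma ereal_le_of_all_less:
  assumes "\<And>c. ereal c < x \<Longrightarrow> c \<le> a"
  shows "x \<le> ereal a"
proof (rule ccontr)
  assume "\<not> x \<le> ereal a"
  then have "ereal a < x" by simp
  then obtain c where "ereal a < ereal c" "ereal c < x" using ereal_dense2 by blast
  then show False using assms[of c] by simp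
qed

text \<open>The data of a sequence along which the solutions converge weakly at every time.
  \<open>lower\<close> and \<open>recovery\<close> express the two halves of Mosco convergence by
  eventual inequalities with thresholds, which combine with other eventual statements.\<close>

locale limit_passage =
  fixes T \<alpha> L :: real and \<psi> :: "'a::{banach, second_countable_topology} \<Rightarrow> ereal"
    and A :: "'a \<Rightarrow>\<^sub>L 'a dual" and l :: "real \<Rightarrow> 'a dual" and y0 :: 'a
    and f :: "nat \<Rightarrow> 'a \<Rightarrow> ereal" and k :: "nat \<Rightarrow> real \<Rightarrow> 'a dual"
    and z g :: "nat \<Rightarrow> real \<Rightarrow> 'a" and y :: "real \<Rightarrow> 'a"
  assumes T: "0 < T" and \<alpha>: "0 < \<alpha>" and refl: "reflexive_space TYPE('a)"
    and \<psi>: "closed_sublinear \<psi>" and f: "\<And>n. closed_sublinear (f n)"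
    and sym: "\<And>u v. blinfun_apply (blinfun_apply A u) v = blinfun_apply (blinfun_apply A v) u"
    and lower: "\<And>u x c. weakly_tendsto u x sequentially \<Longrightarrow> c < \<psi> x \<Longrightarrow> eventually (\<lambda>n. c < f n (u n)) sequentially"
    and recovery: "\<And>x. \<exists>v. v \<longlonglongrightarrow> x \<and> (\<forall>c. \<psi> x < c \<longrightarrow> eventually (\<lambda>n. f n (v n) < c) sequentially)"
    and coercive: "\<And>n u v. u \<in> eff_dom (f n) \<Longrightarrow> v \<in> eff_dom (f n) \<Longrightarrow> \<alpha> / 2 * (norm (u - v))\<^sup>2 \<le> phi A (u - v)"
    and k_lip: "\<And>n. L-lipschitz_on {0..T} (k n)" and k_lim: "\<And>t. t \<in> {0..T} \<Longrightarrow> (\<lambda>n. k n t) \<longlonglongrightarrow> l t"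
    and z: "\<And>n. evolution T (f n) A (k n) (z n) (g n)"
    and z_init: "(\<lambda>n. z n 0) \<longlonglongrightarrow> y0"
    and z_lim: "\<And>t. t \<in> {0..T} \<Longrightarrow> weakly_tendsto (\<lambda>n. z n t) (y t) sequentially"
begin

definition "K = 4 * L / \<alpha>"

lemma k_cont: "continuous_on {0..T} (k n)"
  by (rule lipschitz_on_continuous_on[OF k_lip])

lemma z_lip: "K-lipschitz_on {0..T} (z n)"
  unfolding K_def
proof (rule evolution_lipschitz[OF f T k_cont sym z k_lip \<alpha>])
  fix x assume x: "x \<in> eff_dom (f n)"
  have "0 \<in> eff_dom (f n)" by (simp add: eff_dom_def closed_sublinear_zero[OF f])
  from coercive[OF x this] show "\<alpha> / 2 * (norm x)\<^sup>2 \<le> phi A x" by simp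
qed

lemma L0: "0 \<le> L" by (rule lipschitz_on_nonneg[OF k_lip])

lemma K0: "0 \<le> K" by (rule lipschitz_on_nonneg[OF z_lip])

lemma z_deriv: "has_deriv_ae T (z n) (g n)"
  using z by (simp add: evolution_def)

lemma g_bound: "AE t\<in>{0..T} in lebesgue. norm (g n t) \<le> K"
  by (rule has_deriv_ae_lipschitz_bound[OF refl T z_lip z_deriv])

lemma z_bounded: "\<exists>R\<ge>0. \<forall>n. \<forall>t\<in>{0..T}. norm (z n t) \<le> R"
proof -
  obtain R where R: "0 < R" "\<And>n. norm (z n 0) \<le> R"
    using convergent_imp_Bseq[OF convergentI[OF z_init]] unfolding Bseq_def by auto
  have "norm (z n t) \<le> R + K * T" if t: "t \<in> {0..T}" for n t
  proof -
    have "norm (z n t - z n 0) \<le> K * t"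
      using lipschitz_onD[OF z_lip, of t 0 n] t T by (simp add: dist_norm)
    also have "\<dots> \<le> K * T" using t K0 by (intro mult_left_mono) auto
    finally show ?thesis using R(2)[of n] norm_triangle_sub[of "z n t" "z n 0"] by simp
  qed
  then show ?thesis using R(1) K0 T by (intro exI[of _ "R + K * T"]) auto
qed

lemma y_lip: "K-lipschitz_on {0..T} y"
proof (rule lipschitz_onI[OF _ K0])
  fix s t assume st: "s \<in> {0..T}" "t \<in> {0..T}"
  show "dist (y s) (y t) \<le> K * dist s t"
    unfolding dist_norm[of "y s"]
  proof (rule weakly_tendsto_norm_le[OF weakly_tendsto_diff[OF z_lim[OF st(1)] z_lim[OF st(2)]]])
    show "\<forall>\<^sub>F n in sequentially. norm (z n s - z n t) \<le> K * dist s t"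
      using lipschitz_onD[OF z_lip st] by (simp add: dist_norm)
  qed simp
qed

lemma l_lip: "L-lipschitz_on {0..T} l"
proof (rule lipschitz_onI[OF _ L0])
  fix s t assume st: "s \<in> {0..T}" "t \<in> {0..T}"
  show "dist (l s) (l t) \<le> L * dist s t"
  proof (rule tendsto_upperbound)
    show "(\<lambda>n. dist (k n s) (k n t)) \<longlonglongrightarrow> dist (l s) (l t)" by (intro tendsto_dist k_lim st)
    show "\<forall>\<^sub>F n in sequentially. dist (k n s) (k n t) \<le> L * dist s t"
      using lipschitz_onD[OF k_lip st] by simp
  qed simp
qed

lemma y_init: "y 0 = y0"
proof -
  have "0 \<in> {0..T}" using T by simp
  then show ?thesis
    using weakly_tendsto_unique[OF z_lim tendsto_imp_weakly_tendsto[OF z_init]] by simp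
qed

text \<open>Since \<open>z n t\<close> converges only weakly, the test vector must converge
  strongly: it is a recovery sequence for \<open>v\<close>, and symmetry moves \<open>A\<close> onto
  it before the limit is taken.\<close>

lemma limit_stable:
  assumes t: "t \<in> {0..T}"
  shows "ereal (blinfun_apply (l t - blinfun_apply A (y t)) v) \<le> \<psi> v"
proof (rule ereal_le_of_all_greater)
  fix c assume c: "\<psi> v < ereal c"
  obtain vn where vn: "vn \<longlonglongrightarrow> v" "eventually (\<lambda>n. f n (vn n) < ereal c) sequentially"
    using recovery[of v] c by blast
  obtain R where R: "\<And>n. norm (z n t) \<le> R" using z_bounded t by blast
  have "(\<lambda>n. blinfun_apply (blinfun_apply A (vn n)) (z n t)) \<longlonglongrightarrow> blinfun_apply (blinfun_apply A v) (y t)"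
    using R by (intro weak_strong_pairing[OF z_lim[OF t], where R = R] blinfun.tendsto tendsto_const vn(1)) auto
  moreover have "(\<lambda>n. blinfun_apply (k n t) (vn n)) \<longlonglongrightarrow> blinfun_apply (l t) v"
    by (intro blinfun.tendsto k_lim t vn(1))
  ultimately have "(\<lambda>n. blinfun_apply (k n t) (vn n) - blinfun_apply (blinfun_apply A (vn n)) (z n t))
      \<longlonglongrightarrow> blinfun_apply (l t) v - blinfun_apply (blinfun_apply A v) (y t)"
    by (intro tendsto_diff)
  moreover have "eventually (\<lambda>n. blinfun_apply (k n t) (vn n) - blinfun_apply (blinfun_apply A (vn n)) (z n t) \<le> c) sequentially"
    using vn(2)
  proof eventually_elim
    case (elim n)
    have "ereal (blinfun_apply (k n t - blinfun_apply A (z n t)) (vn n)) \<le> f n (vn n)"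
      by (rule evolutionD(2)[OF f T k_cont sym z t])
    also have "\<dots> < ereal c" by (rule elim)
    finally show ?case by (simp add: blinfun.diff_left sym[of "vn n"])
  qed
  ultimately have "blinfun_apply (l t) v - blinfun_apply (blinfun_apply A v) (y t) \<le> c"
    by (intro tendsto_upperbound) auto
  then show "blinfun_apply (l t - blinfun_apply A (y t)) v \<le> c"
    by (simp add: blinfun.diff_left sym[of v])
qed

text \<open>Both arguments are recovered by strongly convergent sequences, along which
  \<open>phi\<close> is continuous. The limit functional thus inherits coercivity on differences,
  which the uniqueness argument requires.\<close>

lemma limit_coercive:
  assumes "u \<in> eff_dom \<psi>" "v \<in> eff_dom \<psi>"
  shows "\<alpha> / 2 * (norm (u - v))\<^sup>2 \<le> phi A (u - v)"
proof -
  obtain un where un: "un \<longlonglongrightarrow> u" "eventually (\<lambda>n. f n (un n) < \<infinity>) sequentially"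
    using recovery[of u] assms(1) by (auto simp: eff_dom_def)
  obtain vn where vn: "vn \<longlonglongrightarrow> v" "eventually (\<lambda>n. f n (vn n) < \<infinity>) sequentially"
    using recovery[of v] assms(2) by (auto simp: eff_dom_def)
  have "(\<lambda>n. phi A (un n - vn n)) \<longlonglongrightarrow> phi A (u - v)"
    unfolding phi_def by (intro tendsto_mult blinfun.tendsto tendsto_const tendsto_diff un vn)
  moreover have "(\<lambda>n. \<alpha> / 2 * (norm (un n - vn n))\<^sup>2) \<longlonglongrightarrow> \<alpha> / 2 * (norm (u - v))\<^sup>2"
    by (intro tendsto_mult tendsto_power tendsto_norm tendsto_const tendsto_diff un vn)
  moreover have "eventually (\<lambda>n. \<alpha> / 2 * (norm (un n - vn n))\<^sup>2 \<le> phi A (un n - vn n)) sequentially"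
    using un(2) vn(2) by eventually_elim (rule coercive, auto simp: eff_dom_def)
  ultimately show ?thesis by (rule tendsto_le[OF sequentially_bot])
qed

text \<open>By the power identity this is the energy dissipated up to time \<open>t\<close>, the
  integral of \<open>f n (g n r)\<close>. Written as a pairing it is real valued and splits into
  work and stored energy.\<close>

definition "D n t = (LINT r:{0..t}|lebesgue. blinfun_apply (k n r - blinfun_apply A (z n r)) (g n r))"

lemma increment_le_D:
  assumes st: "0 \<le> s" "s \<le> t" "t \<le> T"
  shows "f n (z n t - z n s) \<le> ereal (D n t - D n s)"
proof -
  have "D n t = D n s + (LINT r:{s..t}|lebesgue. blinfun_apply (k n r - blinfun_apply A (z n r)) (g n r))"
    unfolding D_def using st by (intro set_integral_combine evolution_power_integrable[OF f T k_cont sym z]) auto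
  then show ?thesis using evolution_increment_le[OF f T k_cont sym z st, of n] by simp
qed

text \<open>The quadratic part of the power is an exact derivative, so weak limits have to be taken
  only in the linear work and in the values of \<open>phi\<close> at the two ends.\<close>

lemma power_split:
  assumes u: "has_deriv_ae T u v" and j: "continuous_on {0..T} j" and t: "0 \<le> t" "t \<le> T"
  shows "(LINT r:{0..t}|lebesgue. blinfun_apply (j r - blinfun_apply A (u r)) (v r))
    = (LINT r:{0..t}|lebesgue. blinfun_apply (j r) (v r)) - phi A (u t) + phi A (u 0)"
proof -
  have p: "has_deriv_ae T (\<lambda>t. phi A (u t)) (\<lambda>t. blinfun_apply (blinfun_apply A (u t)) (v t))"
    using has_deriv_ae_phi[OF sym u, of 0] by simp
  have "continuous_on {0..t} j" using j by (rule continuous_on_subset) (use t in auto)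
  then have i: "set_integrable lebesgue {0..t} (\<lambda>r. blinfun_apply (j r) (v r))"
    using has_deriv_aeD(3)[OF u order_refl t(2)] by (rule set_integrable_bilinear[OF bounded_bilinear_blinfun_apply])
  show ?thesis
    using set_integral_diff(2)[OF i has_deriv_aeD(3)[OF p order_refl t(2)]] has_deriv_aeD(4)[OF p order_refl t]
    by (simp add: blinfun.diff_left)
qed

section \<open>Convergence of the dissipated energies\<close>

context
  fixes v :: "real \<Rightarrow> 'a"
  assumes v: "has_deriv_ae T y v"
begin

text \<open>The candidate for the limit of \<open>D n\<close>. It is defined as a pairing because
  the power identity of the limit is not yet available.\<close>

definition "E t = (LINT r:{0..t}|lebesgue. blinfun_apply (l r - blinfun_apply A (y r)) (v r))"

lemma v_bound: "AE t\<in>{0..T} in lebesgue. norm (v t) \<le> K"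
  by (rule has_deriv_ae_lipschitz_bound[OF refl T y_lip v])

lemma l_cont: "continuous_on {0..T} l"
  by (rule lipschitz_on_continuous_on[OF l_lip])

definition "C = L + norm A * K"

lemma force_lip: "C-lipschitz_on {0..T} (\<lambda>t. l t - blinfun_apply A (y t))"
proof (rule lipschitz_onI)
  show "0 \<le> C" using L0 K0 by (simp add: C_def)
  fix s t assume st: "s \<in> {0..T}" "t \<in> {0..T}"
  have "dist (l s - blinfun_apply A (y s)) (l t - blinfun_apply A (y t)) = norm ((l s - l t) - blinfun_apply A (y s - y t))"
    by (simp add: dist_norm blinfun.diff_right algebra_simps)
  also have "\<dots> \<le> norm (l s - l t) + norm (blinfun_apply A (y s - y t))" by (rule norm_triangle_ineq4)
  also have "\<dots> \<le> L * dist s t + norm A * (K * dist s t)"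
  proof (rule add_mono)
    show "norm (l s - l t) \<le> L * dist s t" using lipschitz_onD[OF l_lip st] by (simp add: dist_norm)
    have "norm (blinfun_apply A (y s - y t)) \<le> norm A * norm (y s - y t)" by (rule norm_blinfun)
    also have "\<dots> \<le> norm A * (K * dist s t)"
      using lipschitz_onD[OF y_lip st] by (intro mult_left_mono) (auto simp: dist_norm)
    finally show "norm (blinfun_apply A (y s - y t)) \<le> norm A * (K * dist s t)" .
  qed
  finally show "dist (l s - blinfun_apply A (y s)) (l t - blinfun_apply A (y t)) \<le> C * dist s t"
    by (simp add: C_def algebra_simps)
qed

lemma E_diff:
  assumes st: "0 \<le> s" "s \<le> t" "t \<le> T"
  shows "E t - E s = (LINT r:{s..t}|lebesgue. blinfun_apply (l r - blinfun_apply A (y r)) (v r))"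
proof -
  have "continuous_on {0..t} (\<lambda>r. l r - blinfun_apply A (y r))"
    using lipschitz_on_continuous_on[OF force_lip] by (rule continuous_on_subset) (use st in auto)
  then have i: "set_integrable lebesgue {0..t} (\<lambda>r. blinfun_apply (l r - blinfun_apply A (y r)) (v r))"
    using has_deriv_aeD(3)[OF v order_refl st(3)] by (rule set_integrable_bilinear[OF bounded_bilinear_blinfun_apply])
  show ?thesis
    using set_integral_combine[OF i st(1,2)] by (simp add: E_def)
qed

text \<open>No strong convergence of velocities is at hand, and \<open>k n\<close> converges at each
  fixed time only. On a short interval both integrals are replaced by the quadrature at the left
  end, which converges as a weak-strong pairing; the error is quadratic in the length, uniformly in
  \<open>n\<close>.\<close>

lemma work_tendsto:
  assumes t: "t \<in> {0..T}"
  shows "(\<lambda>n. LINT r:{0..t}|lebesgue. blinfun_apply (k n r) (g n r)) \<longlonglongrightarrow> (LINT r:{0..t}|lebesgue. blinfun_apply (l r) (v r))"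
proof -
  define X where "X = (\<lambda>n t. (LINT r:{0..t}|lebesgue. blinfun_apply (k n r) (g n r)) - (LINT r:{0..t}|lebesgue. blinfun_apply (l r) (v r)))"
  obtain R where R: "\<And>n t. t \<in> {0..T} \<Longrightarrow> norm (z n t) \<le> R" using z_bounded by blast
  have si: "set_integrable lebesgue {0..b} (\<lambda>r. blinfun_apply (j r) (p r))"
    if "has_deriv_ae T u p" "continuous_on {0..T} j" "b \<le> T" for u p b and j :: "real \<Rightarrow> 'a dual"
  proof (rule set_integrable_bilinear[OF bounded_bilinear_blinfun_apply])
    show "continuous_on {0..b} j" using that(2) by (rule continuous_on_subset) (use that in auto)
    show "set_integrable lebesgue {0..b} p" using has_deriv_aeD(3)[OF that(1) order_refl that(3)] .
  qed
  have lim: "(\<lambda>n. blinfun_apply (k n a) (z n b - z n a) - blinfun_apply (l a) (y b - y a)) \<longlonglongrightarrow> 0" if ab: "a \<in> {0..T}" "b \<in> {0..T}" for a b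
  proof -
    have "norm (z n b - z n a) \<le> 2 * R" for n
      using R[OF ab(1), of n] R[OF ab(2), of n] norm_triangle_ineq4[of "z n b" "z n a"] by linarith
    then have "(\<lambda>n. blinfun_apply (k n a) (z n b - z n a)) \<longlonglongrightarrow> blinfun_apply (l a) (y b - y a)"
      by (intro weak_strong_pairing[where R = "2 * R"] weakly_tendsto_diff z_lim k_lim ab) simp_all
    then show ?thesis by (rule LIM_zero)
  qed
  have inc: "\<bar>(X n b - X n a) - (blinfun_apply (k n a) (z n b - z n a) - blinfun_apply (l a) (y b - y a))\<bar> \<le> 2 * (L * K) * (b - a)\<^sup>2"
    if ab: "0 \<le> a" "a \<le> b" "b \<le> T" for n a b
  proof -
    have a: "a \<in> {a..b}" using ab by simp
    have 1: "(LINT r:{0..b}|lebesgue. blinfun_apply (k n r) (g n r)) = (LINT r:{0..a}|lebesgue. blinfun_apply (k n r) (g n r))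
        + (LINT r:{a..b}|lebesgue. blinfun_apply (k n r) (g n r))"
      using ab by (intro set_integral_combine si[OF z_deriv k_cont]) auto
    have 2: "(LINT r:{0..b}|lebesgue. blinfun_apply (l r) (v r)) = (LINT r:{0..a}|lebesgue. blinfun_apply (l r) (v r))
        + (LINT r:{a..b}|lebesgue. blinfun_apply (l r) (v r))"
      using ab by (intro set_integral_combine si[OF v l_cont]) auto
    show ?thesis
      using pairing_quadrature[OF z_deriv[of n] g_bound[of n] k_lip[of n] ab a] pairing_quadrature[OF v v_bound l_lip ab a]
      unfolding X_def 1 2 by linarith
  qed
  have fine: "\<exists>d>0. \<forall>a b. 0 \<le> a \<longrightarrow> a \<le> b \<longrightarrow> b \<le> t \<longrightarrow> b - a < d \<longrightarrow>
      (\<forall>\<eta>>0. eventually (\<lambda>n. \<bar>X n b - X n a\<bar> \<le> e * (b - a) + \<eta>) sequentially)" if e: "0 < e" for e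
  proof (intro exI[of _ "e / (2 * (L * K) + 1)"] conjI allI impI)
    have LK: "0 \<le> 2 * (L * K)" using L0 K0 by simp
    then show "0 < e / (2 * (L * K) + 1)" using e by simp
    fix a b \<eta> :: real assume ab: "0 \<le> a" "a \<le> b" "b \<le> t" "b - a < e / (2 * (L * K) + 1)" and \<eta>: "0 < \<eta>"
    have ab': "0 \<le> a" "a \<le> b" "b \<le> T" "a \<in> {0..T}" "b \<in> {0..T}" using ab t by auto
    have "2 * (L * K) * (b - a) \<le> (2 * (L * K) + 1) * (b - a)" using ab by (intro mult_right_mono) auto
    also have "\<dots> \<le> (2 * (L * K) + 1) * (e / (2 * (L * K) + 1))" using ab LK by (intro mult_left_mono) auto
    also have "\<dots> = e" using LK by simp
    finally have "2 * (L * K) * (b - a) * (b - a) \<le> e * (b - a)" using ab by (intro mult_right_mono) auto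
    then have small: "2 * (L * K) * (b - a)\<^sup>2 \<le> e * (b - a)" by (simp add: power2_eq_square mult_ac)
    have "eventually (\<lambda>n. \<bar>blinfun_apply (k n a) (z n b - z n a) - blinfun_apply (l a) (y b - y a)\<bar> < \<eta>) sequentially"
      using tendstoD[OF lim[OF ab'(4,5)] \<eta>] by (simp add: dist_real_def)
    then show "eventually (\<lambda>n. \<bar>X n b - X n a\<bar> \<le> e * (b - a) + \<eta>) sequentially"
    proof eventually_elim
      case (elim n)
      then show ?case using inc[OF ab'(1-3), of n] small by linarith
    qed
  qed
  have X0: "X n 0 = 0" for n
    using set_integral_Icc_singleton[OF si[OF z_deriv k_cont, of 0 n]] set_integral_Icc_singleton[OF si[OF v l_cont, of 0]] T
    by (simp add: X_def)
  have t0: "0 \<le> t" using t by simp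
  \<comment> \<open>\<open>fine_limit_le\<close> is one-sided; the signs \<open>1\<close> and
    \<open>- 1\<close> give both bounds.\<close>
  have signed: "eventually (\<lambda>n. \<sigma> * X n t - \<sigma> * X n 0 \<le> e) sequentially" if \<sigma>: "\<bar>\<sigma>\<bar> = 1" and e: "0 < e" for \<sigma> e
  proof (rule fine_limit_le[OF t0 _ e, of "\<lambda>n t. \<sigma> * X n t"])
    fix e' :: real assume "0 < e'"
    from fine[OF this] obtain d where d: "0 < d" "\<forall>a b. 0 \<le> a \<longrightarrow> a \<le> b \<longrightarrow> b \<le> t \<longrightarrow> b - a < d \<longrightarrow>
      (\<forall>\<eta>>0. eventually (\<lambda>n. \<bar>X n b - X n a\<bar> \<le> e' * (b - a) + \<eta>) sequentially)" by (elim exE conjE)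
    show "\<exists>d>0. \<forall>a b. 0 \<le> a \<longrightarrow> a \<le> b \<longrightarrow> b \<le> t \<longrightarrow> b - a < d \<longrightarrow>
      (\<forall>\<eta>>0. eventually (\<lambda>n. \<sigma> * X n b - \<sigma> * X n a \<le> e' * (b - a) + \<eta>) sequentially)"
    proof (intro exI[of _ d] conjI allI impI)
      fix a b \<eta> :: real assume "0 \<le> a" "a \<le> b" "b \<le> t" "b - a < d" "0 < \<eta>"
      with d(2) have "eventually (\<lambda>n. \<bar>X n b - X n a\<bar> \<le> e' * (b - a) + \<eta>) sequentially" by blast
      then show "eventually (\<lambda>n. \<sigma> * X n b - \<sigma> * X n a \<le> e' * (b - a) + \<eta>) sequentially"
      proof eventually_elim
        case (elim n)
        have "\<sigma> * X n b - \<sigma> * X n a \<le> \<bar>\<sigma> * (X n b - X n a)\<bar>" by (simp add: algebra_simps)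
        also have "\<dots> = \<bar>X n b - X n a\<bar>" using \<sigma> by (simp add: abs_mult)
        finally show ?case using elim by linarith
      qed
    qed (rule d)
  qed
  have "(\<lambda>n. X n t) \<longlonglongrightarrow> 0"
  proof (rule tendstoI)
    fix e :: real assume "0 < e"
    then have e2: "0 < e / 2" by simp
    have "eventually (\<lambda>n. 1 * X n t - 1 * X n 0 \<le> e / 2) sequentially"
      "eventually (\<lambda>n. - 1 * X n t - - 1 * X n 0 \<le> e / 2) sequentially"
      by (rule signed[OF _ e2], simp)+
    then show "eventually (\<lambda>n. dist (X n t) 0 < e) sequentially"
    proof eventually_elim
      case (elim n)
      then show ?case using \<open>0 < e\<close> X0[of n] unfolding dist_real_def by linarith
    qed
  qed
  then show ?thesis unfolding X_def by (rule LIM_zero_cancel)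
qed

lemma D_eq: "t \<in> {0..T} \<Longrightarrow> D n t = (LINT r:{0..t}|lebesgue. blinfun_apply (k n r) (g n r)) - phi A (z n t) + phi A (z n 0)"
  unfolding D_def by (rule power_split[OF z_deriv k_cont]) auto

lemma E_eq: "t \<in> {0..T} \<Longrightarrow> E t = (LINT r:{0..t}|lebesgue. blinfun_apply (l r) (v r)) - phi A (y t) + phi A (y 0)"
  unfolding E_def by (rule power_split[OF v l_cont]) auto

text \<open>\<open>D n t\<close> is bounded, because the work converges and \<open>phi\<close> is
  bounded along the solutions. It dominates \<open>f n\<close> at the increment, and the Mosco lower
  bound hands finiteness to \<open>\<psi>\<close>. This makes the recovery sequence in
  \<open>phi_lower\<close> useful.\<close>

lemma limit_increment_finite:
  assumes t: "t \<in> {0..T}"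
  shows "y t - y 0 \<in> eff_dom \<psi>"
proof -
  have t0: "0 \<in> {0..T}" using T by simp
  obtain R where R: "0 \<le> R" "\<And>n t. t \<in> {0..T} \<Longrightarrow> norm (z n t) \<le> R" using z_bounded by blast
  obtain B where B: "\<And>n. norm (LINT r:{0..t}|lebesgue. blinfun_apply (k n r) (g n r)) \<le> B"
    using convergent_imp_Bseq[OF convergentI[OF work_tendsto[OF t]]] unfolding Bseq_def by auto
  have phi_le: "\<bar>phi A (z n s)\<bar> \<le> norm A * R * R" if s: "s \<in> {0..T}" for n s
  proof -
    have "\<bar>blinfun_apply (blinfun_apply A (z n s)) (z n s)\<bar> \<le> norm (blinfun_apply A (z n s)) * norm (z n s)"
      using norm_blinfun[of "blinfun_apply A (z n s)" "z n s"] by simp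
    also have "\<dots> \<le> (norm A * norm (z n s)) * norm (z n s)"
      by (intro mult_right_mono norm_blinfun) auto
    also have "\<dots> \<le> (norm A * R) * R"
      using R s by (intro mult_mono) auto
    finally show ?thesis by (simp add: phi_def)
  qed
  define c where "c = B + 2 * (norm A * R * R)"
  have D_le: "D n t \<le> c" for n
    using B[of n] phi_le[OF t, of n] phi_le[OF t0, of n] unfolding D_eq[OF t] c_def real_norm_def by linarith
  have D0: "D n 0 = 0" for n
    using D_eq[OF t0, of n] set_integral_Icc_singleton[of 0 "\<lambda>r. blinfun_apply (k n r - blinfun_apply A (z n r)) (g n r)"]
      evolution_power_integrable[OF f T k_cont sym z, of 0 0 n] T by (simp add: D_def)
  have "\<not> ereal c < \<psi> (y t - y 0)"
  proof
    assume "ereal c < \<psi> (y t - y 0)"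
    then have "eventually (\<lambda>n. ereal c < f n (z n t - z n 0)) sequentially"
      by (rule lower[OF weakly_tendsto_diff[OF z_lim[OF t] z_lim[OF t0]]])
    from eventually_happens[OF this] obtain n where "ereal c < f n (z n t - z n 0)" by auto
    also have "\<dots> \<le> ereal (D n t - D n 0)" using t by (intro increment_le_D) auto
    finally show False using D_le[of n] by (simp add: D0)
  qed
  then show ?thesis by (auto simp: eff_dom_def not_less intro: le_less_trans)
qed

text \<open>\<open>\<phi>\<close> is not convex on the whole space. It is expanded around a strong approximation \<open>a\<^sub>n\<close> of \<open>y(t)\<close> with
  \<open>z\<^sub>n(t) - a\<^sub>n \<in> C\<^sub>h - C\<^sub>h\<close>, where the quadratic remainder is nonnegative.\<close>

lemma phi_lower:
  assumes t: "t \<in> {0..T}" and \<eta>: "0 < \<eta>"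
  shows "eventually (\<lambda>n. phi A (y t) - \<eta> \<le> phi A (z n t)) sequentially"
proof -
  have t0: "0 \<in> {0..T}" using T by simp
  obtain R where R: "0 \<le> R" "\<And>n t. t \<in> {0..T} \<Longrightarrow> norm (z n t) \<le> R" using z_bounded by blast
  obtain c where c: "c \<longlonglongrightarrow> y t - y 0" "eventually (\<lambda>n. f n (c n) < \<infinity>) sequentially"
    using recovery[of "y t - y 0"] limit_increment_finite[OF t] by (auto simp: eff_dom_def)
  \<comment> \<open>\<open>c\<close> recovers the increment of \<open>y\<close> from time
    \<open>0\<close>. Eventually both \<open>z n t - z n 0\<close> and \<open>c n\<close> lie in the
    effective domain of \<open>f n\<close>, so their difference \<open>z n t - a n\<close> is
    covered by coercivity.\<close>
  define a where "a = (\<lambda>n. z n 0 + c n)"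
  have a: "a \<longlonglongrightarrow> y t"
    using tendsto_add[OF z_init c(1)] y_init by (simp add: a_def)
  have expand: "phi A x = phi A b + blinfun_apply (blinfun_apply A b) (x - b) + phi A (x - b)" for x b
    by (simp add: phi_def blinfun.diff_left blinfun.diff_right sym[of x b] field_simps)
  have pos: "eventually (\<lambda>n. 0 \<le> phi A (z n t - a n)) sequentially"
    using c(2)
  proof eventually_elim
    case (elim n)
    have "f n (z n t - z n 0) \<le> ereal (D n t - D n 0)" using t by (intro increment_le_D) auto
    then have "z n t - z n 0 \<in> eff_dom (f n)" by (auto simp: eff_dom_def intro: le_less_trans)
    then have "\<alpha> / 2 * (norm (z n t - z n 0 - c n))\<^sup>2 \<le> phi A (z n t - z n 0 - c n)"
      by (rule coercive) (use elim in \<open>simp add: eff_dom_def\<close>)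
    moreover have "0 \<le> \<alpha> / 2 * (norm (z n t - z n 0 - c n))\<^sup>2" using \<alpha> by simp
    ultimately show ?case by (simp add: a_def diff_diff_eq)
  qed
  have "(\<lambda>n. blinfun_apply (blinfun_apply A (a n)) (z n t)) \<longlonglongrightarrow> blinfun_apply (blinfun_apply A (y t)) (y t)"
    using R(2)[OF t] by (intro weak_strong_pairing[OF z_lim[OF t], where R = R] blinfun.tendsto tendsto_const a) auto
  moreover have "(\<lambda>n. blinfun_apply (blinfun_apply A (a n)) (a n)) \<longlonglongrightarrow> blinfun_apply (blinfun_apply A (y t)) (y t)"
    by (intro blinfun.tendsto tendsto_const a)
  moreover have "(\<lambda>n. phi A (a n)) \<longlonglongrightarrow> phi A (y t)"
    unfolding phi_def by (intro tendsto_mult blinfun.tendsto tendsto_const a)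
  ultimately have "(\<lambda>n. phi A (a n) + (blinfun_apply (blinfun_apply A (a n)) (z n t) - blinfun_apply (blinfun_apply A (a n)) (a n)))
      \<longlonglongrightarrow> phi A (y t) + (blinfun_apply (blinfun_apply A (y t)) (y t) - blinfun_apply (blinfun_apply A (y t)) (y t))"
    by (intro tendsto_add tendsto_diff)
  then have "eventually (\<lambda>n. phi A (y t) - \<eta> < phi A (a n) + (blinfun_apply (blinfun_apply A (a n)) (z n t) - blinfun_apply (blinfun_apply A (a n)) (a n))) sequentially"
    using \<eta> by (intro order_tendstoD(1)) auto
  with pos show ?thesis
  proof eventually_elim
    case (elim n)
    then show ?case using expand[of "z n t" "a n"] by (simp add: blinfun.diff_right)
  qed
qed

text \<open>The work and the initial energy converge; \<open>phi A (z n t)\<close> enters with a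
  minus sign, so its asymptotic lower bound suffices.\<close>

lemma D_upper:
  assumes t: "t \<in> {0..T}" and \<eta>: "0 < \<eta>"
  shows "eventually (\<lambda>n. D n t \<le> E t + \<eta>) sequentially"
proof -
  have t0: "0 \<in> {0..T}" using T by simp
  have "(\<lambda>n. (LINT r:{0..t}|lebesgue. blinfun_apply (k n r) (g n r)) + phi A (z n 0))
      \<longlonglongrightarrow> (LINT r:{0..t}|lebesgue. blinfun_apply (l r) (v r)) + phi A (y 0)"
    unfolding phi_def y_init by (intro tendsto_add work_tendsto t tendsto_mult blinfun.tendsto tendsto_const z_init)
  then have "eventually (\<lambda>n. (LINT r:{0..t}|lebesgue. blinfun_apply (k n r) (g n r)) + phi A (z n 0)
      < (LINT r:{0..t}|lebesgue. blinfun_apply (l r) (v r)) + phi A (y 0) + \<eta> / 2) sequentially"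
    using \<eta> by (intro order_tendstoD(2)) auto
  moreover have "eventually (\<lambda>n. phi A (y t) - \<eta> / 2 \<le> phi A (z n t)) sequentially"
    using \<eta> by (intro phi_lower t) simp
  ultimately show ?thesis
    by eventually_elim (simp add: D_eq[OF t] E_eq[OF t])
qed

lemma E_increment_le:
  assumes st: "0 \<le> s" "s \<le> t" "t \<le> T"
  shows "\<bar>(E t - E s) - blinfun_apply (l s - blinfun_apply A (y s)) (y t - y s)\<bar> \<le> C * K * (t - s)\<^sup>2"
  unfolding E_diff[OF st] using pairing_quadrature[OF v v_bound force_lip st, of s] st by simp

text \<open>On a short interval the increment of \<open>E\<close> is, up to a quadratic error, the
  force at the left end paired with \<open>y b - y a\<close>. Stability of the limit bounds this by
  \<open>\<psi> (y b - y a)\<close>, and the Mosco lower bound leads on to the increments of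
  \<open>D n\<close>; \<open>fine_limit_le\<close> sums the estimates.\<close>

lemma D_lower:
  assumes t: "t \<in> {0..T}" and \<eta>: "0 < \<eta>"
  shows "eventually (\<lambda>n. E t - \<eta> \<le> D n t) sequentially"
proof -
  have t0: "0 \<le> t" using t by simp
  have CK: "0 \<le> C * K" using K0 lipschitz_on_nonneg[OF force_lip] by simp
  have "eventually (\<lambda>n. (E t - D n t) - (E 0 - D n 0) \<le> \<eta>) sequentially"
  proof (rule fine_limit_le[OF t0 _ \<eta>, of "\<lambda>n t. E t - D n t"])
    fix e :: real assume e: "0 < e"
    show "\<exists>d>0. \<forall>a b. 0 \<le> a \<longrightarrow> a \<le> b \<longrightarrow> b \<le> t \<longrightarrow> b - a < d \<longrightarrow>
      (\<forall>\<eta>>0. eventually (\<lambda>n. (E b - D n b) - (E a - D n a) \<le> e * (b - a) + \<eta>) sequentially)"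
    proof (intro exI[of _ "e / (C * K + 1)"] conjI allI impI)
      show "0 < e / (C * K + 1)" using e CK by simp
      fix a b \<eta> :: real assume ab: "0 \<le> a" "a \<le> b" "b \<le> t" "b - a < e / (C * K + 1)" and \<eta>: "0 < \<eta>"
      have ab': "0 \<le> a" "a \<le> b" "b \<le> T" "a \<in> {0..T}" "b \<in> {0..T}" using ab t by auto
      have "C * K * (b - a) \<le> (C * K + 1) * (b - a)" using ab by (intro mult_right_mono) auto
      also have "\<dots> \<le> (C * K + 1) * (e / (C * K + 1))" using ab CK by (intro mult_left_mono) auto
      also have "\<dots> = e" using CK by simp
      finally have "C * K * (b - a) * (b - a) \<le> e * (b - a)" using ab by (intro mult_right_mono) auto
      then have small: "C * K * (b - a)\<^sup>2 \<le> e * (b - a)" by (simp add: power2_eq_square mult_ac)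
      let ?p = "blinfun_apply (l a - blinfun_apply A (y a)) (y b - y a)"
      \<comment> \<open>The Mosco lower bound needs a strict inequality, which the loss of
        \<open>\<eta>\<close> provides.\<close>
      have "ereal (?p - \<eta>) < ereal ?p" using \<eta> by simp
      also have "\<dots> \<le> \<psi> (y b - y a)" by (rule limit_stable[OF ab'(4)])
      finally have "eventually (\<lambda>n. ereal (?p - \<eta>) < f n (z n b - z n a)) sequentially"
        by (rule lower[OF weakly_tendsto_diff[OF z_lim[OF ab'(5)] z_lim[OF ab'(4)]]])
      then show "eventually (\<lambda>n. (E b - D n b) - (E a - D n a) \<le> e * (b - a) + \<eta>) sequentially"
      proof eventually_elim
        case (elim n)
        then have "ereal (?p - \<eta>) < ereal (D n b - D n a)"
          using increment_le_D[OF ab'(1-3), of n] by (rule less_le_trans)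
        then show ?case using E_increment_le[OF ab'(1-3)] small by simp
      qed
    qed
  qed
  moreover have "D n 0 = 0" for n
    using set_integral_Icc_singleton[of 0 "\<lambda>r. blinfun_apply (k n r - blinfun_apply A (z n r)) (g n r)"]
      evolution_power_integrable[OF f T k_cont sym z, of 0 0 n] T by (simp add: D_def)
  moreover have "E 0 = 0"
    using E_eq[of 0] set_integral_Icc_singleton[of 0 "\<lambda>r. blinfun_apply (l r) (v r)"]
      set_integrable_bilinear[OF bounded_bilinear_blinfun_apply, of 0 0 l v] has_deriv_aeD(3)[OF v, of 0 0] T by simp
  ultimately show ?thesis by (elim eventually_mono) simp
qed

text \<open>An upper bound for \<open>D n t - D n s\<close> needs an upper bound at \<open>t\<close>
  and a lower bound at \<open>s\<close>; here the two one-sided limits of the dissipated energies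
  meet.\<close>

lemma increment_le_E:
  assumes st: "0 \<le> s" "s \<le> t" "t \<le> T"
  shows "\<psi> (y t - y s) \<le> ereal (E t - E s)"
proof (rule ereal_le_of_all_less)
  fix c assume c: "ereal c < \<psi> (y t - y s)"
  have st': "s \<in> {0..T}" "t \<in> {0..T}" using st by auto
  show "c \<le> E t - E s"
  proof (rule field_le_epsilon)
    fix \<eta> :: real assume "0 < \<eta>"
    then have \<eta>: "0 < \<eta> / 2" by simp
    have "eventually (\<lambda>n. ereal c < f n (z n t - z n s)) sequentially"
      by (rule lower[OF weakly_tendsto_diff[OF z_lim[OF st'(2)] z_lim[OF st'(1)]] c])
    with D_upper[OF st'(2) \<eta>] D_lower[OF st'(1) \<eta>]
    have "eventually (\<lambda>n. c \<le> E t - E s + \<eta>) sequentially"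
    proof eventually_elim
      case (elim n)
      have "ereal c < ereal (D n t - D n s)"
        using elim(3) increment_le_D[OF st, of n] by (rule less_le_trans)
      then show ?case using elim by simp
    qed
    then show "c \<le> E t - E s + \<eta>" by simp
  qed
qed

end

text \<open>The increment inequality over the dyadic cell around \<open>t\<close>, divided by the
  cell length, bounds \<open>\<psi>\<close> at the quotient by its pairing with the force, up to an
  error of order \<open>T / 2 ^ n\<close>. Where the quotients converge weakly, weak lower
  semicontinuity gives one half of the power identity; the other half is stability tested with
  \<open>v t\<close>.\<close>

theorem limit_evolution: "\<exists>v. evolution T \<psi> A l y v"
proof -
  obtain v r where r: "strict_mono r" and v: "has_deriv_ae T y v" and "\<And>t. norm (v t) \<le> K" and q:
    "AE t in lebesgue. t \<in> {0..<T} \<longrightarrow> weakly_tendsto (\<lambda>k. dyadic_quotient T y (r k) t) (v t) sequentially"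
    by (rule lipschitz_imp_has_deriv_ae[OF refl T y_lip]) blast
  let ?w = "\<lambda>t. l t - blinfun_apply A (y t)"
  have flow: "\<psi> (v t) = ereal (blinfun_apply (?w t) (v t))"
    if t: "t \<in> {0<..<T}" and lim: "weakly_tendsto (\<lambda>k. dyadic_quotient T y (r k) t) (v t) sequentially" for t
  proof (rule antisym)
    have t': "0 \<le> t" "t < T" "t \<in> {0..T}" using t by auto
    show "ereal (blinfun_apply (?w t) (v t)) \<le> \<psi> (v t)" by (rule limit_stable[OF t'(3)])
    have "(\<lambda>k. blinfun_apply (?w t) (dyadic_quotient T y (r k) t)) \<longlonglongrightarrow> blinfun_apply (?w t) (v t)"
      using lim unfolding weakly_tendsto_def by blast
    moreover have "(\<lambda>k. C * K * (T / 2 ^ r k)) \<longlonglongrightarrow> 0"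
    proof -
      have "(\<lambda>n. C * K * (T / 2 ^ n)) \<longlonglongrightarrow> C * K * 0"
        by (intro tendsto_mult tendsto_const) (simp add: LIMSEQ_divide_realpow_zero)
      from LIMSEQ_subseq_LIMSEQ[OF this r] show ?thesis by (simp add: o_def)
    qed
    ultimately have lim': "(\<lambda>k. blinfun_apply (?w t) (dyadic_quotient T y (r k) t) + C * K * (T / 2 ^ r k)) \<longlonglongrightarrow> blinfun_apply (?w t) (v t) + 0"
      by (rule tendsto_add)
    have "\<psi> (dyadic_quotient T y n t) \<le> ereal (blinfun_apply (?w t) (dyadic_quotient T y n t) + C * K * (T / 2 ^ n))" for n
    proof -
      obtain a b where ab: "0 \<le> a" "a \<le> t" "t < b" "b \<le> T" "b - a = T / 2 ^ n"
        and dq: "dyadic_quotient T y n t = (1 / (b - a)) *\<^sub>R (y b - y a)"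
        using dyadic_quotient_tag[OF T t'(1,2)] by metis
      have ba: "0 < b - a" using ab by simp
      have "\<psi> (y b - y a) \<le> ereal (E v b - E v a)" using ab by (intro increment_le_E[OF v]) auto
      also have "E v b - E v a \<le> blinfun_apply (?w t) (y b - y a) + C * K * (b - a)\<^sup>2"
      proof -
        \<comment> \<open>The quadrature is tagged at \<open>t\<close> itself, so the force in the
          bound is the one at time \<open>t\<close> for every cell size.\<close>
        have ab': "a \<le> b" "t \<in> {a..b}" using ab by auto
        show ?thesis
          using pairing_quadrature[OF v v_bound[OF v] force_lip[OF v] ab(1) ab'(1) ab(4) ab'(2)]
          unfolding E_diff[OF v ab(1) ab'(1) ab(4)] by linarith
      qed
      finally have "ereal (1 / (b - a)) * \<psi> (y b - y a) \<le> ereal (1 / (b - a)) * ereal (blinfun_apply (?w t) (y b - y a) + C * K * (b - a)\<^sup>2)"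
        using ba by (intro ereal_mult_left_mono) auto
      also have "\<dots> = ereal (blinfun_apply (?w t) ((1 / (b - a)) *\<^sub>R (y b - y a)) + C * K * (b - a))"
        using ba by (simp add: blinfun.scaleR_right add_divide_distrib power2_eq_square)
      also have "ereal (1 / (b - a)) * \<psi> (y b - y a) = \<psi> ((1 / (b - a)) *\<^sub>R (y b - y a))"
        using closed_sublinear_scale[OF \<psi>, of "1 / (b - a)"] ba by simp
      finally show ?thesis unfolding dq ab(5) .
    qed
    then show "\<psi> (v t) \<le> ereal (blinfun_apply (?w t) (v t))"
      using closed_sublinear_weakly_lsc[OF \<psi> lim lim'] by simp
  qed
  have "AE t in Leb T. \<psi> (v t) = ereal (blinfun_apply (?w t) (v t))"
    unfolding AE_lebesgue_on_Ioo_iff using q by eventually_elim (use flow in auto)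
  then show ?thesis
    using v limit_stable by (intro exI[of _ v]) (auto simp: evolution_def stable_def)
qed

end

section \<open>Compactness and Mosco convergence along sequences\<close>

text \<open>One diagonal subsequence makes countably many scalar sequences converge, one for each
  pair of a norming functional and a rational time, the pairs being coded by
  \<open>prod_decode\<close>. The common Lipschitz constant extends convergence to all times, and
  reflexivity supplies the weak limits.\<close>

lemma weak_Arzela_Ascoli:
  fixes z :: "nat \<Rightarrow> real \<Rightarrow> 'a::{real_normed_vector, second_countable_topology}"
  assumes refl: "reflexive_space TYPE('a)" and T: "0 < T" and lip: "\<And>n. K-lipschitz_on {0..T} (z n)"
    and R: "\<And>n t. t \<in> {0..T} \<Longrightarrow> norm (z n t) \<le> R"
  shows "\<exists>r y. strict_mono (r :: nat \<Rightarrow> nat) \<and> (\<forall>t\<in>{0..T}. weakly_tendsto (\<lambda>k. z (r k) t) (y t) sequentially)"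
proof -
  obtain W :: "nat \<Rightarrow> 'a dual" where W: "norming_sequence W" by (rule norming_sequence_exists)
  have W1: "norm (W i) \<le> 1" for i using W by (simp add: norming_sequence_def)
  have K: "0 \<le> K" using lip by (rule lipschitz_on_nonneg)
  define Q where "Q = \<rat> \<inter> {0..T}"
  have "0 \<in> Q" using T by (simp add: Q_def)
  moreover have "countable Q" unfolding Q_def using countable_rat by blast
  ultimately have rangeQ: "range (from_nat_into Q) = Q" by (intro range_from_nat_into) auto
  define x where "x = (\<lambda>m n. blinfun_apply (W (fst (prod_decode m))) (z n (from_nat_into Q (snd (prod_decode m)))))"
  define P where "P = (\<lambda>m s. convergent (\<lambda>k. x m (s k)))"
  interpret subseqs P
  proof
    fix m :: nat and s :: "nat \<Rightarrow> nat"
    have q: "from_nat_into Q (snd (prod_decode m)) \<in> {0..T}"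
      using rangeQ by (auto simp: Q_def)
    have "\<bar>x m n\<bar> \<le> R" for n
      unfolding x_def using blinfun_apply_le_norm[OF W1] R[OF q] by (rule order_trans)
    then have "bounded (range (\<lambda>k. x m (s k)))" by (intro boundedI[of _ R]) auto
    then obtain c r where "strict_mono (r :: nat \<Rightarrow> nat)" "((\<lambda>k. x m (s k)) \<circ> r) \<longlonglongrightarrow> c"
      using bounded_imp_convergent_subsequence by blast
    then show "\<exists>r'. strict_mono r' \<and> P m (s \<circ> r')"
      unfolding P_def o_def by (intro exI[of _ r]) (auto intro: convergentI)
  qed
  define r where "r = diagseq"
  have conv: "convergent (\<lambda>k. x m (r k))" for m
  proof -
    have "P m (diagseq \<circ> (+) (Suc m))"
    proof (rule diagseq_holds)
      fix r' s n assume r': "strict_mono (r' :: nat \<Rightarrow> nat)" and "P n s"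
      then show "P n (s \<circ> r')"
        using convergent_subseq_convergent[OF _ r', of "\<lambda>k. x n (s k)"] by (simp add: P_def o_def)
    qed
    then have "convergent (\<lambda>k. x m ((diagseq \<circ> (+) (Suc m)) k))" by (simp add: P_def)
    then show ?thesis
      using convergent_ignore_initial_segment[of "\<lambda>k. x m (diagseq k)" "Suc m"]
      by (simp only: r_def o_def add.commute[of "Suc m"])
  qed
  have "\<exists>y. weakly_tendsto (\<lambda>k. z (r k) t) y sequentially" if t: "t \<in> {0..T}" for t
  proof (rule bounded_weakly_convergent[OF refl W])
    show "norm (z (r k) t) \<le> R" for k by (rule R[OF t])
    fix i
    have "Cauchy (\<lambda>k. blinfun_apply (W i) (z (r k) t))"
    proof (rule metric_CauchyI)
      fix e :: real assume e: "0 < e"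
      define d where "d = e / (3 * (K + 1))"
      have d: "0 < d" using e K by (simp add: d_def)
      have Kd: "K * d \<le> e / 3"
      proof -
        have "K * d \<le> (K + 1) * d" using d by simp
        also have "\<dots> = e / 3" unfolding d_def using K by (simp add: field_simps)
        finally show ?thesis .
      qed
      \<comment> \<open>The cut at \<open>0\<close> and \<open>T\<close> leaves a nonempty interval
        inside the domain also when \<open>t\<close> is an end point.\<close>
      have "max 0 (t - d) < min T (t + d)" using t T d by auto
      then obtain q where q: "q \<in> \<rat>" "max 0 (t - d) < q" "q < min T (t + d)"
        using Rats_dense_in_real by blast
      then have qQ: "q \<in> Q" by (simp add: Q_def)
      then obtain j where j: "q = from_nat_into Q j" using rangeQ by blast
      have near: "\<bar>blinfun_apply (W i) (z n t) - blinfun_apply (W i) (z n q)\<bar> \<le> e / 3" for n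
      proof -
        have "\<bar>blinfun_apply (W i) (z n t - z n q)\<bar> \<le> norm (z n t - z n q)"
          by (rule blinfun_apply_le_norm[OF W1])
        also have "\<dots> \<le> K * \<bar>t - q\<bar>"
          using lipschitz_onD[OF lip t, of q n] qQ by (simp add: dist_norm Q_def)
        also have "\<dots> \<le> K * d" using q K by (intro mult_left_mono) (auto simp: abs_le_iff)
        finally show ?thesis using Kd by (simp add: blinfun.diff_right)
      qed
      have "convergent (\<lambda>k. blinfun_apply (W i) (z (r k) q))"
        using conv[of "prod_encode (i, j)"] by (simp add: x_def j)
      then have "Cauchy (\<lambda>k. blinfun_apply (W i) (z (r k) q))" by (rule convergent_Cauchy)
      then obtain N where N: "\<And>m n. N \<le> m \<Longrightarrow> N \<le> n \<Longrightarrow>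
          dist (blinfun_apply (W i) (z (r m) q)) (blinfun_apply (W i) (z (r n) q)) < e / 3"
        using e metric_CauchyD[of _ "e / 3"] by (metis zero_less_divide_iff zero_less_numeral)
      have "dist (blinfun_apply (W i) (z (r m) t)) (blinfun_apply (W i) (z (r n) t)) < e" if "N \<le> m" "N \<le> n" for m n
        using near[of "r m"] near[of "r n"] N[OF that] unfolding dist_real_def by linarith
      then show "\<exists>N. \<forall>m\<ge>N. \<forall>n\<ge>N. dist (blinfun_apply (W i) (z (r m) t)) (blinfun_apply (W i) (z (r n) t)) < e"
        by blast
    qed
    then show "convergent (\<lambda>k. blinfun_apply (W i) (z (r k) t))" by (simp add: Cauchy_convergent)
  qed
  then obtain y where "\<And>t. t \<in> {0..T} \<Longrightarrow> weakly_tendsto (\<lambda>k. z (r k) t) (y t) sequentially" by metis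
  then show ?thesis using subseq_diagseq unfolding r_def by blast
qed

text \<open>A strictly decreasing index sequence is injective, and \<open>h n < h N\<close> forces
  \<open>N \<le> n\<close>. Both facts let a sequence be read as part of a family indexed by the
  positive reals.\<close>

lemma strictly_decreasing_subsequence:
  fixes h :: "nat \<Rightarrow> real"
  assumes pos: "\<And>n. 0 < h n" and lim: "h \<longlonglongrightarrow> 0"
  obtains r :: "nat \<Rightarrow> nat" where "strict_mono r" "\<And>m n. m < n \<Longrightarrow> h (r n) < h (r m)"
proof -
  have "\<exists>r :: nat \<Rightarrow> nat. \<forall>n. True \<and> (r n < r (Suc n) \<and> h (r (Suc n)) < h (r n))"
  proof (rule dependent_nat_choice)
    fix x n :: nat
    have "eventually (\<lambda>m. h m < h x \<and> x < m) sequentially"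
      using order_tendstoD(2)[OF lim pos] eventually_gt_at_top[of x] by eventually_elim auto
    from eventually_happens[OF this] show "\<exists>y. True \<and> (x < y \<and> h y < h x)" by auto
  qed simp
  then obtain r :: "nat \<Rightarrow> nat" where r: "\<And>n. r n < r (Suc n)" "\<And>n. h (r (Suc n)) < h (r n)" by auto
  have dec: "h (r n) < h (r m)" if "m < n" for m n
    using lift_Suc_mono_less[of "\<lambda>n. - h (r n)" m n] r(2) that by simp
  have "strict_mono r" using r(1) by (simp add: strict_mono_Suc_iff)
  from that[OF this dec] show ?thesis .
qed

text \<open>A sequence along \<open>h\<close> is completed to a family on \<open>(0, \<infinity>)\<close> by a recovery family.\<close>

lemma Mosco_lower_sequence:
  fixes fh :: "real \<Rightarrow> 'a::real_normed_vector \<Rightarrow> ereal" and h :: "nat \<Rightarrow> real"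
  assumes M: "Mosco_tendsto fh f (at_right 0)"
    and pos: "\<And>n. 0 < h n" and lim: "h \<longlonglongrightarrow> 0" and dec: "\<And>m n. m < n \<Longrightarrow> h n < h m"
    and u: "weakly_tendsto u x sequentially" and c: "c < f x"
  shows "eventually (\<lambda>n. c < fh (h n) (u n)) sequentially"
proof -
  obtain v :: "real \<Rightarrow> 'a" where v: "(v \<longlongrightarrow> x) (at_right 0)" using M unfolding Mosco_tendsto_def by blast
  have "inj h" using dec by (intro linorder_injI) fastforce
  define U where "U = (\<lambda>s. if s \<in> range h then u (inv h s) else v s)"
  have U_h: "U (h n) = u n" for n using \<open>inj h\<close> by (simp add: U_def)
  have "weakly_tendsto U x (at_right 0)"
    unfolding weakly_tendsto_def
  proof (intro allI tendstoI)
    fix w :: "'a dual" and e :: real assume e: "0 < e"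
    have "eventually (\<lambda>n. dist (blinfun_apply w (u n)) (blinfun_apply w x) < e) sequentially"
      using u e unfolding weakly_tendsto_def by (auto dest: tendstoD)
    then obtain N where N: "\<And>n. N \<le> n \<Longrightarrow> dist (blinfun_apply w (u n)) (blinfun_apply w x) < e"
      unfolding eventually_sequentially by blast
    have "eventually (\<lambda>s. dist (blinfun_apply w (v s)) (blinfun_apply w x) < e) (at_right 0)"
      using e by (intro tendstoD[OF blinfun.tendsto[OF tendsto_const v]])
    moreover have "eventually (\<lambda>s. s \<in> {0<..<h N}) (at_right 0)"
      using pos by (intro eventually_at_right_real)
    ultimately show "eventually (\<lambda>s. dist (blinfun_apply w (U s)) (blinfun_apply w x) < e) (at_right 0)"
    proof eventually_elim
      case (elim s)
      show ?case
      proof (cases "s \<in> range h")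
        case True
        then obtain n where n: "s = h n" by blast
        have "N \<le> n"
        proof (rule ccontr)
          assume "\<not> N \<le> n"
          then have "h N < h n" by (intro dec) simp
          then show False using elim n by simp
        qed
        then show ?thesis using N n U_h by simp
      qed (use elim in \<open>simp add: U_def\<close>)
    qed
  qed
  then have "f x \<le> Liminf (at_right 0) (\<lambda>s. fh s (U s))"
    using M unfolding Mosco_tendsto_def by blast
  then have "eventually (\<lambda>s. c < fh s (U s)) (at_right 0)"
    using c by (intro less_LiminfD) auto
  moreover have "filterlim h (at_right 0) sequentially"
    unfolding filterlim_at using lim pos by (auto intro!: always_eventually simp: less_imp_neq[OF pos, symmetric])
  ultimately have "eventually (\<lambda>n. c < fh (h n) (U (h n))) sequentially"
    unfolding filterlim_iff by blast
  then show ?thesis by (simp add: U_h)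
qed

lemma Mosco_recovery_sequence:
  fixes fh :: "real \<Rightarrow> 'a::real_normed_vector \<Rightarrow> ereal" and h :: "nat \<Rightarrow> real"
  assumes M: "Mosco_tendsto fh f (at_right 0)" and h: "filterlim h (at_right 0) sequentially"
  shows "\<exists>v. v \<longlonglongrightarrow> x \<and> (\<forall>c. f x < c \<longrightarrow> eventually (\<lambda>n. fh (h n) (v n) < c) sequentially)"
proof -
  obtain v where v: "(v \<longlongrightarrow> x) (at_right 0)" "f x = Limsup (at_right 0) (\<lambda>s. fh s (v s))"
    using M unfolding Mosco_tendsto_def by blast
  have "eventually (\<lambda>n. fh (h n) (v (h n)) < c) sequentially" if "f x < c" for c
  proof -
    have "eventually (\<lambda>s. fh s (v s) < c) (at_right 0)" using that v(2) by (intro Limsup_lessD) simp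
    then show ?thesis using h unfolding filterlim_iff by blast
  qed
  then show ?thesis using filterlim_compose[OF v(1) h] by blast
qed

section \<open>Weak star convergence\<close>

text \<open>As in \<open>borel_measurable_bilinear\<close>, second countability is avoided: the
  finite range of \<open>p\<close> reduces the claim to differences with constants.\<close>

lemma norm_diff_simple_measurable:
  fixes g :: "'s \<Rightarrow> 'b::real_normed_vector"
  assumes g: "g \<in> borel_measurable M" and p: "simple_function M p"
  shows "(\<lambda>t. norm (g t - p t)) \<in> borel_measurable M"
proof -
  have "continuous_on UNIV (\<lambda>x. norm (x - c))" for c :: 'b by (intro continuous_intros)
  then have "(\<lambda>t. norm (g t - c)) \<in> borel_measurable M" for c
    using g by (rule borel_measurable_continuous_on)
  moreover have "p \<in> measurable M (count_space (p ` space M))"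
    using p by (auto simp: simple_function_def measurable_count_space_eq2)
  moreover have "countable (p ` space M)" using p by (auto simp: simple_function_def intro: countable_finite)
  ultimately show ?thesis
    by (rule measurable_compose_countable'[of "p ` space M" "\<lambda>c t. norm (g t - c)"])
qed

lemma simple_function_norm_integrable:
  fixes p :: "'s \<Rightarrow> 'b::real_normed_vector"
  assumes p: "simple_function M p" and M: "finite_measure M"
  shows "integrable M (\<lambda>t. norm (p t))"
proof -
  interpret finite_measure M by (rule M)
  have "finite (p ` space M)" using p by (rule simple_functionD)
  then obtain B where B: "\<forall>x\<in>p ` space M. norm x \<le> B"
    using finite_imp_bounded[of "p ` space M"] unfolding bounded_iff by blast
  have "(\<lambda>t. norm (p t)) \<in> borel_measurable M"
    using borel_measurable_simple_function[OF p] by (rule measurable_compose) simp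
  then show ?thesis using B by (intro integrable_const_bound[of _ B]) auto
qed

lemma Bochner_integrable_norm:
  assumes g: "Bochner_integrable M g" and M: "finite_measure M"
  shows "g \<in> borel_measurable M" "integrable M (\<lambda>t. norm (g t))"
    and "\<And>e. 0 < e \<Longrightarrow> \<exists>s. simple_function M s \<and> (\<integral>\<^sup>+t. ennreal (norm (g t - s t)) \<partial>M) < ennreal e"
proof -
  interpret finite_measure M by (rule M)
  obtain s where gm: "g \<in> borel_measurable M" and s: "\<And>i::nat. Bochner_Integration.simple_bochner_integrable M (s i)"
    and lim: "(\<lambda>i. \<integral>\<^sup>+t. ennreal (norm (g t - s i t)) \<partial>M) \<longlonglongrightarrow> 0"
    using g unfolding Bochner_integrable_def Bochner_has_integral_def by auto
  have sf: "simple_function M (s i)" for i using s[of i] by (auto elim: simple_bochner_integrable.cases)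
  show "g \<in> borel_measurable M" by (rule gm)
  show approx: "\<exists>s. simple_function M s \<and> (\<integral>\<^sup>+t. ennreal (norm (g t - s t)) \<partial>M) < ennreal e" if "0 < e" for e
  proof -
    have "eventually (\<lambda>i. (\<integral>\<^sup>+t. ennreal (norm (g t - s i t)) \<partial>M) < ennreal e) sequentially"
      using lim that by (intro order_tendstoD(2)) auto
    from eventually_happens[OF this] show ?thesis using sf by auto
  qed
  obtain p where p: "simple_function M p" "(\<integral>\<^sup>+t. ennreal (norm (g t - p t)) \<partial>M) < ennreal 1"
    using approx[of 1] by auto
  have pm: "(\<lambda>t. norm (p t)) \<in> borel_measurable M"
    using simple_function_norm_integrable[OF p(1) M] by (rule borel_measurable_integrable)
  have nm: "(\<lambda>t. norm (g t)) \<in> borel_measurable M" using gm by (rule measurable_compose) simp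
  have dm: "(\<lambda>t. norm (g t - p t)) \<in> borel_measurable M"
    by (rule norm_diff_simple_measurable[OF gm p(1)])
  have "(\<integral>\<^sup>+t. ennreal (norm (g t - p t)) \<partial>M) < \<infinity>"
    using p(2) by (rule less_trans) simp
  then have di: "integrable M (\<lambda>t. norm (g t - p t))"
    using dm by (intro integrableI_bounded) auto
  show "integrable M (\<lambda>t. norm (g t))"
  proof (rule Bochner_Integration.integrable_bound)
    show "integrable M (\<lambda>t. norm (g t - p t) + norm (p t))"
      using di simple_function_norm_integrable[OF p(1) M] by (rule Bochner_Integration.integrable_add)
    show "AE t in M. norm (norm (g t)) \<le> norm (norm (g t - p t) + norm (p t))"
    proof (rule AE_I2)
      fix t
      show "norm (norm (g t)) \<le> norm (norm (g t - p t) + norm (p t))"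
        using norm_triangle_ineq[of "g t - p t" "p t"] by simp
    qed
  qed (rule nm)
qed

lemma simple_indicator_scaleR:
  assumes "A \<inter> space M \<in> sets M"
  shows "simple_function M (\<lambda>t. indicat_real A t *\<^sub>R w)"
proof -
  have "simple_function M (indicat_real (A \<inter> space M))" using assms by (rule simple_function_indicator)
  then have "simple_function M (\<lambda>t. indicat_real (A \<inter> space M) t *\<^sub>R w)" by (rule simple_function_compose1)
  then show ?thesis by (rule simple_function_cong[THEN iffD1, rotated]) (simp add: indicator_def)
qed

text \<open>A sequence bounded in \<open>L\<^sup>\<infinity>\<close> with a candidate for its limit.
  The bound makes convergence of the pairings stable under \<open>L\<^sup>1\<close> approximation of
  the test function, which reduces weak star convergence to constant functionals on
  intervals.\<close>

locale bounded_family =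
  fixes M :: "'s measure" and R :: real and G :: "nat \<Rightarrow> 's \<Rightarrow> 'a::{banach, second_countable_topology}" and G0 :: "'s \<Rightarrow> 'a"
  assumes finite: "finite_measure M" and R: "0 \<le> R"
    and G: "\<And>n. G n \<in> borel_measurable M" "\<And>n. AE t in M. norm (G n t) \<le> R"
    and G0: "G0 \<in> borel_measurable M" "AE t in M. norm (G0 t) \<le> R"
begin

definition tested :: "('s \<Rightarrow> 'a dual) \<Rightarrow> bool" where
  "tested g \<longleftrightarrow> (\<lambda>n. \<integral>t. blinfun_apply (g t) (G n t) \<partial>M) \<longlonglongrightarrow> (\<integral>t. blinfun_apply (g t) (G0 t) \<partial>M)"

lemma pairing_integrable:
  fixes g :: "'s \<Rightarrow> 'a dual" and H :: "'s \<Rightarrow> 'a"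
  assumes g: "g \<in> borel_measurable M" "integrable M (\<lambda>t. norm (g t))"
    and H: "H \<in> borel_measurable M" "AE t in M. norm (H t) \<le> R"
  shows "integrable M (\<lambda>t. blinfun_apply (g t) (H t))"
proof (rule Bochner_Integration.integrable_bound)
  show "integrable M (\<lambda>t. R * norm (g t))" using g(2) by simp
  show "(\<lambda>t. blinfun_apply (g t) (H t)) \<in> borel_measurable M"
    by (rule borel_measurable_bilinear[OF bounded_bilinear_blinfun_apply g(1) H(1)])
  show "AE t in M. norm (blinfun_apply (g t) (H t)) \<le> norm (R * norm (g t))"
    using H(2)
  proof eventually_elim
    case (elim t)
    have "norm (g t) * norm (H t) \<le> norm (g t) * R" using elim by (intro mult_left_mono) auto
    then show ?case using norm_blinfun[of "g t" "H t"] R by (simp add: mult.commute)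
  qed
qed

lemma simple_borel:
  assumes "simple_function M (p :: 's \<Rightarrow> 'a dual)"
  shows "p \<in> borel_measurable M" "integrable M (\<lambda>t. norm (p t))"
  using borel_measurable_simple_function[OF assms] simple_function_norm_integrable[OF assms finite] by auto

lemma pairing_diff_le:
  fixes g p :: "'s \<Rightarrow> 'a dual" and H :: "'s \<Rightarrow> 'a"
  assumes g: "g \<in> borel_measurable M" "integrable M (\<lambda>t. norm (g t))" and p: "simple_function M p"
    and H: "H \<in> borel_measurable M" "AE t in M. norm (H t) \<le> R"
    and d: "(\<integral>\<^sup>+t. ennreal (norm (g t - p t)) \<partial>M) \<le> ennreal e" and e: "0 \<le> e"
  shows "\<bar>(\<integral>t. blinfun_apply (g t) (H t) \<partial>M) - (\<integral>t. blinfun_apply (p t) (H t) \<partial>M)\<bar> \<le> R * e"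
proof -
  let ?X = "\<lambda>t. blinfun_apply (g t) (H t) - blinfun_apply (p t) (H t)"
  have gi: "integrable M (\<lambda>t. blinfun_apply (g t) (H t))" and pi: "integrable M (\<lambda>t. blinfun_apply (p t) (H t))"
    by (rule pairing_integrable[OF g H], rule pairing_integrable[OF simple_borel[OF p] H])
  have X: "integrable M ?X" using gi pi by (rule Bochner_Integration.integrable_diff)
  have "ennreal (norm (\<integral>t. ?X t \<partial>M)) \<le> (\<integral>\<^sup>+t. ennreal (norm (?X t)) \<partial>M)"
    using X by (rule integral_norm_bound_ennreal)
  also have "\<dots> \<le> (\<integral>\<^sup>+t. ennreal R * ennreal (norm (g t - p t)) \<partial>M)"
  proof (rule nn_integral_mono_AE)
    show "AE t in M. ennreal (norm (?X t)) \<le> ennreal R * ennreal (norm (g t - p t))"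
      using H(2)
    proof eventually_elim
      case (elim t)
      have "norm (?X t) \<le> norm (g t - p t) * norm (H t)"
        using norm_blinfun[of "g t - p t" "H t"] by (simp add: blinfun.diff_left)
      also have "\<dots> \<le> norm (g t - p t) * R" using elim by (intro mult_left_mono) auto
      finally show ?case using R by (simp add: ennreal_mult[symmetric] ennreal_leI mult.commute)
    qed
  qed
  also have "\<dots> = ennreal R * (\<integral>\<^sup>+t. ennreal (norm (g t - p t)) \<partial>M)"
    using norm_diff_simple_measurable[OF g(1) p] by (intro nn_integral_cmult) simp
  also have "\<dots> \<le> ennreal R * ennreal e" using d by (rule mult_left_mono) simp
  finally have "norm (\<integral>t. ?X t \<partial>M) \<le> R * e"
    using R e by (simp add: ennreal_mult[symmetric])
  then show ?thesis using Bochner_Integration.integral_diff[OF gi pi] by simp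
qed

text \<open>Replacing \<open>g\<close> by \<open>p\<close> costs at most \<open>R * d\<close> in
  each of the two pairings, uniformly in \<open>n\<close>.\<close>

lemma tested_approx:
  assumes g: "g \<in> borel_measurable M" "integrable M (\<lambda>t. norm (g t))"
    and approx: "\<And>e. 0 < e \<Longrightarrow> \<exists>p. simple_function M p \<and> tested p \<and> (\<integral>\<^sup>+t. ennreal (norm (g t - p t)) \<partial>M) \<le> ennreal e"
  shows "tested g"
  unfolding tested_def
proof (rule tendstoI)
  fix e :: real assume e: "0 < e"
  define d where "d = e / (3 * (R + 1))"
  have d: "0 < d" using e R by (simp add: d_def)
  have "R * d \<le> (R + 1) * d" using d by simp
  also have "\<dots> = e / 3" unfolding d_def using R by (simp add: field_simps)
  finally have Rd: "R * d \<le> e / 3" .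
  obtain p where p: "simple_function M p" "tested p" "(\<integral>\<^sup>+t. ennreal (norm (g t - p t)) \<partial>M) \<le> ennreal d"
    using approx[OF d] by blast
  have "eventually (\<lambda>n. dist (\<integral>t. blinfun_apply (p t) (G n t) \<partial>M) (\<integral>t. blinfun_apply (p t) (G0 t) \<partial>M) < e / 3) sequentially"
    using p(2) e unfolding tested_def by (intro tendstoD) auto
  then show "eventually (\<lambda>n. dist (\<integral>t. blinfun_apply (g t) (G n t) \<partial>M) (\<integral>t. blinfun_apply (g t) (G0 t) \<partial>M) < e) sequentially"
  proof eventually_elim
    case (elim n)
    have "\<bar>(\<integral>t. blinfun_apply (g t) (G n t) \<partial>M) - (\<integral>t. blinfun_apply (p t) (G n t) \<partial>M)\<bar> \<le> R * d"
      using d by (intro pairing_diff_le[OF g p(1) G p(3)]) simp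
    moreover have "\<bar>(\<integral>t. blinfun_apply (g t) (G0 t) \<partial>M) - (\<integral>t. blinfun_apply (p t) (G0 t) \<partial>M)\<bar> \<le> R * d"
      using d by (intro pairing_diff_le[OF g p(1) G0 p(3)]) simp
    ultimately show ?case using elim Rd unfolding dist_real_def by linarith
  qed
qed

lemma tested_cong_AE:
  assumes "simple_function M g" "simple_function M p" "AE t in M. g t = p t" "tested p"
  shows "tested g"
proof (rule tested_approx[OF simple_borel[OF assms(1)]])
  fix e :: real assume "0 < e"
  have "AE t in M. ennreal (norm (g t - p t)) = 0" using assms(3) by eventually_elim simp
  then have "(\<integral>\<^sup>+t. ennreal (norm (g t - p t)) \<partial>M) = (\<integral>\<^sup>+t. 0 \<partial>M)" by (rule nn_integral_cong_AE)
  then show "\<exists>p. simple_function M p \<and> tested p \<and> (\<integral>\<^sup>+t. ennreal (norm (g t - p t)) \<partial>M) \<le> ennreal e"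
    using assms by (intro exI[of _ p]) simp
qed

lemma tested_sum:
  assumes "finite I" "\<And>i. i \<in> I \<Longrightarrow> simple_function M (p i)" "\<And>i. i \<in> I \<Longrightarrow> tested (p i)"
  shows "tested (\<lambda>t. \<Sum>i\<in>I. p i t)"
proof -
  have eq: "(\<integral>t. blinfun_apply (\<Sum>i\<in>I. p i t) (H t) \<partial>M) = (\<Sum>i\<in>I. \<integral>t. blinfun_apply (p i t) (H t) \<partial>M)"
    if H: "H \<in> borel_measurable M" "AE t in M. norm (H t) \<le> R" for H :: "'s \<Rightarrow> 'a"
    unfolding blinfun.sum_left
    by (intro Bochner_Integration.integral_sum pairing_integrable[OF simple_borel[OF assms(2)] H])
  show ?thesis
    unfolding tested_def eq[OF G] eq[OF G0]
    by (intro tendsto_sum) (use assms(3) in \<open>simp add: tested_def\<close>)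
qed

lemma tested_simple:
  assumes s: "simple_function M s" and ind: "\<And>A w. A \<in> sets M \<Longrightarrow> tested (\<lambda>t. indicat_real A t *\<^sub>R w)"
  shows "tested s"
proof -
  let ?A = "\<lambda>c. s -` {c} \<inter> space M"
  have A: "?A c \<in> sets M" for c using s by (rule simple_functionD)
  have fin: "Finite_Set.finite (s ` space M)" using s by (rule simple_functionD)
  have t: "tested (\<lambda>t. \<Sum>c\<in>s ` space M. indicat_real (?A c) t *\<^sub>R c)"
    by (intro tested_sum fin ind A simple_indicator_scaleR) (use A in auto)
  have eq: "(\<Sum>c\<in>s ` space M. indicat_real (?A c) t *\<^sub>R c) = s t" if "t \<in> space M" for t
  proof -
    have "(\<Sum>c\<in>s ` space M. indicat_real (?A c) t *\<^sub>R c) = (\<Sum>c\<in>s ` space M. if c = s t then c else 0)"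
      using that by (intro sum.cong) (auto simp: indicator_def)
    then show ?thesis using fin that by (simp add: sum.delta)
  qed
  have "(\<integral>t. blinfun_apply (\<Sum>c\<in>s ` space M. indicat_real (?A c) t *\<^sub>R c) (H t) \<partial>M) = (\<integral>t. blinfun_apply (s t) (H t) \<partial>M)" for H
    by (rule Bochner_Integration.integral_cong) (simp_all only: eq)
  then show ?thesis using t unfolding tested_def by simp
qed

lemma tested_Bochner_integrable:
  assumes g: "Bochner_integrable M g" and ind: "\<And>A w. A \<in> sets M \<Longrightarrow> tested (\<lambda>t. indicat_real A t *\<^sub>R w)"
  shows "tested g"
proof (rule tested_approx[OF Bochner_integrable_norm(1,2)[OF g finite]])
  fix e :: real assume "0 < e"
  then obtain s where "simple_function M s" "(\<integral>\<^sup>+t. ennreal (norm (g t - s t)) \<partial>M) < ennreal e"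
    using Bochner_integrable_norm(3)[OF g finite] by blast
  then show "\<exists>p. simple_function M p \<and> tested p \<and> (\<integral>\<^sup>+t. ennreal (norm (g t - p t)) \<partial>M) \<le> ennreal e"
    using tested_simple[OF _ ind] by (intro exI[of _ s]) auto
qed

end

lemma finite_measure_Leb: "finite_measure (Leb T)"
  by (rule finite_measure_lebesgue_on) (rule bounded_set_imp_lmeasurable, auto)

text \<open>Induction over Borel sets: complements by subtraction from an interval containing the
  domain, countable disjoint unions by \<open>L\<^sup>1\<close> approximation with partial unions.
  Lebesgue sets agree with Borel sets up to null sets.\<close>

lemma tested_if_intervals:
  assumes bf: "bounded_family (Leb T) R G G0"
    and Icc: "\<And>w a b. a \<le> b \<Longrightarrow> bounded_family.tested (Leb T) G G0 (\<lambda>t. indicat_real {a..b} t *\<^sub>R w)"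
    and A: "A \<in> sets (Leb T)"
  shows "bounded_family.tested (Leb T) G G0 (\<lambda>t. indicat_real A t *\<^sub>R w)"
proof -
  interpret bounded_family "Leb T" R G G0 by (rule bf)
  interpret finite_measure "Leb T" by (rule finite_measure_Leb)
  have sp: "space (Leb T) = {0<..<T}" by (simp add: space_restrict_space)
  have S: "A \<inter> space (Leb T) \<in> sets (Leb T)" if "A \<in> sets lebesgue" for A
    using that unfolding sp by (subst sets_restrict_space_iff) auto
  have si: "simple_function (Leb T) (\<lambda>t. indicat_real A t *\<^sub>R (w :: 'a dual))" if "A \<in> sets lebesgue" for A w
    by (rule simple_indicator_scaleR[OF S[OF that]])
  have borel: "tested (\<lambda>t. indicat_real A t *\<^sub>R w)" if "A \<in> sets borel" for A w
    using that
  proof (induction rule: borel_set_induct)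
    case empty
    then show ?case by (simp add: tested_def)
  next
    case (interval a b)
    then show ?case by (rule Icc)
  next
    case (compl A)
    \<comment> \<open>This interval contains \<open>{0<..<T}\<close> for either sign of
      \<open>T\<close>, and its end points are ordered as \<open>Icc\<close> demands.\<close>
    have total: "tested (\<lambda>t. indicat_real {min 0 T..max 0 T} t *\<^sub>R w)" by (rule Icc) simp
    have eq: "(\<integral>t. blinfun_apply (indicat_real (- A) t *\<^sub>R w) (H t) \<partial>Leb T)
        = (\<integral>t. blinfun_apply (indicat_real {min 0 T..max 0 T} t *\<^sub>R w) (H t) \<partial>Leb T) - (\<integral>t. blinfun_apply (indicat_real A t *\<^sub>R w) (H t) \<partial>Leb T)"
      if H: "H \<in> borel_measurable (Leb T)" "AE t in Leb T. norm (H t) \<le> R" for H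
    proof -
      have i: "integrable (Leb T) (\<lambda>t. blinfun_apply (indicat_real B t *\<^sub>R w) (H t))" if "B \<in> sets lebesgue" for B
        by (rule pairing_integrable[OF simple_borel[OF si[OF that]] H])
      have "(\<integral>t. blinfun_apply (indicat_real (- A) t *\<^sub>R w) (H t) \<partial>Leb T)
          = (\<integral>t. blinfun_apply (indicat_real {min 0 T..max 0 T} t *\<^sub>R w) (H t) - blinfun_apply (indicat_real A t *\<^sub>R w) (H t) \<partial>Leb T)"
        by (rule Bochner_Integration.integral_cong) (auto simp: sp indicator_def)
      also have "\<dots> = (\<integral>t. blinfun_apply (indicat_real {min 0 T..max 0 T} t *\<^sub>R w) (H t) \<partial>Leb T) - (\<integral>t. blinfun_apply (indicat_real A t *\<^sub>R w) (H t) \<partial>Leb T)"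
        using compl by (intro Bochner_Integration.integral_diff i) auto
      finally show ?thesis .
    qed
    show ?case
      using tendsto_diff[OF total[unfolded tested_def] compl.IH[unfolded tested_def]]
      unfolding tested_def eq[OF G] eq[OF G0] .
  next
    case (union A)
    let ?U = "\<Union>i. A i"
    have meas: "?U \<in> sets lebesgue" "\<And>n. (\<Union>i<n. A i) \<in> sets lebesgue" using union by auto
    have step: "tested (\<lambda>t. indicat_real (\<Union>i<n. A i) t *\<^sub>R w)" for n
    proof -
      have "indicat_real (\<Union>i<n. A i) t *\<^sub>R w = (\<Sum>i<n. indicat_real (A i) t *\<^sub>R w)" for t
        using union(1) by (subst indicator_UN_disjoint) (auto simp: disjoint_family_on_def scaleR_left.sum)
      moreover have "tested (\<lambda>t. \<Sum>i<n. indicat_real (A i) t *\<^sub>R w)"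
        using union by (intro tested_sum si) auto
      ultimately show ?thesis by simp
    qed
    have "(\<lambda>n. \<integral>\<^sup>+t. ennreal (norm (indicat_real ?U t * norm w - indicat_real (\<Union>i<n. A i) t * norm w)) \<partial>Leb T) \<longlonglongrightarrow> 0"
    proof (rule nn_integral_dominated_convergence_norm[where w = "\<lambda>t. norm w"])
      have ind: "(\<lambda>t. indicat_real B t * norm w) \<in> borel_measurable (Leb T)" if "B \<in> sets lebesgue" for B
        using borel_measurable_simple_function[OF simple_indicator_scaleR[OF S[OF that], of "norm w"]] by simp
      show "(\<lambda>t. indicat_real ?U t * norm w) \<in> borel_measurable (Leb T)"
        "(\<lambda>t. indicat_real (\<Union>i<n. A i) t * norm w) \<in> borel_measurable (Leb T)" for n
        by (rule ind[OF meas(1)], rule ind[OF meas(2)])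
      show "(\<integral>\<^sup>+t. ennreal (norm w) \<partial>Leb T) < \<infinity>"
        by (simp add: ennreal_mult_eq_top_iff less_top[symmetric] emeasure_eq_measure)
      show "AE t in Leb T. (\<lambda>n. indicat_real (\<Union>i<n. A i) t * norm w) \<longlonglongrightarrow> indicat_real ?U t * norm w"
        by (intro AE_I2 tendsto_mult LIMSEQ_indicator_UN tendsto_const)
    qed (auto simp: indicator_def)
    moreover have "norm (indicat_real ?U t * norm w - indicat_real (\<Union>i<n. A i) t * norm w)
        = norm (indicat_real ?U t *\<^sub>R w - indicat_real (\<Union>i<n. A i) t *\<^sub>R w)" for n t
      by (simp add: abs_mult flip: left_diff_distrib scaleR_diff_left)
    ultimately have lim: "(\<lambda>n. \<integral>\<^sup>+t. ennreal (norm (indicat_real ?U t *\<^sub>R w - indicat_real (\<Union>i<n. A i) t *\<^sub>R w)) \<partial>Leb T) \<longlonglongrightarrow> 0"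
      by simp
    show ?case
    proof (rule tested_approx[OF simple_borel[OF si[OF meas(1)]]])
      fix e :: real assume "0 < e"
      then have "eventually (\<lambda>n. (\<integral>\<^sup>+t. ennreal (norm (indicat_real ?U t *\<^sub>R w - indicat_real (\<Union>i<n. A i) t *\<^sub>R w)) \<partial>Leb T) < ennreal e) sequentially"
        using lim by (intro order_tendstoD(2)) auto
      from eventually_happens[OF this] obtain n
        where n: "(\<integral>\<^sup>+t. ennreal (norm (indicat_real ?U t *\<^sub>R w - indicat_real (\<Union>i<n. A i) t *\<^sub>R w)) \<partial>Leb T) < ennreal e" by auto
      show "\<exists>p. simple_function (Leb T) p \<and> tested p \<and> (\<integral>\<^sup>+t. ennreal (norm (indicat_real ?U t *\<^sub>R w - p t)) \<partial>Leb T) \<le> ennreal e"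
        using n step[of n] si[OF meas(2)[of n], of w] by (intro exI[of _ "\<lambda>t. indicat_real (\<Union>i<n. A i) t *\<^sub>R w"]) auto
    qed
  qed
  have AL: "A \<in> sets lebesgue" using A by (subst (asm) sets_restrict_space_iff) auto
  then obtain B where B: "B \<in> sets borel" "AE x in lebesgue. x \<in> A \<longleftrightarrow> x \<in> B" by (rule lebesgue_AE_eq_borel)
  have BL: "B \<in> sets lebesgue" using B(1) by simp
  have "AE t in Leb T. indicat_real A t *\<^sub>R w = indicat_real B t *\<^sub>R w"
    unfolding AE_lebesgue_on_Ioo_iff using B(2) by eventually_elim (auto simp: indicator_def)
  then show ?thesis by (rule tested_cong_AE[OF si[OF AL] si[OF BL] _ borel[OF B(1)]])
qed

text \<open>The functions converge weakly at every time, so dominated convergence handles them. A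
  velocity integrated against a constant functional over an interval yields an increment of the
  function, which converges; such test functions suffice by
  \<open>tested_if_intervals\<close>.\<close>

theorem weak_star_tendsto_sequence:
  fixes z :: "nat \<Rightarrow> real \<Rightarrow> 'a::{banach, second_countable_topology}" and g :: "real \<Rightarrow> 'a dual"
  assumes refl: "reflexive_space TYPE('a)" and T: "0 < T"
    and z_lip: "\<And>n. K-lipschitz_on {0..T} (z n)" and y_lip: "K-lipschitz_on {0..T} y"
    and R: "\<And>n t. t \<in> {0..T} \<Longrightarrow> norm (z n t) \<le> R"
    and lim: "\<And>t. t \<in> {0..T} \<Longrightarrow> weakly_tendsto (\<lambda>n. z n t) (y t) sequentially"
    and g: "Bochner_integrable (Leb T) g"
  shows "(\<lambda>n. \<integral>t. blinfun_apply (g t) (z n t) \<partial>Leb T) \<longlonglongrightarrow> (\<integral>t. blinfun_apply (g t) (y t) \<partial>Leb T)"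
    and "(\<lambda>n. \<integral>t. blinfun_apply (g t) (weak_deriv T (z n) t) \<partial>Leb T) \<longlonglongrightarrow> (\<integral>t. blinfun_apply (g t) (weak_deriv T y t) \<partial>Leb T)"
proof -
  have sp: "space (Leb T) = {0<..<T}" by (simp add: space_restrict_space)
  have cm: "u \<in> borel_measurable (Leb T)" if "continuous_on {0..T} u" for u :: "real \<Rightarrow> 'a"
    using set_integrable_continuous[OF that] unfolding integrable_Leb_iff[symmetric] by (rule borel_measurable_integrable)
  note gn = Bochner_integrable_norm(1,2)[OF g finite_measure_Leb]
  show "(\<lambda>n. \<integral>t. blinfun_apply (g t) (z n t) \<partial>Leb T) \<longlonglongrightarrow> (\<integral>t. blinfun_apply (g t) (y t) \<partial>Leb T)"
  proof (rule integral_dominated_convergence)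
    show "integrable (Leb T) (\<lambda>t. norm (g t) * R)" using gn(2) by simp
    show "(\<lambda>t. blinfun_apply (g t) (y t)) \<in> borel_measurable (Leb T)"
      using cm[OF lipschitz_on_continuous_on[OF y_lip]] by (rule borel_measurable_bilinear[OF bounded_bilinear_blinfun_apply gn(1)])
    show "(\<lambda>t. blinfun_apply (g t) (z n t)) \<in> borel_measurable (Leb T)" for n
      using cm[OF lipschitz_on_continuous_on[OF z_lip]] by (rule borel_measurable_bilinear[OF bounded_bilinear_blinfun_apply gn(1)])
    show "AE t in Leb T. (\<lambda>n. blinfun_apply (g t) (z n t)) \<longlonglongrightarrow> blinfun_apply (g t) (y t)"
      using lim by (intro AE_I2) (auto simp: sp weakly_tendsto_def)
    show "AE t in Leb T. norm (blinfun_apply (g t) (z n t)) \<le> norm (g t) * R" for n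
    proof (rule AE_I2)
      fix t assume "t \<in> space (Leb T)"
      then have "norm (z n t) \<le> R" by (intro R) (simp add: sp)
      then have "norm (g t) * norm (z n t) \<le> norm (g t) * R" by (intro mult_left_mono) auto
      then show "norm (blinfun_apply (g t) (z n t)) \<le> norm (g t) * R"
        using norm_blinfun[of "g t" "z n t"] by linarith
    qed
  qed
  have zd: "has_deriv_ae T (z n) (weak_deriv T (z n))" for n
    by (rule has_deriv_ae_weak_deriv[OF lipschitz_imp_W1inf(2)[OF refl T z_lip]])
  have yd: "has_deriv_ae T y (weak_deriv T y)"
    by (rule has_deriv_ae_weak_deriv[OF lipschitz_imp_W1inf(2)[OF refl T y_lip]])
  have dm: "p \<in> borel_measurable (Leb T)" if "has_deriv_ae T u p" for u and p :: "real \<Rightarrow> 'a"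
    using has_deriv_aeD(2)[OF that] unfolding integrable_Leb_iff[symmetric] by (rule borel_measurable_integrable)
  have K: "0 \<le> K" using y_lip by (rule lipschitz_on_nonneg)
  have bf: "bounded_family (Leb T) K (\<lambda>n. weak_deriv T (z n)) (weak_deriv T y)"
    by (rule bounded_family.intro; rule finite_measure_Leb K dm[OF zd] dm[OF yd]
        lipschitz_imp_W1inf(3)[OF refl T z_lip] lipschitz_imp_W1inf(3)[OF refl T y_lip])
  interpret bounded_family "Leb T" K "\<lambda>n. weak_deriv T (z n)" "weak_deriv T y" by (rule bf)
  have Icc: "tested (\<lambda>t. indicat_real {a..b} t *\<^sub>R w)" if ab: "a \<le> b" for a b w
  proof (cases "max 0 a \<le> min T b")
    case True
    define s t where "s = max 0 a" and "t = min T b"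
    have st: "0 \<le> s" "s \<le> t" "t \<le> T" using True T by (auto simp: s_def t_def)
    have eq: "(\<integral>r. blinfun_apply (indicat_real {a..b} r *\<^sub>R w) (p r) \<partial>Leb T) = blinfun_apply w (u t - u s)"
      if u: "has_deriv_ae T u p" for u p
    proof -
      have si: "set_integrable lebesgue {0..T} (\<lambda>r. indicat_real {a..b} r *\<^sub>R p r)"
      proof -
        have "set_integrable lebesgue {s..t} p" by (rule has_deriv_aeD(3)[OF u st(1,3)])
        moreover have "indicat_real {s..t} r *\<^sub>R p r = indicat_real {0..T} r *\<^sub>R indicat_real {a..b} r *\<^sub>R p r" for r
          by (auto simp: s_def t_def indicator_def)
        ultimately show ?thesis by (simp add: set_integrable_def)
      qed
      have "(\<integral>r. blinfun_apply (indicat_real {a..b} r *\<^sub>R w) (p r) \<partial>Leb T) = (\<integral>r. blinfun_apply w (indicat_real {a..b} r *\<^sub>R p r) \<partial>Leb T)"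
        by (simp add: blinfun.scaleR_left blinfun.scaleR_right)
      also have "\<dots> = (LINT r:{0..T}|lebesgue. blinfun_apply w (indicat_real {a..b} r *\<^sub>R p r))"
        by (rule integral_Leb[OF set_integrable_bounded_linear(1)[OF blinfun.bounded_linear_right si]])
      also have "\<dots> = blinfun_apply w (LINT r:{0..T}|lebesgue. indicat_real {a..b} r *\<^sub>R p r)"
        by (rule set_integrable_bounded_linear(2)[OF blinfun.bounded_linear_right si])
      also have "(LINT r:{0..T}|lebesgue. indicat_real {a..b} r *\<^sub>R p r) = (LINT r:{s..t}|lebesgue. p r)"
        unfolding set_lebesgue_integral_def by (rule Bochner_Integration.integral_cong) (auto simp: s_def t_def indicator_def)
      also have "\<dots> = u t - u s" by (rule has_deriv_aeD(4)[OF u st, symmetric])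
      finally show ?thesis .
    qed
    have "weakly_tendsto (\<lambda>n. z n t - z n s) (y t - y s) sequentially"
      using st by (intro weakly_tendsto_diff lim) auto
    then show ?thesis unfolding tested_def eq[OF zd] eq[OF yd] weakly_tendsto_def by blast
  next
    case False
    then have z0: "(\<integral>r. blinfun_apply (indicat_real {a..b} r *\<^sub>R w) (p r) \<partial>Leb T) = (\<integral>r. 0 \<partial>Leb T)" for p
      by (intro Bochner_Integration.integral_cong) (auto simp: sp indicator_def)
    show ?thesis unfolding tested_def z0 by simp
  qed
  have "tested g"
    by (rule tested_Bochner_integrable[OF g tested_if_intervals[OF bf Icc]])
  then show "(\<lambda>n. \<integral>t. blinfun_apply (g t) (weak_deriv T (z n) t) \<partial>Leb T) \<longlonglongrightarrow> (\<integral>t. blinfun_apply (g t) (weak_deriv T y t) \<partial>Leb T)"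
    unfolding tested_def .
qed

section \<open>The approximation theorem\<close>

text \<open>A sum of two nonnegative terms vanishes only if both do. Finiteness of
  \<open>chi_on\<close> puts \<open>y 0 - y0\<close> into \<open>Y\<close>, so the term equals
  \<open>chi\<close>, whose only zero is the origin.\<close>

lemma Fh_fun_eq_0_imp:
  assumes f: "closed_sublinear f" and chi: "\<forall>y. chi A y \<ge> 0" "\<forall>y. chi A y = 0 \<longleftrightarrow> y = 0"
    and zero: "Fh_fun T Y f A l y0 y = 0"
  shows "Fenchel_integral T f A l y = 0" "y 0 = y0"
proof -
  have sum: "Fenchel_integral T f A l y + chi_on Y A (y 0 - y0) = 0"
    using zero by (auto simp: Fh_fun_def split: if_splits)
  have nn: "0 \<le> Fenchel_integral T f A l y" by (rule Fenchel_integral_nonneg[OF f])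
  have chi_on: "chi_on Y A x = (if x \<in> Y then ereal (chi A x) else \<infinity>)" for x
    by (simp add: chi_on_def phi_on_def chi_def)
  have "y 0 - y0 \<in> Y"
    using sum nn by (cases "Fenchel_integral T f A l y") (auto simp: chi_on split: if_splits)
  then have sum': "Fenchel_integral T f A l y + ereal (chi A (y 0 - y0)) = 0"
    using sum by (simp add: chi_on)
  have "0 \<le> chi A (y 0 - y0)" using chi(1) by blast
  then have "Fenchel_integral T f A l y = 0 \<and> chi A (y 0 - y0) = 0"
    using sum' nn by (cases "Fenchel_integral T f A l y") (auto simp: zero_ereal_def)
  then show "Fenchel_integral T f A l y = 0" "y 0 = y0" using chi(2) by auto
qed

theorem theorem5p3:
  fixes T \<alpha> :: real
    and \<psi> :: "'a::{banach, second_countable_topology} \<Rightarrow> ereal"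
    and A :: "'a \<Rightarrow>\<^sub>L 'a dual"
    and l :: "real \<Rightarrow> 'a dual"
    and y0 :: 'a
    and Yh :: "real \<Rightarrow> 'a set"
    and \<psi>h :: "real \<Rightarrow> 'a \<Rightarrow> ereal"
    and lh :: "real \<Rightarrow> real \<Rightarrow> 'a dual"
    and y0h :: "real \<Rightarrow> 'a"
    and yh :: "real \<Rightarrow> real \<Rightarrow> 'a"
  assumes T_pos: "T > 0"
    and reflexive: "reflexive_space TYPE('a)"
    and psi_nonneg: "\<forall>y. \<psi> y \<ge> 0"
    and psi: "proper_fun \<psi>" "convex_fun \<psi>" "lsc_fun \<psi>" "pos_homogeneous \<psi>"
    and A_sym: "\<forall>u v. blinfun_apply (blinfun_apply A u) v = blinfun_apply (blinfun_apply A v) u"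
    and alpha_pos: "\<alpha> > 0"
    and coercive: "\<forall>y\<in>eff_dom \<psi>. phi A y \<ge> \<alpha> / 2 * (norm y)\<^sup>2"
    and chi: "\<forall>y. chi A y \<ge> 0" "\<forall>y. chi A y = 0 \<longleftrightarrow> y = 0"
    and l: "l \<in> W1inf T"
    and y0: "y0 \<in> eff_dom \<psi>" "l 0 - blinfun_apply A y0 \<in> subdifferential \<psi> 0"
    and Yh: "\<forall>h>0. subspace (Yh h) \<and> closed (Yh h)"
      "closure (\<Union>h\<in>{0<..}. Yh h) = UNIV"
    and psih: "\<forall>h>0. convex_fun (\<psi>h h) \<and> proper_fun (\<psi>h h) \<and> lsc_fun (\<psi>h h) \<and>
      pos_homogeneous (\<psi>h h)"
    and psih_Mosco: "Mosco_tendsto \<psi>h \<psi> (at_right 0)"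
    and coercive_h: "\<forall>h>0. \<forall>y \<in> {u - v | u v. u \<in> eff_dom (\<psi>h h) \<and> v \<in> eff_dom (\<psi>h h)}.
      phi A y \<ge> \<alpha> / 2 * (norm y)\<^sup>2"
    and lh_lipschitz: "\<exists>L. \<forall>h>0. L-lipschitz_on {0..T} (lh h)"
    and lh_tendsto: "\<forall>t\<in>{0..T}. ((\<lambda>h. lh h t) \<longlongrightarrow> l t) (at_right 0)"
    and y0h: "\<forall>h>0. y0h h \<in> Yh h" "(y0h \<longlongrightarrow> y0) (at_right 0)"
    and yh: "\<forall>h>0. yh h \<in> W11 T \<and> Fh_fun T (Yh h) (\<psi>h h) A (lh h) (y0h h) (yh h) = 0"
  shows "(\<forall>h>0. yh h \<in> W1inf T) \<and>
    (\<exists>y \<in> W1inf T. weak_star_tendsto_W1inf T yh y (at_right 0) \<and> F_fun T \<psi> A l y0 y = 0)"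
proof -
  have sym: "\<And>u v. blinfun_apply (blinfun_apply A u) v = blinfun_apply (blinfun_apply A v) u"
    using A_sym by blast
  have cs: "closed_sublinear \<psi>" using psi by (simp add: closed_sublinear_def)
  have csh: "closed_sublinear (\<psi>h h)" if "0 < h" for h
    using psih that by (simp add: closed_sublinear_def)
  obtain L where L: "\<And>h. 0 < h \<Longrightarrow> L-lipschitz_on {0..T} (lh h)" using lh_lipschitz by blast
  define K where K: "K = 4 * L / \<alpha>"
  have lhc: "continuous_on {0..T} (lh h)" if "0 < h" for h
    by (rule lipschitz_on_continuous_on[OF L[OF that]])
  have init: "yh h 0 = y0h h" and evol: "evolution T (\<psi>h h) A (lh h) (yh h) (weak_deriv T (yh h))" if h: "0 < h" for h
  proof -
    have W: "yh h \<in> W11 T" and zero: "Fh_fun T (Yh h) (\<psi>h h) A (lh h) (y0h h) (yh h) = 0" using yh h by auto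
    show "yh h 0 = y0h h" by (rule Fh_fun_eq_0_imp(2)[OF csh[OF h] chi zero])
    show "evolution T (\<psi>h h) A (lh h) (yh h) (weak_deriv T (yh h))"
      by (rule Fenchel_integral_eq_0_imp_evolution[OF T_pos csh[OF h] lhc[OF h] W Fh_fun_eq_0_imp(1)[OF csh[OF h] chi zero]])
  qed
  have coh: "\<alpha> / 2 * (norm (u - v))\<^sup>2 \<le> phi A (u - v)" if "0 < h" "u \<in> eff_dom (\<psi>h h)" "v \<in> eff_dom (\<psi>h h)" for h u v
    using coercive_h that by blast
  have lip: "K-lipschitz_on {0..T} (yh h)" if h: "0 < h" for h
    unfolding K
  proof (rule evolution_lipschitz[OF csh[OF h] T_pos lhc[OF h] sym evol[OF h] L[OF h] alpha_pos])
    fix x assume x: "x \<in> eff_dom (\<psi>h h)"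
    have "0 \<in> eff_dom (\<psi>h h)" by (simp add: eff_dom_def closed_sublinear_zero[OF csh[OF h]])
    from coh[OF h x this] show "\<alpha> / 2 * (norm x)\<^sup>2 \<le> phi A x" by simp
  qed
  have K0: "0 \<le> K" using lip[of 1] lipschitz_on_nonneg by fastforce
  have fl: "filterlim h (at_right 0) sequentially" if "\<And>n. 0 < h n" "h \<longlonglongrightarrow> 0" for h :: "nat \<Rightarrow> real"
    unfolding filterlim_at using that by (auto intro!: always_eventually simp: less_imp_neq[OF that(1), symmetric])
  have bound: "\<exists>R. \<forall>n. \<forall>t\<in>{0..T}. norm (yh (h n) t) \<le> R" if h: "\<And>n. 0 < h n" "h \<longlonglongrightarrow> 0" for h :: "nat \<Rightarrow> real"
  proof -
    have "(\<lambda>n. y0h (h n)) \<longlonglongrightarrow> y0" by (rule filterlim_compose[OF y0h(2) fl[OF h]])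
    from convergent_imp_Bseq[OF convergentI[OF this]] obtain B where B: "\<And>n. norm (y0h (h n)) \<le> B"
      unfolding Bseq_def by blast
    have "norm (yh (h n) t) \<le> B + K * T" if t: "t \<in> {0..T}" for n t
    proof -
      have "norm (yh (h n) t - yh (h n) 0) \<le> K * t"
        using lipschitz_onD[OF lip[OF h(1)], of t 0 n] t T_pos by (simp add: dist_norm)
      also have "\<dots> \<le> K * T" using t K0 by (intro mult_left_mono) auto
      finally show ?thesis
        using B[of n] norm_triangle_sub[of "yh (h n) t" "yh (h n) 0"] init[OF h(1)[of n]] by simp
    qed
    then show ?thesis by blast
  qed
  have lcont: "continuous_on {0..T} l" using l by (simp add: W1inf_def)
  \<comment> \<open>The properties that single out the limit. The last one makes
    \<open>(y' t - y0) - (y t - y0)\<close>, for two solutions, a difference of elements of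
    \<open>eff_dom \<psi>\<close>, where the limit is coercive.\<close>
  define solution where "solution = (\<lambda>y. (\<exists>v. evolution T \<psi> A l y v) \<and> y 0 = y0 \<and> K-lipschitz_on {0..T} y \<and>
    (\<forall>t\<in>{0..T}. y t - y0 \<in> eff_dom \<psi>))"
  \<comment> \<open>The coercivity statement does not involve the subsequence; it is carried along
    because it is inherited from the approximations.\<close>
  have seq: "(\<exists>r y. strict_mono (r :: nat \<Rightarrow> nat) \<and> solution y \<and>
      (\<forall>t\<in>{0..T}. weakly_tendsto (\<lambda>k. yh (h (r k)) t) (y t) sequentially)) \<and>
      (\<forall>u\<in>eff_dom \<psi>. \<forall>v\<in>eff_dom \<psi>. \<alpha> / 2 * (norm (u - v))\<^sup>2 \<le> phi A (u - v))"
    if h: "\<And>n. 0 < h n" "h \<longlonglongrightarrow> 0" for h :: "nat \<Rightarrow> real"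
  proof -
    obtain r1 :: "nat \<Rightarrow> nat" where r1: "strict_mono r1" "\<And>m n. m < n \<Longrightarrow> h (r1 n) < h (r1 m)"
      by (rule strictly_decreasing_subsequence[OF h]) blast
    obtain R where R: "\<And>n t. t \<in> {0..T} \<Longrightarrow> norm (yh (h n) t) \<le> R" using bound[OF h] by blast
    obtain r2 y where r2: "strict_mono r2" and y: "\<And>t. t \<in> {0..T} \<Longrightarrow> weakly_tendsto (\<lambda>k. yh (h (r1 (r2 k))) t) (y t) sequentially"
      using weak_Arzela_Ascoli[OF reflexive T_pos, of K "\<lambda>n. yh (h (r1 n))" R, OF lip[OF h(1)] R] by blast
    define r where "r = r1 \<circ> r2"
    have r: "strict_mono r" unfolding r_def using r1(1) r2 by (rule strict_mono_o)
    define s where "s = (\<lambda>n. h (r n))"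
    have s_pos: "0 < s n" for n by (simp add: s_def h(1))
    have s_lim: "s \<longlonglongrightarrow> 0"
      using LIMSEQ_subseq_LIMSEQ[OF h(2) r] by (simp add: s_def o_def)
    have s_dec: "s n < s m" if "m < n" for m n
      unfolding s_def r_def o_def using strict_monoD[OF r2 that] by (rule r1(2))
    have y': "weakly_tendsto (\<lambda>n. yh (s n) t) (y t) sequentially" if "t \<in> {0..T}" for t
      using y[OF that] by (simp add: s_def r_def)
    interpret limit_passage T \<alpha> L \<psi> A l y0 "\<lambda>n. \<psi>h (s n)" "\<lambda>n. lh (s n)" "\<lambda>n. yh (s n)" "\<lambda>n. weak_deriv T (yh (s n))" y
    proof
      show "0 < T" "0 < \<alpha>" "reflexive_space TYPE('a)" "closed_sublinear \<psi>" by (fact T_pos alpha_pos reflexive cs)+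
      show "closed_sublinear (\<psi>h (s n))" for n by (rule csh[OF s_pos])
      show "blinfun_apply (blinfun_apply A u) v = blinfun_apply (blinfun_apply A v) u" for u v by (rule sym)
      show "eventually (\<lambda>n. c < \<psi>h (s n) (u n)) sequentially"
        if "weakly_tendsto u x sequentially" "c < \<psi> x" for u x c
        by (rule Mosco_lower_sequence[OF psih_Mosco s_pos s_lim s_dec that])
      show "\<exists>v. v \<longlonglongrightarrow> x \<and> (\<forall>c. \<psi> x < c \<longrightarrow> eventually (\<lambda>n. \<psi>h (s n) (v n) < c) sequentially)" for x
        by (rule Mosco_recovery_sequence[OF psih_Mosco fl[OF s_pos s_lim]])
      show "\<alpha> / 2 * (norm (u - v))\<^sup>2 \<le> phi A (u - v)" if "u \<in> eff_dom (\<psi>h (s n))" "v \<in> eff_dom (\<psi>h (s n))" for n u v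
        by (rule coh[OF s_pos that])
      show "L-lipschitz_on {0..T} (lh (s n))" for n by (rule L[OF s_pos])
      show "(\<lambda>n. lh (s n) t) \<longlonglongrightarrow> l t" if "t \<in> {0..T}" for t
        using lh_tendsto that by (intro filterlim_compose[OF _ fl[OF s_pos s_lim]]) blast
      show "evolution T (\<psi>h (s n)) A (lh (s n)) (yh (s n)) (weak_deriv T (yh (s n)))" for n by (rule evol[OF s_pos])
      show "(\<lambda>n. yh (s n) 0) \<longlonglongrightarrow> y0"
        unfolding init[OF s_pos] by (rule filterlim_compose[OF y0h(2) fl[OF s_pos s_lim]])
      show "weakly_tendsto (\<lambda>n. yh (s n) t) (y t) sequentially" if "t \<in> {0..T}" for t by (rule y'[OF that])
    qed
    obtain v where v: "evolution T \<psi> A l y v" using limit_evolution by blast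
    have d: "has_deriv_ae T y v" using v by (simp add: evolution_def)
    have "solution y"
      unfolding solution_def using v y_init y_lip limit_increment_finite[OF d]
      by (auto simp: K K_def)
    then show ?thesis using r y' limit_coercive unfolding s_def by blast
  qed
  \<comment> \<open>The sequence \<open>1 / (n + 1)\<close> produces one candidate; uniqueness makes
    every other subsequential limit agree with it.\<close>
  have inv: "1 / real (Suc n) > 0" "(\<lambda>n. 1 / real (Suc n)) \<longlonglongrightarrow> 0" for n
    using LIMSEQ_inverse_real_of_nat by (simp_all add: inverse_eq_divide)
  obtain y where y: "solution y" using seq[OF inv] by blast
  have co: "\<alpha> / 2 * (norm (u - v))\<^sup>2 \<le> phi A (u - v)" if "u \<in> eff_dom \<psi>" "v \<in> eff_dom \<psi>" for u v
    using seq[OF inv] that by blast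
  have unique: "y' t = y t" if y': "solution y'" and t: "t \<in> {0..T}" for y' t
  proof -
    obtain v v' where v: "evolution T \<psi> A l y v" "evolution T \<psi> A l y' v'" using y y' unfolding solution_def by blast
    show ?thesis
    proof (rule evolution_unique[OF cs T_pos lcont sym v(2,1) _ alpha_pos _ t])
      show "y' 0 = y 0" using y y' by (simp add: solution_def)
      fix t assume "t \<in> {0..T}"
      then have "y' t - y0 \<in> eff_dom \<psi>" "y t - y0 \<in> eff_dom \<psi>" using y y' by (auto simp: solution_def)
      from co[OF this] show "\<alpha> / 2 * (norm (y' t - y t))\<^sup>2 \<le> phi A (y' t - y t)" by simp
    qed
  qed
  \<comment> \<open>Subsequence principle: a subsequence staying at distance \<open>e\<close> would
    have a further subsequence converging to a solution, hence to \<open>y t\<close>.\<close>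
  have weak: "weakly_tendsto (\<lambda>n. yh (h n) t) (y t) sequentially"
    if h: "\<And>n. 0 < h n" "h \<longlonglongrightarrow> 0" and t: "t \<in> {0..T}" for h :: "nat \<Rightarrow> real" and t
    unfolding weakly_tendsto_def
  proof (intro allI tendstoI, rule ccontr)
    fix w :: "'a dual" and e :: real
    assume e: "0 < e" and "\<not> eventually (\<lambda>n. dist (blinfun_apply w (yh (h n) t)) (blinfun_apply w (y t)) < e) sequentially"
    from not_eventually_sequentiallyD[OF this(2)] obtain p :: "nat \<Rightarrow> nat" where p: "strict_mono p"
      and far: "\<And>n. \<not> dist (blinfun_apply w (yh (h (p n)) t)) (blinfun_apply w (y t)) < e" by blast
    have hp: "\<And>n. 0 < h (p n)" "(\<lambda>n. h (p n)) \<longlonglongrightarrow> 0"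
      using h(1) LIMSEQ_subseq_LIMSEQ[OF h(2) p] by (simp_all add: o_def)
    obtain r y' where "solution y'" and lim: "\<forall>t\<in>{0..T}. weakly_tendsto (\<lambda>k. yh (h (p (r k))) t) (y' t) sequentially"
      using seq[OF hp] by blast
    then have "weakly_tendsto (\<lambda>k. yh (h (p (r k))) t) (y t) sequentially" using unique[of y' t] t by metis
    then have "(\<lambda>k. blinfun_apply w (yh (h (p (r k))) t)) \<longlonglongrightarrow> blinfun_apply w (y t)"
      unfolding weakly_tendsto_def by blast
    then have "eventually (\<lambda>k. dist (blinfun_apply w (yh (h (p (r k))) t)) (blinfun_apply w (y t)) < e) sequentially"
      using e by (rule tendstoD)
    from eventually_happens[OF this] show False using far by auto
  qed
  have y_lip: "K-lipschitz_on {0..T} y" using y by (simp add: solution_def)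
  have star: "weak_star_tendsto_W1inf T yh y (at_right 0)"
    unfolding weak_star_tendsto_W1inf_def
  proof (intro allI impI)
    fix g :: "real \<Rightarrow> 'a dual" assume g: "Bochner_integrable (Leb T) g"
    have *: "(\<lambda>n. \<integral>t. blinfun_apply (g t) (yh (h n) t) \<partial>Leb T) \<longlonglongrightarrow> (\<integral>t. blinfun_apply (g t) (y t) \<partial>Leb T)"
      "(\<lambda>n. \<integral>t. blinfun_apply (g t) (weak_deriv T (yh (h n)) t) \<partial>Leb T) \<longlonglongrightarrow> (\<integral>t. blinfun_apply (g t) (weak_deriv T y t) \<partial>Leb T)"
      if h: "\<And>n. 0 < h n" "h \<longlonglongrightarrow> 0" for h :: "nat \<Rightarrow> real"
    proof -
      obtain R where R: "\<And>n t. t \<in> {0..T} \<Longrightarrow> norm (yh (h n) t) \<le> R" using bound[OF h] by blast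
      note ws = weak_star_tendsto_sequence[OF reflexive T_pos lip[OF h(1)] y_lip R weak[OF h] g]
      show "(\<lambda>n. \<integral>t. blinfun_apply (g t) (yh (h n) t) \<partial>Leb T) \<longlonglongrightarrow> (\<integral>t. blinfun_apply (g t) (y t) \<partial>Leb T)"
        by (rule ws(1))
      show "(\<lambda>n. \<integral>t. blinfun_apply (g t) (weak_deriv T (yh (h n)) t) \<partial>Leb T) \<longlonglongrightarrow> (\<integral>t. blinfun_apply (g t) (weak_deriv T y t) \<partial>Leb T)"
        by (rule ws(2))
    qed
    \<comment> \<open>The one-sided limit in \<open>h\<close> amounts to the limits along all
      positive null sequences.\<close>
    show "((\<lambda>h. \<integral>t. blinfun_apply (g t) (yh h t) \<partial>Leb T) \<longlongrightarrow> (\<integral>t. blinfun_apply (g t) (y t) \<partial>Leb T)) (at_right 0) \<and>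
      ((\<lambda>h. \<integral>t. blinfun_apply (g t) (weak_deriv T (yh h) t) \<partial>Leb T) \<longlongrightarrow> (\<integral>t. blinfun_apply (g t) (weak_deriv T y t) \<partial>Leb T)) (at_right 0)"
      unfolding tendsto_at_iff_sequentially o_def using * by auto
  qed
  have "F_fun T \<psi> A l y0 y = 0"
  proof -
    obtain v where v: "evolution T \<psi> A l y v" using y unfolding solution_def by blast
    \<comment> \<open>\<open>v\<close> is some density of \<open>y\<close> and
      \<open>weak_deriv\<close> a chosen representative; they agree almost everywhere.\<close>
    have "AE t in Leb T. stable \<psi> (l t - blinfun_apply A (y t)) \<and>
      \<psi> (weak_deriv T y t) = ereal (blinfun_apply (l t - blinfun_apply A (y t)) (weak_deriv T y t))"
    proof -
      have d: "has_deriv_ae T y v" and ae: "AE t in Leb T. \<psi> (v t) = ereal (blinfun_apply (l t - blinfun_apply A (y t)) (v t))"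
        and st: "\<And>t. t \<in> {0..T} \<Longrightarrow> stable \<psi> (l t - blinfun_apply A (y t))"
        using v by (auto simp: evolution_def)
      have "AE t in Leb T. t \<in> {0..T}"
        by (intro AE_I2) (simp add: space_restrict_space)
      then show ?thesis
        using ae weak_deriv_AE_eq[OF T_pos d] by eventually_elim (simp add: st)
    qed
    then have "Fenchel_integral T \<psi> A l y = 0" by (rule Fenchel_integral_eq_0I[OF cs])
    moreover have "chi A (y 0 - y0) = 0" using y chi(2) by (simp add: solution_def)
    ultimately show ?thesis by (simp add: F_fun_def)
  qed
  moreover have "y \<in> W1inf T" by (rule lipschitz_imp_W1inf(1)[OF reflexive T_pos y_lip])
  moreover have "\<forall>h>0. yh h \<in> W1inf T" using lipschitz_imp_W1inf(1)[OF reflexive T_pos lip] by blast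
  ultimately show ?thesis using star by blast
qed

end
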